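(* Let $n\ge3$. The closure in $\mathscr{A}_n^{\mathbb{Z}}$ (product topology) of the set of cutting sequences of bi-infinite linear trajectories in the regular $2n$-gon coincides with the set of infinitely coherent words in $\mathscr{A}_n^{\mathbb{Z}}$. Equivalently, this closure is $$\bigcap_{k\in\mathbb{N}}\ \bigcup_{\substack{0\le s_0\le 2n-1\\ 1\le s_1,\dots,s_k\le 2n-1}}\left\{\mathfrak{g}^{s_0}_{s_1}\mathfrak{g}^{s_1}_{s_2}\cdots\mathfrak{g}^{s_{k-2}}_{s_{k-1}}\mathfrak{g}^{s_{k-1}}_{s_k}u\ :\ u\in\mathscr{A}_{s_k}\right\},$$ where, for $0\le s\le 2n-1$, $\mathscr{A}_s$ denotes the set of bi-infinite words admissible in diagram $\mathscr{D}^n_s$.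
   Context: **Polygon and cutting sequences.** Let $O_{2n}\subset\mathbb{R}^2$ be a regular $2n$-gon centred at the origin with two horizontal sides, opposite sides identified by translation. The pairs of opposite sides are labelled in clockwise order $L_1,\dots,L_n$, with $L_1$ the horizontal pair; $\mathscr{A}_n=\{L_1,\dots,L_n\}$. A (bi-infinite) linear trajectory moves with constant velocity; when it hits a side it re-enters $O_{2n}$ at the corresponding point of the opposite side with the same velocity; it never hits a vertex and is defined for all times. Its cutting sequence is the bi-infinite word in $\mathscr{A}_n$ of labels of sides crossed (considered up to shift). **Diagrams.** For $0\le i\le 2n-1$ let $\nu_i$ be the isometry of $O_{2n}$ acting on directions by $\theta\mapsto\theta-i\pi/2n$ (rotation) if $i$ is even and by $\theta\mapsto(i+1)\pi/2n-\theta$ (reflection) if $i$ is odd; it maps $[i\pi/2n,(i+1)\pi/2n]$ to $[0,\pi/2n]$. Let $\pi_i$ be the permutation of $\mathscr{A}_n$ induced by $\nu_i$ (i.e. $\pi_i(L)=L'$ iff $\nu_i$ maps sides labelled $L$ to sides labelled $L'$); explicitly, with indices mod $n$, $\pi_{2m}(L_j)=L_{j+m}$ and $\pi_{2m-1}(L_j)=L_{2-m-j}$. Permutations act on words letter by letter. The diagram $\mathscr{D}^n_0$ has vertices $L_1,\dots,L_n$ and transitions $L_iL_j$ for $i+j\in\{n+1,n+2\}$ (for $n=2k$ or $n=2k+1$ it is the path $L_1-L_n-L_2-L_{n-1}-\cdots$ with two-way edges, ending at $L_{k+1}$, which carries a loop). A word is admissible in $\mathscr{D}^n_0$ (diagram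 $0$) if all its pairs of consecutive letters are transitions of $\mathscr{D}^n_0$; it is admissible in diagram $i$ ($\mathscr{D}^n_i$) if $\pi_i\cdot w$ is admissible in diagram $0$; admissible if admissible in some diagram. **Derivation.** A letter occurrence in a word is sandwiched if the letters immediately before and after it are equal; $L'$-sandwiched if both equal $L'$. The derived sequence $w'$ of a bi-infinite word keeps only the sandwiched letters. $w$ is derivable if $w,w'$ are admissible; infinitely derivable if $w$ and all its iterated derived sequences are derivable. **Groups.** Let $\pi_n^{\uparrow}(L_j)=L_{n+1-j}$ for $1\le j\le n$, and $\pi_n^{\rightarrow}(L_1)=L_1$, $\pi_n^{\rightarrow}(L_j)=L_{n+2-j}$ for $2\le j\le n$. For $0\le l\le n-1$ the group $G^n_l$ consists of: $\pi_n^{\uparrow}(L_j)$-sandwiched $L_j$ for $1\le j\le n-l$, and $\pi_n^{\rightarrow}(L_j)$-sandwiched $L_j$ for $n-l<j\le n$. **Coherence.** A derivable $w\in\mathscr{A}_n^{\mathbb{Z}}$ is coherent with respect to $(i,j)$, $i,j\in\{0,\dots,2n-1\}$, if $w$ is admissible in diagram $i$ and, with $n(w):=\pi_i\cdot w$: there is $l\in\{0,\dots,n-1\}$ such that all sandwiched letters occurring in $n(w)$ belong to $G^n_l$; $n(w)'$ is admissible in diagram $j$ with $j\in\{1,\dots,2n-1\}$; and $l=[j/2]$ (integer part). **Infinite coherence.** Given $w$ and a sequence $s=\{s_k\}_{k\in\mathbb{N}}$ with $s_0\in\{0,\dots,2n-1\}$, $s_k\in\{1,\dots,2n-1\}$ for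 $k\ge1$, put $w_0:=w$, $w_k:=(\pi_{s_{k-1}}\cdot w_{k-1})'$. $w$ is infinitely coherent if it is infinitely derivable and there is such an $s$ for which each $w_k$ is coherent with respect to $(s_k,s_{k+1})$. **Generation operators.** For $1\le k\le 2n-1$ and a letter $L$ let $p_k(L)$ be the letter such that "$p_k(L)$-sandwiched $L$" is in $G^n_{[k/2]}$. For each transition $LL'$ admissible in diagram $k$, the interpolating word $w^k_{LL'}$ is the unique (possibly empty) finite word such that $L\,w^k_{LL'}\,L'$ is admissible in diagram $0$, has second letter $p_k(L)$ and penultimate letter $p_k(L')$, and no letter of $w^k_{LL'}$ is sandwiched in $L\,w^k_{LL'}\,L'$. For $u=\dots M_1M_2M_3\dots$ admissible in diagram $k$, $\mathfrak{g}^0_ku:=\dots M_1w^k_{M_1M_2}M_2w^k_{M_2M_3}M_3\dots$ and $\mathfrak{g}^i_ku:=\pi_i^{-1}\cdot\mathfrak{g}^0_ku$, $0\le i\le 2n-1$. *)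

theory Defs
  imports "HOL-Analysis.Analysis"
begin

text \<open>
  The letter \<open>L\<^sub>j\<close> is the natural number \<open>j \<in> {1..n}\<close>, and a bi-infinite word is a function
  \<open>int \<Rightarrow> nat\<close> with values in \<open>{1..n}\<close>. Operations whose result is only determined up to shift
  either pick one indexing (\<open>derived\<close>; every notion applied to its result is invariant under
  shifts) or return the set of all indexings of the result (\<open>gen\<close>).
\<close>

type_synonym biword = "int \<Rightarrow> nat"

definition words :: "nat \<Rightarrow> biword set" where
  "words n = {w. range w \<subseteq> {1..n}}"


section \<open>The polygon and cutting sequences\<close>

text \<open>
  The plane is \<^typ>\<open>complex\<close> and \<open>r\<close> is the circumradius. Vertices and sides are numbered clockwise;
  the midpoint of side \<open>m\<close> has argument \<open>pi/2 - m pi/n\<close>, so sides \<open>0\<close> (top) and \<open>n\<close> (bottom) are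
  horizontal, and side \<open>m + n\<close> is opposite to side \<open>m\<close>.
\<close>

definition vertex :: "nat \<Rightarrow> real \<Rightarrow> nat \<Rightarrow> complex" where
  "vertex n r m = complex_of_real r * cis (pi / 2 + pi / (2 * real n) - real m * pi / real n)"

definition regular_polygon :: "nat \<Rightarrow> real \<Rightarrow> complex set" where
  "regular_polygon n r = convex hull (vertex n r ` {..<2 * n})"

definition open_side :: "nat \<Rightarrow> real \<Rightarrow> nat \<Rightarrow> complex set" where
  "open_side n r m = open_segment (vertex n r m) (vertex n r (Suc m))"

definition side_label :: "nat \<Rightarrow> nat \<Rightarrow> nat" where
  "side_label n m = m mod n + 1"

text \<open>
  The translation that carries side \<open>m\<close> to the opposite side sends \<open>vertex m\<close> to
  \<open>vertex (m + n + 1) = - vertex (m + 1)\<close>.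
\<close>

definition glue :: "nat \<Rightarrow> real \<Rightarrow> nat \<Rightarrow> complex \<Rightarrow> complex" where
  "glue n r m z = z - (vertex n r m + vertex n r (Suc m))"

text \<open>
  \<open>\<gamma>\<close> is the trajectory with velocity \<open>v\<close>, and \<open>T k\<close> is the time at which it hits the side
  \<open>\<sigma> k\<close>. At a hitting time, \<open>\<gamma>\<close> takes the value after the identification, i.e. the point of
  re-entry on the opposite side.
\<close>

definition linear_trajectory ::
    "nat \<Rightarrow> real \<Rightarrow> complex \<Rightarrow> (real \<Rightarrow> complex) \<Rightarrow> (int \<Rightarrow> real) \<Rightarrow> (int \<Rightarrow> nat) \<Rightarrow> bool" where
  "linear_trajectory n r v \<gamma> T \<sigma> \<longleftrightarrow>
     v \<noteq> 0 \<and> strict_mono T \<and> (\<forall>t. \<exists>k. T k \<le> t \<and> t < T (k + 1)) \<and>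
     (\<forall>k. \<sigma> k < 2 * n \<and>
       (\<forall>t\<in>{T k..<T (k + 1)}. \<gamma> t = \<gamma> (T k) + (t - T k) *\<^sub>R v) \<and>
       (\<forall>t\<in>{T k<..<T (k + 1)}. \<gamma> t \<in> interior (regular_polygon n r)) \<and>
       (let q = \<gamma> (T k) + (T (k + 1) - T k) *\<^sub>R v in
          q \<in> open_side n r (\<sigma> (k + 1)) \<and> \<gamma> (T (k + 1)) = glue n r (\<sigma> (k + 1)) q))"

definition cutting_sequences :: "nat \<Rightarrow> real \<Rightarrow> biword set" where
  "cutting_sequences n r =
     {w. \<exists>v \<gamma> T \<sigma>. linear_trajectory n r v \<gamma> T \<sigma> \<and> (\<forall>k. w k = side_label n (\<sigma> k))}"


section \<open>Diagrams and admissibility\<close>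

text \<open>\<open>letter n z\<close> is the representative in \<open>{1..n}\<close> of the index \<open>z\<close> taken modulo \<open>n\<close>.\<close>

definition letter :: "nat \<Rightarrow> int \<Rightarrow> nat" where
  "letter n z = nat ((z - 1) mod int n) + 1"

text \<open>
  The permutation of the labels induced by \<open>\<nu>\<^sub>i\<close>: for \<open>i = 2 m\<close> it is \<open>j \<mapsto> j + m\<close>, for
  \<open>i = 2 m - 1\<close> it is \<open>j \<mapsto> 2 - m - j\<close>, with indices modulo \<open>n\<close>. Outside \<open>{1..n}\<close> it is
  the identity, so that it is a bijection on \<^typ>\<open>nat\<close> and \<open>inv (dperm n i)\<close> is its inverse.
\<close>

definition dperm :: "nat \<Rightarrow> nat \<Rightarrow> nat \<Rightarrow> nat" where
  "dperm n i j =
     (if j \<notin> {1..n} then j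
      else if even i then letter n (int j + int (i div 2))
      else letter n (2 - int ((i + 1) div 2) - int j))"

definition transition0 :: "nat \<Rightarrow> nat \<Rightarrow> nat \<Rightarrow> bool" where
  "transition0 n a b \<longleftrightarrow> a \<in> {1..n} \<and> b \<in> {1..n} \<and> a + b \<in> {n + 1, n + 2}"

definition admissible0 :: "nat \<Rightarrow> biword \<Rightarrow> bool" where
  "admissible0 n w \<longleftrightarrow> w \<in> words n \<and> (\<forall>m. transition0 n (w m) (w (m + 1)))"

definition admissible_in :: "nat \<Rightarrow> nat \<Rightarrow> biword \<Rightarrow> bool" where
  "admissible_in n i w \<longleftrightarrow> w \<in> words n \<and> admissible0 n (dperm n i \<circ> w)"

definition admissible :: "nat \<Rightarrow> biword \<Rightarrow> bool" where
  "admissible n w \<longleftrightarrow> (\<exists>i\<in>{0..2 * n - 1}. admissible_in n i w)"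

definition admissible_words :: "nat \<Rightarrow> nat \<Rightarrow> biword set" where
  "admissible_words n i = {w \<in> words n. admissible_in n i w}"


section \<open>Derivation\<close>

definition sandwiched :: "biword \<Rightarrow> int \<Rightarrow> bool" where
  "sandwiched w m \<longleftrightarrow> w (m - 1) = w (m + 1)"

text \<open>
  An increasing enumeration of the sandwiched positions by \<^typ>\<open>int\<close>, if it exists, is unique up to
  shift. It exists for every admissible word: a word in diagram \<open>0\<close> can go without sandwiched
  letters only by following the path in one direction, at most once through the loop, and it reaches
  the end \<open>L\<^sub>1\<close> of the path, where it has to turn back, after boundedly many steps.
\<close>

definition derived :: "biword \<Rightarrow> biword" where
  "derived w = w \<circ> (SOME f :: int \<Rightarrow> int. strict_mono f \<and> range f = {m. sandwiched w m})"

definition derivable :: "nat \<Rightarrow> biword \<Rightarrow> bool" where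
  "derivable n w \<longleftrightarrow> admissible n w \<and> admissible n (derived w)"

definition infinitely_derivable :: "nat \<Rightarrow> biword \<Rightarrow> bool" where
  "infinitely_derivable n w \<longleftrightarrow> (\<forall>k. derivable n ((derived ^^ k) w))"


section \<open>Groups of sandwiched letters and coherence\<close>

definition perm_up :: "nat \<Rightarrow> nat \<Rightarrow> nat" where
  "perm_up n j = n + 1 - j"

definition perm_right :: "nat \<Rightarrow> nat \<Rightarrow> nat" where
  "perm_right n j = (if j = 1 then 1 else n + 2 - j)"

text \<open>The pair \<open>(M, L)\<close> stands for "\<open>M\<close>-sandwiched \<open>L\<close>".\<close>

definition sandwich_group :: "nat \<Rightarrow> nat \<Rightarrow> (nat \<times> nat) set" where
  "sandwich_group n l =
     {(perm_up n j, j) | j. 1 \<le> j \<and> j \<le> n - l} \<union> {(perm_right n j, j) | j. n - l < j \<and> j \<le> n}"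

definition coherent :: "nat \<Rightarrow> nat \<Rightarrow> nat \<Rightarrow> biword \<Rightarrow> bool" where
  "coherent n i j w \<longleftrightarrow>
     derivable n w \<and> i \<in> {0..2 * n - 1} \<and> admissible_in n i w \<and>
     (let u = dperm n i \<circ> w in
        \<exists>l\<in>{0..n - 1}.
          (\<forall>m. sandwiched u m \<longrightarrow> (u (m - 1), u m) \<in> sandwich_group n l) \<and>
          j \<in> {1..2 * n - 1} \<and> admissible_in n j (derived u) \<and> l = j div 2)"

primrec normalized_derived :: "nat \<Rightarrow> (nat \<Rightarrow> nat) \<Rightarrow> biword \<Rightarrow> nat \<Rightarrow> biword" where
  "normalized_derived n s w 0 = w"
| "normalized_derived n s w (Suc k) = derived (dperm n (s k) \<circ> normalized_derived n s w k)"

definition infinitely_coherent :: "nat \<Rightarrow> biword \<Rightarrow> bool" where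
  "infinitely_coherent n w \<longleftrightarrow>
     infinitely_derivable n w \<and>
     (\<exists>s :: nat \<Rightarrow> nat. s 0 \<in> {0..2 * n - 1} \<and> (\<forall>k\<ge>1. s k \<in> {1..2 * n - 1}) \<and>
        (\<forall>k. coherent n (s k) (s (Suc k)) (normalized_derived n s w k)))"


section \<open>Generation operators\<close>

definition sandwicher :: "nat \<Rightarrow> nat \<Rightarrow> nat \<Rightarrow> nat" where
  "sandwicher n k L = (THE M. (M, L) \<in> sandwich_group n (k div 2))"

definition is_interpolating :: "nat \<Rightarrow> nat \<Rightarrow> nat \<Rightarrow> nat \<Rightarrow> nat list \<Rightarrow> bool" where
  "is_interpolating n k L L' ws \<longleftrightarrow>
     (let x = L # ws @ [L'] in
        successively (transition0 n) x \<and>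
        x ! 1 = sandwicher n k L \<and> x ! (length x - 2) = sandwicher n k L' \<and>
        (\<forall>i. 1 \<le> i \<and> i + 1 < length x \<longrightarrow> x ! (i - 1) \<noteq> x ! (i + 1)))"

definition interpolating :: "nat \<Rightarrow> nat \<Rightarrow> nat \<Rightarrow> nat \<Rightarrow> nat list" where
  "interpolating n k L L' = (THE ws. is_interpolating n k L L' ws)"

text \<open>
  \<open>gen0 n k u\<close> is the set of all indexings \<open>v\<close> of \<open>g\<^sup>0\<^sub>k u\<close>, where \<open>f m\<close> is the position in \<open>v\<close> of
  the letter \<open>u m\<close>. It is meant for \<open>u\<close> admissible in diagram \<open>k\<close>, with \<open>1 \<le> k \<le> 2 n - 1\<close>.
\<close>

definition gen0 :: "nat \<Rightarrow> nat \<Rightarrow> biword \<Rightarrow> biword set" where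
  "gen0 n k u =
     {v. \<exists>f :: int \<Rightarrow> int. strict_mono f \<and>
        (\<forall>m. v (f m) = u m \<and>
             map v [f m + 1..f (m + 1) - 1] = interpolating n k (u m) (u (m + 1)))}"

definition gen :: "nat \<Rightarrow> nat \<Rightarrow> nat \<Rightarrow> biword \<Rightarrow> biword set" where
  "gen n i k u = (\<lambda>v. inv (dperm n i) \<circ> v) ` gen0 n k u"

text \<open>
  \<open>iter_gen n s k U\<close> is the set of all indexings of the words
  \<open>g\<close>(s 0, s 1) ... \<open>g\<close>(s (k-1), s k) \<open>u\<close> for \<open>u \<in> U\<close>, where \<open>g\<close>(i, k) has upper index \<open>i\<close>
  and lower index \<open>k\<close>.
\<close>

primrec iter_gen :: "nat \<Rightarrow> (nat \<Rightarrow> nat) \<Rightarrow> nat \<Rightarrow> biword set \<Rightarrow> biword set" where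
  "iter_gen n s 0 U = U"
| "iter_gen n s (Suc k) U = iter_gen n s k (\<Union>u\<in>U. gen n (s k) (s (Suc k)) u)"

end

theory Submission
  imports Defs
begin

text \<open>
  A trajectory in direction \<open>\<theta>\<close> is described by the heights, transversally to \<open>\<theta>\<close> and relative to
  the side midpoints, of its crossing points: a word is a cutting sequence iff there are reals \<open>x k\<close>,
  each within half the height of the side crossed, with increments that depend only on the two
  sides. In the sector \<open>[0, pi/2n]\<close> the shear-reflection
  \<open>(x, y) \<mapsto> (- x + 2 y / tan (pi/2n), y)\<close> turns the inequalities at the sandwiched letters into
  those of the sheared polygon, and its linear functionals telescope over the unsandwiched letters;
  so derivation applies this map to the direction, and generation applies its inverse.

  The closure of the cutting sequences is the set of words all of whose windows occur in cutting
  sequences. As there are finitely many sectors, each such word is coherent for some pair of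
  sectors and its derived word is again of this kind, whence infinite coherence. Conversely, a window
  of a word generated by enough operators comes from a shorter window of the derived word, unless
  its interior letters are all sandwiched; then it alternates between two letters and occurs in
  a periodic trajectory parallel to a boundary direction of the sector.
\<close>

section \<open>Codings by heights and the shear-reflection\<close>

text \<open>A flight that starts on the side opposite to side \<open>i\<close> and ends on side
  \<open>j\<close> joins side midpoints by a vector parallel to direction \<open>h\<close> if
  \<open>i + j = n + 1\<close> and horizontal if \<open>i + j = n + 2\<close>; for directions in
  \<open>[0, h]\<close> no other transitions occur. The shear-reflection is the linear map that
  negates horizontal vectors and fixes direction \<open>h\<close>; the condition
  \<open>- cos h + c * sin h = cos h\<close> gives its coefficient \<open>c = 2 / tan h\<close>. So
  it acts on each of these vectors by a sign, and this sign alternates along unsandwiched letters: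
  hence the telescoping. As an orientation-reversing involution it serves derivation and generation
  with the same formulas. Two obstacles shape the rest. In generation, inequalities are given only
  at the two ends of a run, while every crossing inside it has to be bounded. And a word of the
  intersection comes with operators whose indices may change with \<open>k\<close>, so no direction
  for the whole word is at hand; directions are constructed only for its finite windows.\<close>

locale even_gon =
  fixes n :: nat
  assumes two_le: "2 \<le> n"
begin

text \<open>Half the angle under which a side is seen from the centre, and also the width of a
  sector of directions.\<close>

definition h :: real where "h = pi / (2 * real n)"

text \<open>In units of the apothem and for direction \<open>\<theta>\<close>, the side labelled \<open>j\<close> has half-height
  \<open>tan h * sin (phi \<theta> j)\<close>, and the height of its midpoint is \<open>cos (phi \<theta> j)\<close>. A negative sine means
  that the trajectory leaves through the opposite side; \<open>exit_cos\<close> takes this into account.\<close>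

definition phi :: "real \<Rightarrow> nat \<Rightarrow> real" where
  "phi \<theta> j = \<theta> + 2 * (real j - 1) * h"

definition exit_cos :: "real \<Rightarrow> real" where
  "exit_cos t = sgn (sin t) * cos t"

text \<open>Sign convention: \<open>x k\<close> is the height of the midpoint of the side crossed
  minus the height of the crossing point. The increment equation says that the height does not
  change between the re-entry after crossing \<open>k\<close> and crossing
  \<open>k + 1\<close>.\<close>

definition is_coding :: "real \<Rightarrow> biword \<Rightarrow> (int \<Rightarrow> real) \<Rightarrow> bool" where
  "is_coding \<theta> w x \<longleftrightarrow> w \<in> words n \<and>
     (\<forall>k. \<bar>x k\<bar> < tan h * \<bar>sin (phi \<theta> (w k))\<bar> \<and>
          x (k + 1) - x k = exit_cos (phi \<theta> (w k)) + exit_cos (phi \<theta> (w (k + 1))))"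

definition codings :: "real \<Rightarrow> biword set" where
  "codings \<theta> = {w. \<exists>x. is_coding \<theta> w x}"

text \<open>Closed at both ends, so that the directions \<open>0\<close> and \<open>h\<close> of the
  words in \<open>alternating_coding\<close> belong to sector \<open>0\<close>.\<close>

definition sector :: "nat \<Rightarrow> real set" where
  "sector i = {real i * h..(real i + 1) * h}"

definition sector_codings :: "nat \<Rightarrow> biword set" where
  "sector_codings i = (\<Union>\<theta>\<in>sector i. codings \<theta>)"

lemma n_h: "real n * h = pi / 2"
  using two_le by (simp add: h_def)

lemma h_pos: "0 < h"
  using two_le by (simp add: h_def)

lemma h_le: "h \<le> pi / 4"
proof -
  have "2 * h \<le> real n * h" using two_le h_pos by (intro mult_right_mono) auto
  then show ?thesis using n_h by simp
qed

lemma sin_h: "0 < sin h" and cos_h: "0 < cos h" and tan_h: "0 < tan h"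
proof -
  have "h < pi / 2" using h_le pi_gt_zero by linarith
  then show "0 < sin h" "0 < cos h" "0 < tan h"
    using h_pos by (auto intro!: sin_gt_zero cos_gt_zero tan_gt_zero)
qed

lemma wordsD: "w \<in> words n \<Longrightarrow> 1 \<le> w k \<and> w k \<le> n"
  unfolding words_def by (metis (mono_tags, lifting) atLeastAtMost_iff mem_Collect_eq range_subsetD)

lemma wordsI: "(\<And>k. 1 \<le> w k \<and> w k \<le> n) \<Longrightarrow> w \<in> words n"
  unfolding words_def by auto

text \<open>\<open>(dx \<theta>, sin \<theta>)\<close> is the image of the unit vector in direction \<open>\<theta>\<close> under the
  shear-reflection, and \<open>dsin \<theta> j\<close>, \<open>dcos \<theta> j\<close> take the place of the sine and cosine of \<open>phi \<theta> j\<close>.\<close>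

definition dx :: "real \<Rightarrow> real" where
  "dx \<theta> = 2 * sin \<theta> / tan h - cos \<theta>"

definition dsin :: "real \<Rightarrow> nat \<Rightarrow> real" where
  "dsin \<theta> j = sin \<theta> * cos (phi 0 j) + dx \<theta> * sin (phi 0 j)"

definition dcos :: "real \<Rightarrow> nat \<Rightarrow> real" where
  "dcos \<theta> j = dx \<theta> * cos (phi 0 j) - sin \<theta> * sin (phi 0 j)"

lemma phi_0: "phi \<theta> j = \<theta> + phi 0 j"
  by (simp add: phi_def)

lemma phi_up: "i + j = n + 1 \<Longrightarrow> phi 0 j = pi - (phi 0 i + 2 * h)"
proof -
  assume a: "i + j = n + 1"
  have j: "real j = real n + 1 - real i" using a by linarith
  have "phi 0 j = 2 * (real n * h) - phi 0 i - 2 * h" unfolding phi_def j by (simp add: algebra_simps)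
  then show ?thesis using n_h by simp
qed

lemma phi_right: "i + j = n + 2 \<Longrightarrow> phi 0 j = pi - phi 0 i"
proof -
  assume a: "i + j = n + 2"
  have j: "real j = real n + 2 - real i" using a by linarith
  have "phi 0 j = 2 * (real n * h) - phi 0 i" unfolding phi_def j by (simp add: algebra_simps)
  then show ?thesis using n_h by simp
qed

lemma sincos_up:
  assumes "i + j = n + 1"
  shows "sin (phi 0 j) = sin (phi 0 i) * cos (2 * h) + cos (phi 0 i) * sin (2 * h)"
    and "cos (phi 0 j) = sin (phi 0 i) * sin (2 * h) - cos (phi 0 i) * cos (2 * h)"
  unfolding phi_up[OF assms] sin_diff cos_diff by (simp_all add: sin_add cos_add)

lemma sincos_right:
  assumes "i + j = n + 2"
  shows "sin (phi 0 j) = sin (phi 0 i)" and "cos (phi 0 j) = - cos (phi 0 i)"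
  unfolding phi_right[OF assms] by (simp_all add: sin_diff cos_diff)

text \<open>The sum of the midpoint vectors of the two sides is parallel to direction
  \<open>h\<close>, hence fixed by the shear-reflection. As the map reverses orientation, the height
  of a fixed vector changes sign.\<close>

lemma cos_up:
  assumes "i + j = n + 1"
  shows "cos (phi \<theta> i) + cos (phi \<theta> j) = - (dcos \<theta> i + dcos \<theta> j)"
proof -
  have "cos (phi \<theta> i) + cos (phi \<theta> j) + (dcos \<theta> i + dcos \<theta> j)
      = 2 * sin \<theta> / sin h * (cos h * (cos (phi 0 i) + cos (phi 0 j)) - sin h * (sin (phi 0 i) + sin (phi 0 j)))"
    unfolding phi_0[of \<theta>] cos_add dcos_def dx_def tan_def using sin_h cos_h by (simp add: field_simps)
  also have "cos h * (cos (phi 0 i) + cos (phi 0 j)) - sin h * (sin (phi 0 i) + sin (phi 0 j))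
      = cos (phi 0 i + h) + cos (phi 0 j + h)" by (simp add: cos_add algebra_simps)
  also have "phi 0 j + h = pi - (phi 0 i + h)" using phi_up[OF assms] by simp
  finally show ?thesis by (simp add: cos_diff)
qed

text \<open>Here the sum of the midpoint vectors is horizontal. The map negates it, and this cancels
  the sign caused by the reversed orientation.\<close>

lemma cos_right:
  assumes "i + j = n + 2"
  shows "cos (phi \<theta> i) + cos (phi \<theta> j) = dcos \<theta> i + dcos \<theta> j"
  unfolding phi_0[of \<theta>] cos_add dcos_def sincos_right[OF assms] by (simp add: algebra_simps)

text \<open>The left side bounds the offset of a crossing of side \<open>i\<close> that lies between
  two crossings of side \<open>j\<close>. It turns out to be the half-height of side
  \<open>i\<close> for the image direction, up to scaling, so sandwiching imposes the very
  inequality that the derived word needs.\<close>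

lemma sandwich_up:
  assumes "i + j = n + 1"
  shows "tan h * sin (phi \<theta> j) - (cos (phi \<theta> i) + cos (phi \<theta> j)) = tan h * dsin \<theta> i"
proof -
  have "1 - cos (2 * h) = 2 * (sin h)\<^sup>2" "1 + cos (2 * h) = 2 * (cos h)\<^sup>2"
    using cos_double_sin[of h] cos_double_cos[of h] by simp_all
  then have t: "tan h * sin (2*h) = 1 - cos (2 * h)" "sin (2*h) = tan h * (1 + cos (2*h))"
    using cos_h by (simp_all add: tan_def sin_double power2_eq_square)
  have d: "tan h * dsin \<theta> i = tan h * sin \<theta> * cos (phi 0 i) + (2 * sin \<theta> - tan h * cos \<theta>) * sin (phi 0 i)"
    unfolding dsin_def dx_def using tan_h by (simp add: field_simps)
  show ?thesis
    unfolding d unfolding phi_0[of \<theta>] sin_add cos_add sincos_up[OF assms]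
    using t by algebra
qed

text \<open>The counterpart of \<open>sandwich_up\<close>; the minus sign means that the image
  trajectory leaves through the opposite side with the same label.\<close>

lemma sandwich_right:
  assumes "i + j = n + 2"
  shows "tan h * sin (phi \<theta> j) + (cos (phi \<theta> i) + cos (phi \<theta> j)) = - (tan h * dsin \<theta> i)"
proof -
  have d: "tan h * dsin \<theta> i = tan h * sin \<theta> * cos (phi 0 i) + (2 * sin \<theta> - tan h * cos \<theta>) * sin (phi 0 i)"
    unfolding dsin_def dx_def using tan_h by (simp add: field_simps)
  show ?thesis
    unfolding d unfolding phi_0[of \<theta>] sin_add cos_add sincos_right[OF assms]
    by (simp add: algebra_simps)
qed

section \<open>Action of the shear-reflection on directions\<close>

lemma polar_upper:
  assumes "0 \<le> (y::real)" "(x, y) \<noteq> (0, 0)"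
  obtains \<rho> t where "0 < \<rho>" "0 \<le> t" "t \<le> pi" "x = \<rho> * cos t" "y = \<rho> * sin t"
proof -
  let ?z = "Complex x y"
  have nz: "?z \<noteq> 0" using assms(2) by (auto simp: complex_eq_iff)
  have e: "?z = of_real (norm ?z) * cis (Arg ?z)" using rcis_cmod_Arg[of ?z] by (simp add: rcis_def)
  have "0 \<le> Arg ?z" using assms(1) by (simp add: Arg_less_0)
  moreover have "Arg ?z \<le> pi" by (rule Arg_le_pi)
  moreover have "x = norm ?z * cos (Arg ?z)" "y = norm ?z * sin (Arg ?z)"
    using arg_cong[OF e, of Re] arg_cong[OF e, of Im] by simp_all
  ultimately show ?thesis using that[of "norm ?z" "Arg ?z"] nz by simp
qed

lemma dsin_dcos_polar:
  assumes "dx \<theta> = \<rho> * cos \<theta>'" "sin \<theta> = \<rho> * sin \<theta>'"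
  shows "dsin \<theta> j = \<rho> * sin (phi \<theta>' j)" "dcos \<theta> j = \<rho> * cos (phi \<theta>' j)"
  unfolding dsin_def dcos_def assms phi_0[of \<theta>'] sin_add cos_add by (simp_all add: algebra_simps)

text \<open>The map fixes direction \<open>h\<close>, sends direction \<open>0\<close> to
  \<open>pi\<close> and reverses orientation, so it opens \<open>[0, h]\<close> to
  \<open>[h, pi]\<close>. The bound by \<open>h\<close> is read off the sign of the determinant with
  the fixed vector.\<close>

lemma derive_direction:
  assumes "0 \<le> \<theta>" "\<theta> \<le> h"
  obtains \<rho> \<theta>' where "0 < \<rho>" "h \<le> \<theta>'" "\<theta>' \<le> pi" "dx \<theta> = \<rho> * cos \<theta>'" "sin \<theta> = \<rho> * sin \<theta>'"
proof -
  have s: "0 \<le> sin \<theta>" using assms h_le pi_gt_zero by (intro sin_ge_zero) auto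
  have "(dx \<theta>, sin \<theta>) \<noteq> (0, 0)"
    by (metis Pair_inject add_0 diff_0 div_0 dx_def mult_zero_right neg_equal_0_iff_equal power_zero_numeral sin_cos_squared_add zero_neq_one)
  from polar_upper[OF s this] obtain \<rho> t where p: "0 < \<rho>" "0 \<le> t" "t \<le> pi" "dx \<theta> = \<rho> * cos t" "sin \<theta> = \<rho> * sin t"
    by metis
  have "h \<le> t"
  proof (rule ccontr)
    assume "\<not> h \<le> t"
    then have "0 < sin (h - t)" using p(2) h_le pi_gt_zero by (intro sin_gt_zero) auto
    then have "0 < \<rho> * sin (h - t)" using p(1) by simp
    also have "\<rho> * sin (h - t) = dx \<theta> * sin h - sin \<theta> * cos h"
      unfolding p sin_diff by (simp add: algebra_simps)
    also have "\<dots> = - sin (h - \<theta>)" 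
      unfolding dx_def tan_def sin_diff using sin_h cos_h by (simp add: field_simps)
    finally have "sin (h - \<theta>) < 0" by simp
    moreover have "0 \<le> sin (h - \<theta>)" using assms h_le pi_gt_zero by (intro sin_ge_zero) auto
    ultimately show False by simp
  qed
  then show ?thesis using that p by metis
qed

text \<open>Since the map is an involution, the preimage is obtained by applying it once more and
  inverting the scaling factor.\<close>

lemma generate_direction:
  assumes "h \<le> \<theta>'" "\<theta>' \<le> pi"
  obtains \<rho> \<theta> where "0 < \<rho>" "0 \<le> \<theta>" "\<theta> \<le> h" "dx \<theta> = \<rho> * cos \<theta>'" "sin \<theta> = \<rho> * sin \<theta>'"
proof -
  have s: "0 \<le> sin \<theta>'" using assms h_pos by (intro sin_ge_zero) auto
  have "(dx \<theta>', sin \<theta>') \<noteq> (0, 0)"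
    by (metis Pair_inject add_0 diff_0 div_0 dx_def mult_zero_right neg_equal_0_iff_equal power_zero_numeral sin_cos_squared_add zero_neq_one)
  from polar_upper[OF s this] obtain \<rho> t where p: "0 < \<rho>" "0 \<le> t" "t \<le> pi" "dx \<theta>' = \<rho> * cos t" "sin \<theta>' = \<rho> * sin t"
    by metis
  have "t \<le> h"
  proof (rule ccontr)
    assume "\<not> t \<le> h"
    then have "0 < sin (t - h)" using p(3) h_pos by (intro sin_gt_zero) auto
    then have "0 < \<rho> * sin (t - h)" using p(1) by simp
    also have "\<rho> * sin (t - h) = sin \<theta>' * cos h - dx \<theta>' * sin h"
      unfolding p sin_diff by (simp add: algebra_simps)
    also have "\<dots> = - sin (\<theta>' - h)" 
      unfolding dx_def tan_def sin_diff using sin_h cos_h by (simp add: field_simps)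
    finally have "sin (\<theta>' - h) < 0" by simp
    moreover have "0 \<le> sin (\<theta>' - h)" using assms h_pos by (intro sin_ge_zero) auto
    ultimately show False by simp
  qed
  moreover have "dx t = (1 / \<rho>) * cos \<theta>'" "sin t = (1 / \<rho>) * sin \<theta>'"
  proof -
    show "sin t = (1 / \<rho>) * sin \<theta>'" using p by simp
    have "\<rho> * dx t = 2 * (\<rho> * sin t) / tan h - \<rho> * cos t" unfolding dx_def by (simp add: algebra_simps)
    also have "\<dots> = cos \<theta>'" unfolding p(4,5)[symmetric] dx_def by simp
    finally show "dx t = (1 / \<rho>) * cos \<theta>'" using p(1) by (simp add: field_simps)
  qed
  ultimately show ?thesis using that[of "1 / \<rho>" t] p by simp
qed

section \<open>Codings for directions in the sector \<open>[0, h]\<close>\<close>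

lemma phi_range:
  assumes "1 \<le> j" "j \<le> n"
  shows "0 \<le> phi 0 j" "phi 0 j \<le> pi - 2 * h"
proof -
  show "0 \<le> phi 0 j" using assms h_pos by (simp add: phi_def)
  have "(real j - 1) * h \<le> (real n - 1) * h" using assms h_pos by (intro mult_right_mono) auto
  then show "phi 0 j \<le> pi - 2 * h" using n_h by (simp add: phi_def algebra_simps)
qed

lemma sin_phi_nonneg:
  assumes "1 \<le> j" "j \<le> n" "0 \<le> \<theta>" "\<theta> \<le> h"
  shows "0 \<le> sin (phi \<theta> j)"
  using phi_range[OF assms(1,2)] assms(3,4) h_pos unfolding phi_0[of \<theta>] by (intro sin_ge_zero) auto

text \<open>Both \<open>sin - dsin\<close> and \<open>sin + dsin\<close> factor into nonnegative
  sines. Thus the height bound of the derived coding is at least as strong as the original one at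
  the same letter.\<close>

lemma abs_dsin_le:
  assumes "1 \<le> j" "j \<le> n" "0 \<le> \<theta>" "\<theta> \<le> h"
  shows "\<bar>dsin \<theta> j\<bar> \<le> sin (phi \<theta> j)"
proof -
  have a: "0 \<le> sin (phi 0 j)" using sin_phi_nonneg[OF assms(1,2), of 0] h_pos by simp
  have "sin (phi \<theta> j) - dsin \<theta> j = 2 * (sin (h - \<theta>) / sin h) * sin (phi 0 j)"
    unfolding dsin_def dx_def phi_0[of \<theta>] sin_add tan_def sin_diff using sin_h cos_h by (simp add: field_simps)
  moreover have "0 \<le> sin (h - \<theta>)" using assms h_le pi_gt_zero by (intro sin_ge_zero) auto
  ultimately have 1: "0 \<le> sin (phi \<theta> j) - dsin \<theta> j" using a sin_h by simp
  have "sin (phi \<theta> j) + dsin \<theta> j = 2 * sin \<theta> * (sin (phi 0 j + h) / sin h)"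
    unfolding dsin_def dx_def phi_0[of \<theta>] sin_add tan_def using sin_h cos_h by (simp add: field_simps)
  moreover have "0 \<le> sin \<theta>" using assms h_le pi_gt_zero by (intro sin_ge_zero) auto
  moreover have "0 \<le> sin (phi 0 j + h)" using phi_range[OF assms(1,2)] h_pos by (intro sin_ge_zero) auto
  ultimately have 2: "0 \<le> sin (phi \<theta> j) + dsin \<theta> j" using sin_h by simp
  from 1 2 show ?thesis by linarith
qed

lemma is_codingD:
  assumes "is_coding \<theta> w x"
  shows "w \<in> words n" "\<bar>x k\<bar> < tan h * \<bar>sin (phi \<theta> (w k))\<bar>" "sin (phi \<theta> (w k)) \<noteq> 0"
    "x (k + 1) - x k = exit_cos (phi \<theta> (w k)) + exit_cos (phi \<theta> (w (k + 1)))"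
proof -
  have w: "w \<in> words n"
    and x: "\<And>k. \<bar>x k\<bar> < tan h * \<bar>sin (phi \<theta> (w k))\<bar>"
    and d: "\<And>k. x (k + 1) - x k = exit_cos (phi \<theta> (w k)) + exit_cos (phi \<theta> (w (k + 1)))"
    using assms unfolding is_coding_def by blast+
  show "w \<in> words n" by (rule w)
  show "\<bar>x k\<bar> < tan h * \<bar>sin (phi \<theta> (w k))\<bar>" by (rule x)
  then show "sin (phi \<theta> (w k)) \<noteq> 0" by force
  show "x (k + 1) - x k = exit_cos (phi \<theta> (w k)) + exit_cos (phi \<theta> (w (k + 1)))" by (rule d)
qed

lemma is_coding0:
  assumes "is_coding \<theta> w x" "0 \<le> \<theta>" "\<theta> \<le> h"
  shows "\<bar>x k\<bar> < tan h * sin (phi \<theta> (w k))" "0 < sin (phi \<theta> (w k))"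
    "x (k + 1) - x k = cos (phi \<theta> (w k)) + cos (phi \<theta> (w (k + 1)))"
proof -
  have p: "0 < sin (phi \<theta> (w k))" for k
    using is_codingD(1)[OF assms(1)] is_codingD(3)[OF assms(1), of k] sin_phi_nonneg[of "w k" \<theta>] assms(2,3) wordsD[of w k] by force
  then show "0 < sin (phi \<theta> (w k))" .
  show "\<bar>x k\<bar> < tan h * sin (phi \<theta> (w k))"
    using is_codingD(2)[OF assms(1), of k] p[of k] by simp
  show "x (k + 1) - x k = cos (phi \<theta> (w k)) + cos (phi \<theta> (w (k + 1)))"
    using is_codingD(4)[OF assms(1), of k] p[of k] p[of "k+1"] by (simp add: exit_cos_def)
qed

lemma is_coding0I:
  assumes "w \<in> words n" "0 \<le> \<theta>" "\<theta> \<le> h"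
    "\<And>k. \<bar>x k\<bar> < tan h * sin (phi \<theta> (w k))"
    "\<And>k. x (k + 1) - x k = cos (phi \<theta> (w k)) + cos (phi \<theta> (w (k + 1)))"
  shows "is_coding \<theta> w x"
proof -
  have p: "0 < sin (phi \<theta> (w k))" for k
    using assms(4)[of k] tan_h by (smt (verit) zero_less_mult_pos)
  then have "\<bar>sin (phi \<theta> (w k))\<bar> = sin (phi \<theta> (w k))" for k by (simp add: less_imp_le)
  then show ?thesis using assms p unfolding is_coding_def exit_cos_def by simp
qed

text \<open>Adding the bounds at two neighbouring crossings gives
  \<open>\<bar>cos S\<bar> < tan h * sin S\<close> for the mean \<open>S\<close> of the two angles,
  so \<open>S\<close> is less than \<open>h\<close> away from \<open>pi / 2\<close>. As
  \<open>S\<close> is \<open>\<theta>\<close> plus \<open>(i + j - 2) * h\<close> and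
  \<open>n * h = pi / 2\<close>, only two values of \<open>i + j\<close> remain.\<close>

lemma coding0_transition:
  assumes "is_coding \<theta> w x" "0 \<le> \<theta>" "\<theta> \<le> h"
  shows "transition0 n (w k) (w (k + 1))"
proof -
  let ?a = "phi \<theta> (w k)" and ?b = "phi \<theta> (w (k + 1))"
  note r = wordsD[OF is_codingD(1)[OF assms(1)]]
  have ab: "0 \<le> ?a" "?a < pi" "0 \<le> ?b" "?b < pi"
    using phi_range[of "w k"] phi_range[of "w (k+1)"] r[of k] r[of "k+1"] assms(2,3) h_pos phi_0[of \<theta>]
    by (smt (verit))+
  let ?S = "(?a + ?b) / 2" and ?D = "(?a - ?b) / 2"
  have D: "0 < cos ?D" using ab by (intro cos_gt_zero_pi) auto
  have c: "cos ?a + cos ?b = 2 * cos ?S * cos ?D" by (simp add: cos_plus_cos)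
  have s: "sin ?a + sin ?b = 2 * sin ?S * cos ?D" by (simp add: sin_plus_sin)
  have "\<bar>cos ?a + cos ?b\<bar> < tan h * (sin ?a + sin ?b)"
    using is_coding0(1)[OF assms, of k] is_coding0(1)[OF assms, of "k+1"] is_coding0(3)[OF assms, of k]
    by (simp add: algebra_simps)
  then have "\<bar>cos ?S\<bar> * (2 * cos ?D) < (tan h * sin ?S) * (2 * cos ?D)"
    unfolding c s using D by (simp add: abs_mult algebra_simps)
  then have lt: "\<bar>cos ?S\<bar> < tan h * sin ?S" using D by simp
  then have l1: "cos ?S * cos h < sin h * sin ?S" "- (cos ?S * cos h) < sin h * sin ?S"
    using cos_h by (simp_all add: tan_def field_simps abs_less_iff)
  have "cos (?S + h) < 0" using l1 by (simp add: cos_add mult.commute)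
  have "0 < cos (?S - h)" using l1 by (simp add: cos_diff mult.commute)
  have 1: "?S - h < pi / 2"
  proof (rule ccontr)
    assume "\<not> ?S - h < pi / 2"
    moreover have "?S - h \<le> pi" using ab h_pos by argo
    ultimately have "cos (?S - h) \<le> cos (pi / 2)" by (intro cos_monotone_0_pi_le) auto
    then show False using \<open>0 < cos (?S - h)\<close> by simp
  qed
  have 2: "pi / 2 < ?S + h"
  proof (rule ccontr)
    assume "\<not> pi / 2 < ?S + h"
    moreover have "0 \<le> ?S + h" using ab h_pos by argo
    ultimately have "cos (pi / 2) \<le> cos (?S + h)" by (intro cos_monotone_0_pi_le) auto
    then show False using \<open>cos (?S + h) < 0\<close> by simp
  qed
  have S: "?S = \<theta> + (real (w k) + real (w (k + 1)) - 2) * h" by (simp add: phi_def field_simps)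
  have "(real (w k) + real (w (k + 1))) * h < (real n + 3) * h"
    using 1 assms(2) unfolding S n_h[symmetric] by (simp add: algebra_simps)
  then have u: "w k + w (k + 1) < n + 3" using h_pos by simp
  have "(real n) * h < (real (w k) + real (w (k + 1))) * h"
    using 2 assms(3) unfolding S n_h[symmetric] by (simp add: algebra_simps)
  then have "n < w k + w (k + 1)" using h_pos by simp
  then show ?thesis using u r[of k] r[of "k+1"] unfolding transition0_def by auto
qed

lemma coding0_admissible0:
  assumes "is_coding \<theta> w x" "0 \<le> \<theta>" "\<theta> \<le> h"
  shows "admissible0 n w"
  using coding0_transition[OF assms] is_codingD(1)[OF assms(1)] by (simp add: admissible0_def)

text \<open>The origin of the groups: in both sectors \<open>2 l\<close> and \<open>2 l + 1\<close>
  the angle passes \<open>pi\<close> only after label \<open>n - l\<close>, which is why the group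
  index is \<open>k div 2\<close>.\<close>

lemma sin_phi_sector:
  assumes "\<theta> \<in> sector k" "k \<le> 2 * n - 1" "1 \<le> j" "j \<le> n"
  shows "j \<le> n - k div 2 \<Longrightarrow> 0 \<le> sin (phi \<theta> j)" "n - k div 2 < j \<Longrightarrow> sin (phi \<theta> j) \<le> 0"
proof -
  let ?l = "k div 2"
  have l: "?l < n" using assms(2) two_le by linarith
  have b: "2 * real ?l \<le> real k" "real k \<le> 2 * real ?l + 1" by linarith+
  have lo: "2 * real ?l * h \<le> \<theta>"
    using assms(1) mult_right_mono[OF b(1), of h] h_pos unfolding sector_def atLeastAtMost_iff by linarith
  have hi: "\<theta> \<le> (2 * real ?l + 2) * h"
    using assms(1) mult_right_mono[OF b(2), of h] h_pos unfolding sector_def atLeastAtMost_iff by (simp add: algebra_simps)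
  {
    assume "j \<le> n - ?l"
    then have "real j \<le> real n - real ?l" using l by linarith
    then have "real j * h \<le> (real n - real ?l) * h" using h_pos by (intro mult_right_mono) auto
    then have "phi \<theta> j \<le> pi" using hi n_h by (simp add: phi_def algebra_simps)
    moreover have "0 \<le> phi \<theta> j" using lo phi_range(1)[OF assms(3,4)] h_pos
      unfolding phi_0[of \<theta>] by (smt (verit) mult_nonneg_nonneg of_nat_0_le_iff)
    ultimately show "0 \<le> sin (phi \<theta> j)" by (intro sin_ge_zero)
  }
  {
    assume "n - ?l < j"
    then have "real n - real ?l + 1 \<le> real j" using l by linarith
    then have "(real n - real ?l + 1) * h \<le> real j * h" using h_pos by (intro mult_right_mono) auto
    then have "pi \<le> phi \<theta> j" using lo n_h by (simp add: phi_def algebra_simps)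
    moreover have "phi \<theta> j \<le> 2 * pi"
    proof -
      have "(2 * real ?l + 2) * h \<le> 2 * real n * h" using l h_pos by (intro mult_right_mono) auto
      then have "\<theta> \<le> pi" using hi n_h by simp
      then show ?thesis using phi_range(2)[OF assms(3,4)] h_pos unfolding phi_0[of \<theta>] by linarith
    qed
    ultimately have "0 \<le> sin (phi \<theta> j - pi)" by (intro sin_ge_zero) auto
    then show "sin (phi \<theta> j) \<le> 0" by (simp add: sin_diff)
  }
qed

lemma sector_cover:
  assumes "0 \<le> \<theta>" "\<theta> < pi"
  obtains i where "i < 2 * n" "\<theta> \<in> sector i"
proof -
  let ?i = "nat \<lfloor>\<theta> / h\<rfloor>"
  have p: "0 \<le> \<theta> / h" using assms h_pos by simp
  have "real ?i \<le> \<theta> / h" "\<theta> / h < real ?i + 1" using p by linarith+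
  then have s: "\<theta> \<in> sector ?i" using h_pos by (simp add: sector_def field_simps)
  have "\<theta> / h < 2 * real n" using assms h_pos n_h by (simp add: field_simps)
  then have "real ?i < 2 * real n" using p by linarith
  then have "?i < 2 * n" by linarith
  then show ?thesis using s that by blast
qed

lemma sector_pi: "pi \<in> sector (2 * n - 1)"
proof -
  have "real (2 * n - 1) = 2 * real n - 1" using two_le by simp
  then show ?thesis using n_h h_pos by (simp add: sector_def algebra_simps)
qed

lemma sector_cover_derived:
  assumes "h \<le> \<theta>" "\<theta> \<le> pi"
  obtains i where "1 \<le> i" "i \<le> 2 * n - 1" "\<theta> \<in> sector i"
proof (cases "\<theta> < pi")
  case True
  then obtain i where i: "i < 2 * n" "\<theta> \<in> sector i" using sector_cover[of \<theta>] assms h_pos by (metis dual_order.trans less_imp_le)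
  show ?thesis
  proof (cases "i = 0")
    case True
    \<comment> \<open>The direction \<open>h\<close> lies on the border of sectors \<open>0\<close>
      and \<open>1\<close>; derived words must use index \<open>1\<close>.\<close>
    then have "\<theta> = h" using i assms by (simp add: sector_def)
    then have "\<theta> \<in> sector 1" using h_pos by (simp add: sector_def)
    then show ?thesis using that[of 1] two_le by simp
  qed (use i that[of i] in simp)
next
  case False
  then show ?thesis using that[of "2*n-1"] sector_pi assms two_le by simp
qed

lemma sector_bounds:
  assumes "\<theta> \<in> sector i" "1 \<le> i" "i \<le> 2 * n - 1"
  shows "h \<le> \<theta>" "\<theta> \<le> pi"
proof -
  have "1 * h \<le> real i * h" using assms h_pos by (intro mult_right_mono) auto
  then show "h \<le> \<theta>" using assms(1) by (simp add: sector_def)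
  have "(real i + 1) * h \<le> 2 * real n * h" using assms two_le h_pos by (intro mult_right_mono) linarith+
  then show "\<theta> \<le> pi" using assms(1) n_h by (simp add: sector_def)
qed

end

section \<open>Sandwiched letters and runs\<close>

text \<open>Summation in both directions from an anchor; it produces heights, hitting times and
  positions of letters from their increments.\<close>

lemma int_partial_sums:
  fixes g :: "int \<Rightarrow> 'a::ab_group_add"
  obtains S where "S a = b" "\<And>i. S (i + 1) = S i + g i"
proof -
  define S where "S i = b + (if a \<le> i then sum g {a..<i} else - sum g {i..<a})" for i
  have "S (i + 1) = S i + g i" for i
  proof (cases "a \<le> i")
    case True
    then have "{a..<i + 1} = insert i {a..<i}" by auto
    then show ?thesis using True by (simp add: S_def add.commute add.left_commute)
  next
    case False
    then have "{i..<a} = insert i {i + 1..<a}" by auto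
    then have "sum g {i..<a} = g i + sum g {i + 1..<a}" by simp
    then show ?thesis using False by (cases "a = i + 1") (simp_all add: S_def)
  qed
  moreover have "S a = b" by (simp add: S_def)
  ultimately show ?thesis using that by blast
qed

lemma strict_mono_intI:
  fixes f :: "int \<Rightarrow> 'a::order"
  assumes "\<And>m. f m < f (m + 1)"
  shows "strict_mono f"
proof (rule strict_monoI)
  fix a b :: int
  assume "a < b"
  then show "f a < f b"
  proof (induction b rule: int_gr_induct)
    case base
    then show ?case using assms by simp
  next
    case (step i)
    then show ?case using assms[of i] by (meson less_trans)
  qed
qed

lemma int_block:
  fixes f :: "int \<Rightarrow> 'a::linorder"
  assumes "strict_mono f" "f a \<le> t" "t < f b"
  obtains m where "f m \<le> t" "t < f (m + 1)"
proof -
  have "a < b" using assms by (meson le_less_trans not_less strict_mono_less_eq)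
  then have "t < f (a + int (nat (b - a)))" using assms by simp
  then have ex: "\<exists>d. t < f (a + int d)" by blast
  define d where "d = (LEAST d. t < f (a + int d))"
  have d: "t < f (a + int d)" unfolding d_def using ex by (rule LeastI_ex)
  have "d \<noteq> 0" using d assms(2) by (metis add_0_right int_ops(1) not_less)
  then obtain e where e: "d = Suc e" using not0_implies_Suc by blast
  have "\<not> t < f (a + int e)" using not_less_Least[of e "\<lambda>d. t < f (a + int d)"] e d_def by simp
  then show ?thesis using that[of "a + int e"] d e by (simp add: algebra_simps)
qed

lemma strict_mono_int_add:
  fixes f :: "int \<Rightarrow> int"
  assumes "strict_mono f"
  shows "f m + int d \<le> f (m + int d)"
proof (induction d)
  case (Suc d)
  have "f (m + int d) < f (m + int (Suc d))" using assms by (simp add: strict_mono_less)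
  then show ?case using Suc by simp
qed simp

lemma int_int_block:
  fixes f :: "int \<Rightarrow> int"
  assumes "strict_mono f"
  obtains m where "f m \<le> i" "i < f (m + 1)"
proof -
  let ?d = "nat (\<bar>i - f 0\<bar> + 1)"
  have "i < f (0 + int ?d)" using strict_mono_int_add[OF assms, of 0 ?d] by linarith
  moreover have "f (0 - int ?d) \<le> i" using strict_mono_int_add[OF assms, of "0 - int ?d" ?d] by simp
  ultimately show ?thesis using int_block[OF assms] that by metis
qed

lemma strict_mono_gap:
  fixes f :: "int \<Rightarrow> 'a::linorder"
  assumes "strict_mono f" "f m < i" "i < f (m + 1)"
  shows "i \<notin> range f"
  using assms by (auto simp: strict_mono_less)

text \<open>The successor map of the set is iterated upwards and the predecessor map downwards from
  one element; neither skips an element, so all are reached.\<close>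

lemma int_enumerate:
  fixes S :: "int set"
  assumes up: "\<And>i. \<exists>j>i. j \<in> S" and down: "\<And>i. \<exists>j<i. j \<in> S"
  obtains f :: "int \<Rightarrow> int" where "strict_mono f" "range f = S"
proof -
  have "\<exists>j>i. j \<in> S \<and> (\<forall>k. i < k \<and> k < j \<longrightarrow> k \<notin> S)" for i
  proof -
    let ?P = "\<lambda>d. i + 1 + int d \<in> S"
    obtain j where j: "j > i" "j \<in> S" using up by blast
    then have "?P (nat (j - i - 1))" by simp
    then have L: "?P (LEAST d. ?P d)" by (rule LeastI[of ?P])
    have "k \<notin> S" if k: "i < k" "k < i + 1 + int (LEAST d. ?P d)" for k
    proof -
      have "nat (k - i - 1) < (LEAST d. ?P d)" using k by linarith
      from not_less_Least[OF this] show ?thesis using k by simp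
    qed
    moreover have "i < i + 1 + int (LEAST d. ?P d)" by linarith
    ultimately show ?thesis using L by blast
  qed
  then obtain nxt where nxt: "\<And>i. i < nxt i \<and> nxt i \<in> S \<and> (\<forall>k. i < k \<and> k < nxt i \<longrightarrow> k \<notin> S)" by metis
  have "\<exists>j<i. j \<in> S \<and> (\<forall>k. j < k \<and> k < i \<longrightarrow> k \<notin> S)" for i
  proof -
    let ?P = "\<lambda>d. i - 1 - int d \<in> S"
    obtain j where j: "j < i" "j \<in> S" using down by blast
    then have "?P (nat (i - 1 - j))" by simp
    then have L: "?P (LEAST d. ?P d)" by (rule LeastI[of ?P])
    have "k \<notin> S" if k: "k < i" "i - 1 - int (LEAST d. ?P d) < k" for k
    proof -
      have "nat (i - 1 - k) < (LEAST d. ?P d)" using k by linarith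
      from not_less_Least[OF this] show ?thesis using k by simp
    qed
    moreover have "i - 1 - int (LEAST d. ?P d) < i" by linarith
    ultimately show ?thesis using L by blast
  qed
  then obtain prv where prv: "\<And>i. prv i < i \<and> prv i \<in> S \<and> (\<forall>k. prv i < k \<and> k < i \<longrightarrow> k \<notin> S)" by metis
  obtain s where s: "s \<in> S" using up by blast
  define f where "f k = (if 0 \<le> k then (nxt ^^ nat k) s else (prv ^^ nat (- k)) s)" for k
  have f0: "f 0 = s" by (simp add: f_def)
  have fp: "f (k + 1) = nxt (f k)" if "0 \<le> k" for k
    using that by (simp add: f_def nat_add_distrib)
  have fm: "f k = prv (f (k + 1))" if "k < 0" for k
  proof -
    have "nat (- k) = Suc (nat (- (k + 1)))" using that by linarith
    then show ?thesis using that by (auto simp: f_def)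
  qed
  have step: "f k < f (k + 1) \<and> (\<forall>i. f k < i \<and> i < f (k + 1) \<longrightarrow> i \<notin> S)" for k
    using fp[of k] fm[of k] nxt[of "f k"] prv[of "f (k + 1)"] by (cases "0 \<le> k") auto
  have mem: "f k \<in> S" for k
  proof (cases "0 < k")
    case True
    then show ?thesis using fp[of "k - 1"] nxt[of "f (k - 1)"] by simp
  next
    case False
    then show ?thesis using fm[of k] prv[of "f (k + 1)"] f0 s by (cases "k = 0") auto
  qed
  have sm: "strict_mono f" using step by (intro strict_mono_intI) blast
  have "i \<in> range f" if "i \<in> S" for i
  proof -
    obtain m where "f m \<le> i" "i < f (m + 1)" using int_int_block[OF sm] .
    then show ?thesis using step[of m] that by (metis order_le_less rangeI)
  qed
  then show ?thesis using that sm mem by blast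
qed

lemma derived_enumeration:
  assumes "\<And>i. \<exists>j>i. sandwiched w j" "\<And>i. \<exists>j<i. sandwiched w j"
  obtains f :: "int \<Rightarrow> int" where "strict_mono f" "range f = {m. sandwiched w m}" "derived w = w \<circ> f"
proof -
  have "\<exists>f :: int \<Rightarrow> int. strict_mono f \<and> range f = {m. sandwiched w m}"
    using int_enumerate[of "{m. sandwiched w m}"] assms by (metis mem_Collect_eq)
  from someI_ex[OF this] show ?thesis using that unfolding derived_def by blast
qed

section \<open>Existence of sandwiched letters in words of diagram \<open>0\<close>\<close>

lemma transition0_commute: "transition0 n a b \<longleftrightarrow> transition0 n b a"
  by (auto simp: transition0_def add.commute)

lemma admissible0_transition: "admissible0 n w \<Longrightarrow> transition0 n (w m) (w (m + 1))"
  by (simp add: admissible0_def)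

lemma admissible0_range: "admissible0 n w \<Longrightarrow> 1 \<le> w m \<and> w m \<le> n"
  using admissible0_transition[of n w m] by (auto simp: transition0_def)

lemma admissible0_sum: "admissible0 n w \<Longrightarrow> w m + w (m + 1) = n + 1 \<or> w m + w (m + 1) = n + 2"
  using admissible0_transition[of n w m] by (auto simp: transition0_def)

text \<open>Along unsandwiched letters the sums of neighbours alternate between \<open>n + 1\<close> and \<open>n + 2\<close>,
  so that every second letter is shifted by one in a constant direction.\<close>

lemma admissible0_sandwiched_after:
  assumes w: "admissible0 n w"
  shows "\<exists>j>i. sandwiched w j"
proof (rule ccontr)
  assume "\<not> ?thesis"
  then have ns: "w (j - 1) \<noteq> w (j + 1)" if "j > i" for j using that by (auto simp: sandwiched_def)
  note s = admissible0_sum[OF w] and r = admissible0_range[OF w]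
  have step: "w (j + 2) = (if w j + w (j + 1) = n + 1 then w j + 1 else w j - 1) \<and>
      (w (j + 2) + w (j + 3) = n + 1 \<longleftrightarrow> w j + w (j + 1) = n + 1)" if "j \<ge> i" for j
  proof -
    have e: "j + 1 - 1 = j" "j + 1 + 1 = j + 2" "j + 2 - 1 = j + 1" "j + 2 + 1 = j + 3" by simp_all
    have "w j \<noteq> w (j + 2)" "w (j + 1) \<noteq> w (j + 3)"
      using ns[of "j + 1", unfolded e] ns[of "j + 2", unfolded e] that by simp_all
    then have "w j + w (j + 1) \<noteq> w (j + 1) + w (j + 2)" "w (j + 1) + w (j + 2) \<noteq> w (j + 2) + w (j + 3)" by simp_all
    moreover note s[of j] s[of "j + 1", unfolded e] s[of "j + 2", unfolded e] r[of j]
    ultimately show ?thesis by (cases "w j + w (j + 1) = n + 1"; simp; linarith)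
  qed
  have "int (w (i + 2 * int t)) = int (w i) + (if w i + w (i + 1) = n + 1 then int t else - int t) \<and>
      (w (i + 2 * int t) + w (i + 2 * int t + 1) = n + 1 \<longleftrightarrow> w i + w (i + 1) = n + 1)" for t
  proof (induction t)
    case (Suc t)
    define a where "a = i + 2 * int t"
    have e: "i + 2 * int (Suc t) = a + 2" "a + 2 + 1 = a + 3" by (simp_all add: a_def)
    have "i \<le> a" by (simp add: a_def)
    from step[OF this] show ?case unfolding e using Suc[folded a_def] r[of a] by (auto simp: of_nat_diff)
  qed simp
  \<comment> \<open>After \<open>n\<close> double steps the letter has moved by \<open>n\<close> in
    one direction and has left \<open>{1..n}\<close>.\<close>
  from this[of n] show False using r[of i] r[of "i + 2 * int n"] by (auto split: if_splits)
qed

lemma admissible0_sandwiched_before: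
  assumes w: "admissible0 n w"
  shows "\<exists>j<i. sandwiched w j"
proof -
  have "admissible0 n (\<lambda>k. w (- k))"
    unfolding admissible0_def words_def
  proof (intro conjI allI)
    show "(\<lambda>k. w (- k)) \<in> {w. range w \<subseteq> {1..n}}" using admissible0_range[OF w] by auto
    show "transition0 n (w (- m)) (w (- (m + 1)))" for m
      using admissible0_transition[OF w, of "- m - 1"] by (simp add: transition0_commute)
  qed
  from admissible0_sandwiched_after[OF this, of "- i"] obtain j where "j > - i" "sandwiched (\<lambda>k. w (- k)) j" by blast
  then show ?thesis by (intro exI[of _ "- j"]) (auto simp: sandwiched_def minus_diff_commute)
qed

lemma admissible0_derived:
  assumes "admissible0 n w"
  obtains f :: "int \<Rightarrow> int" where "strict_mono f" "range f = {m. sandwiched w m}" "derived w = w \<circ> f"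
  using derived_enumeration admissible0_sandwiched_after[OF assms] admissible0_sandwiched_before[OF assms] .

context even_gon
begin

section \<open>The derived word of a coding is a coding for the image direction\<close>

lemma coding0_sandwiched:
  assumes c: "is_coding \<theta> u x" "0 \<le> \<theta>" "\<theta> \<le> h" and s: "sandwiched u k"
  shows "u (k - 1) + u k = n + 1 \<and> \<bar>x k\<bar> < tan h * dsin \<theta> (u k) \<or>
         u (k - 1) + u k = n + 2 \<and> \<bar>x k\<bar> < - (tan h * dsin \<theta> (u k))"
proof -
  let ?M = "u (k - 1)" and ?D = "cos (phi \<theta> (u k)) + cos (phi \<theta> (u (k - 1)))"
  have M: "u (k + 1) = ?M" using s by (simp add: sandwiched_def)
  have 1: "\<bar>x k + ?D\<bar> < tan h * sin (phi \<theta> ?M)"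
    using is_coding0(1)[OF c, of "k + 1"] is_coding0(3)[OF c, of k] M by (simp add: algebra_simps)
  have 2: "\<bar>x k - ?D\<bar> < tan h * sin (phi \<theta> ?M)"
    using is_coding0(1)[OF c, of "k - 1"] is_coding0(3)[OF c, of "k - 1"] by (simp add: algebra_simps)
  consider "u k + ?M = n + 1" | "u k + ?M = n + 2"
    using admissible0_sum[OF coding0_admissible0[OF c], of "k - 1"] by (auto simp: add.commute)
  then show ?thesis
  proof cases
    case a: 1
    then show ?thesis using sandwich_up[OF a, of \<theta>] 1 2 by (auto simp: add.commute)
  next
    case a: 2
    then show ?thesis using sandwich_right[OF a, of \<theta>] 1 2 by (auto simp: add.commute)
  qed
qed

text \<open>The sign by which the shear-reflection acts on the midpoint-to-midpoint vector of the
  transition at \<open>k\<close>: fixed for sum \<open>n + 1\<close>, negated otherwise.\<close>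

definition kind :: "biword \<Rightarrow> int \<Rightarrow> real" where
  "kind u k = (if u k + u (k + 1) = n + 1 then 1 else - 1)"

lemma coding0_step:
  assumes c: "is_coding \<theta> u x" "0 \<le> \<theta>" "\<theta> \<le> h"
  shows "x (k + 1) + kind u k * dcos \<theta> (u (k + 1)) = x k - kind u k * dcos \<theta> (u k)"
  using is_coding0(3)[OF c, of k] admissible0_sum[OF coding0_admissible0[OF c], of k]
    cos_up[of "u k" "u (k + 1)" \<theta>] cos_right[of "u k" "u (k + 1)" \<theta>]
  by (auto simp: kind_def)

lemma kind_sandwiched:
  assumes "admissible0 n u"
  shows "kind u (k + 1) = (if sandwiched u (k + 1) then kind u k else - kind u k)"
  using admissible0_sum[OF assms, of k] admissible0_sum[OF assms, of "k + 1"]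
  by (auto simp: kind_def sandwiched_def add.commute)

text \<open>An unsandwiched letter flips \<open>kind\<close>, so the term gained at the end of one
  step is the term lost at the start of the next: \<open>x - kind * dcos\<close> is constant along
  the run.\<close>

lemma coding0_run:
  assumes c: "is_coding \<theta> u x" "0 \<le> \<theta>" "\<theta> \<le> h"
    and ns: "\<And>j. k < j \<Longrightarrow> j \<le> k + int d \<Longrightarrow> \<not> sandwiched u j"
  shows "x (k + 1 + int d) + kind u (k + int d) * dcos \<theta> (u (k + 1 + int d)) = x k - kind u k * dcos \<theta> (u k)"
  using ns
proof (induction d)
  case 0
  then show ?case using coding0_step[OF c] by simp
next
  case (Suc d)
  have "kind u (k + int (Suc d)) = - kind u (k + int d)"
    using kind_sandwiched[OF coding0_admissible0[OF c], of "k + int d"] Suc.prems[of "k + int (Suc d)"] by (simp add: algebra_simps)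
  then show ?case
    using coding0_step[OF c, of "k + 1 + int d"] Suc by (simp add: algebra_simps)
qed

text \<open>The new heights carry a minus sign because the map reverses orientation, and the factor
  \<open>1 / \<rho>\<close> because the image of the unit velocity has length
  \<open>\<rho>\<close>.\<close>

lemma derived_is_coding:
  assumes c: "is_coding \<theta> u x" "0 \<le> \<theta>" "\<theta> \<le> h"
    and d: "dx \<theta> = \<rho> * cos \<theta>'" "sin \<theta> = \<rho> * sin \<theta>'" and \<rho>: "0 < \<rho>"
    and f: "strict_mono f" "range f = {m. sandwiched u m}"
  shows "is_coding \<theta>' (u \<circ> f) (\<lambda>m. - x (f m) / \<rho>)"
    and "sandwiched u k \<Longrightarrow> u (k - 1) + u k = n + 1 \<and> 0 < sin (phi \<theta>' (u k)) \<or>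
         u (k - 1) + u k = n + 2 \<and> sin (phi \<theta>' (u k)) < 0"
proof -
  note adm = coding0_admissible0[OF c]
  note p = dsin_dcos_polar[OF d]
  have sw: "u (k - 1) + u k = n + 1 \<and> 0 < sin (phi \<theta>' (u k)) \<and> \<bar>x k\<bar> < \<rho> * (tan h * \<bar>sin (phi \<theta>' (u k))\<bar>) \<or>
         u (k - 1) + u k = n + 2 \<and> sin (phi \<theta>' (u k)) < 0 \<and> \<bar>x k\<bar> < \<rho> * (tan h * \<bar>sin (phi \<theta>' (u k))\<bar>)"
    if "sandwiched u k" for k
  proof -
    have pos: "0 < b" if "a < tan h * (\<rho> * b)" "0 \<le> a" for a b
      using that tan_h \<rho> by (smt (verit) mult_nonneg_nonpos)
    from coding0_sandwiched[OF c that] show ?thesis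
    proof (elim disjE conjE)
      assume "u (k - 1) + u k = n + 1" and l: "\<bar>x k\<bar> < tan h * dsin \<theta> (u k)"
      moreover have "0 < sin (phi \<theta>' (u k))" using l pos[of "\<bar>x k\<bar>"] by (simp add: p)
      ultimately show ?thesis by (simp add: p mult.left_commute)
    next
      assume "u (k - 1) + u k = n + 2" and l: "\<bar>x k\<bar> < - (tan h * dsin \<theta> (u k))"
      moreover have "0 < - sin (phi \<theta>' (u k))" using l pos[of "\<bar>x k\<bar>" "- sin (phi \<theta>' (u k))"] by (simp add: p)
      ultimately show ?thesis by (simp add: p mult.left_commute)
    qed
  qed
  show "sandwiched u k \<Longrightarrow> u (k - 1) + u k = n + 1 \<and> 0 < sin (phi \<theta>' (u k)) \<or>
         u (k - 1) + u k = n + 2 \<and> sin (phi \<theta>' (u k)) < 0" using sw[of k] by blast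
  have sf: "sandwiched u (f m)" for m using f(2) by blast
  \<comment> \<open>The transitions before and after a sandwiched letter have the same kind, and it
    is the sign of the new sine; so the boundary terms of the telescoped runs are those required of
    the derived coding.\<close>
  have ec: "kind u (f m) * dcos \<theta> (u (f m)) = \<rho> * exit_cos (phi \<theta>' (u (f m)))"
     "kind u (f m - 1) * dcos \<theta> (u (f m)) = \<rho> * exit_cos (phi \<theta>' (u (f m)))" for m
  proof -
    have "kind u (f m) = kind u (f m - 1)" using kind_sandwiched[OF adm, of "f m - 1"] sf by simp
    moreover have "kind u (f m - 1) = sgn (sin (phi \<theta>' (u (f m))))" using sw[OF sf[of m]] by (auto simp: kind_def)
    ultimately show "kind u (f m) * dcos \<theta> (u (f m)) = \<rho> * exit_cos (phi \<theta>' (u (f m)))"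
     "kind u (f m - 1) * dcos \<theta> (u (f m)) = \<rho> * exit_cos (phi \<theta>' (u (f m)))"
      by (simp_all add: p exit_cos_def)
  qed
  have "- x (f (m + 1)) - - x (f m) = \<rho> * (exit_cos (phi \<theta>' (u (f m))) + exit_cos (phi \<theta>' (u (f (m + 1)))))" for m
  proof -
    define d where "d = nat (f (m + 1) - f m - 1)"
    have lt: "f m < f (m + 1)" using f(1) by (simp add: strict_mono_less)
    then have e: "f (m + 1) = f m + 1 + int d" "f (m + 1) - 1 = f m + int d" by (simp_all add: d_def)
    have ns: "\<not> sandwiched u j" if "f m < j" "j \<le> f m + int d" for j
      using strict_mono_gap[OF f(1), of m j] f(2) that e by auto
    have "x (f (m + 1)) + kind u (f (m + 1) - 1) * dcos \<theta> (u (f (m + 1))) = x (f m) - kind u (f m) * dcos \<theta> (u (f m))"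
      using coding0_run[OF c, of "f m" d] ns unfolding e(1)[symmetric] e(2)[symmetric] by blast
    with ec(1)[of m] ec(2)[of "m + 1"]
    show ?thesis by (simp only: distrib_left)
  qed
  then have inc: "(- x (f (m + 1)) - - x (f m)) / \<rho> = exit_cos (phi \<theta>' (u (f m))) + exit_cos (phi \<theta>' (u (f (m + 1))))" for m
    using \<rho> by simp
  have "\<bar>- x (f m) / \<rho>\<bar> < tan h * \<bar>sin (phi \<theta>' (u (f m)))\<bar>" for m
  proof -
    have "\<bar>x (f m)\<bar> < \<rho> * (tan h * \<bar>sin (phi \<theta>' (u (f m)))\<bar>)" using sw[OF sf[of m]] by blast
    then show ?thesis using \<rho> by (simp add: abs_divide pos_divide_less_eq mult.commute)
  qed
  moreover have "u \<circ> f \<in> words n" using wordsD[OF is_codingD(1)[OF c(1)]] by (intro wordsI) auto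
  ultimately show "is_coding \<theta>' (u \<circ> f) (\<lambda>m. - x (f m) / \<rho>)"
    unfolding is_coding_def using inc by (simp add: diff_divide_distrib)
qed

text \<open>The diagram \<open>0\<close> is a path with a loop at its end. Unfolding it at the loop gives the path
  \<open>0, \<dots>, 2 n - 1\<close>, in which each letter occurs at one even and one odd place. Interpolating
  words are read off upward runs, because downward runs become upward under \<open>p \<mapsto> 2 n - 1 - p\<close>.\<close>

definition path_letter :: "nat \<Rightarrow> nat" where
  "path_letter p = (if even p then p div 2 + 1 else n - p div 2)"

text \<open>The places of letter \<open>i\<close> are \<open>2 i - 2\<close> and
  \<open>2 n + 1 - 2 i\<close>. Going up from an even place yields neighbour sum
  \<open>n + 1\<close>, from an odd place \<open>n + 2\<close>; the group of \<open>k\<close> tells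
  which of these leads to the sandwiching letter.\<close>

definition run_start :: "nat \<Rightarrow> nat \<Rightarrow> nat" where
  "run_start k i = (if i \<le> n - k div 2 then 2 * i - 2 else 2 * n + 1 - 2 * i)"

text \<open>The mirror place \<open>2 n - 1 - run_start k i\<close>, at which an upward run arrives
  at \<open>i\<close> from its sandwiching letter.\<close>

definition run_end :: "nat \<Rightarrow> nat \<Rightarrow> nat" where
  "run_end k i = (if i \<le> n - k div 2 then 2 * n + 1 - 2 * i else 2 * i - 2)"

lemma path_letter_range: "p < 2 * n \<Longrightarrow> 1 \<le> path_letter p \<and> path_letter p \<le> n"
  using two_le by (auto simp: path_letter_def)

lemma path_letter_sum:
  assumes "p + 1 < 2 * n"
  shows "path_letter p + path_letter (p + 1) = (if even p then n + 1 else n + 2)"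
proof (cases "even p")
  case True
  then obtain q where "p = 2 * q" by blast
  then show ?thesis using assms by (simp add: path_letter_def)
next
  case False
  then obtain q where "p = 2 * q + 1" using oddE by blast
  then show ?thesis using assms by (simp add: path_letter_def)
qed

lemma path_letter_transition:
  assumes "p + 1 < 2 * n"
  shows "transition0 n (path_letter p) (path_letter (p + 1))"
  using path_letter_sum[OF assms] path_letter_range[of p] path_letter_range[of "p + 1"] assms
  by (auto simp: transition0_def)

lemma run_start_bound: "1 \<le> i \<Longrightarrow> i \<le> n \<Longrightarrow> k < 2 * n \<Longrightarrow> run_start k i + 1 < 2 * n"
  by (auto simp: run_start_def)

lemma run_end_bound: "1 \<le> i \<Longrightarrow> i \<le> n \<Longrightarrow> k < 2 * n \<Longrightarrow> 1 \<le> run_end k i \<and> run_end k i < 2 * n"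
  by (auto simp: run_end_def)

lemma path_letter_run_start: "1 \<le> i \<Longrightarrow> i \<le> n \<Longrightarrow> path_letter (run_start k i) = i"
proof -
  assume i: "1 \<le> i" "i \<le> n"
  have "2 * i - 2 = 2 * (i - 1)" "2 * n + 1 - 2 * i = 2 * (n - i) + 1" using i by auto
  then show ?thesis using i by (auto simp: path_letter_def run_start_def simp del: mult_Suc_right)
qed

lemma path_letter_run_end: "1 \<le> i \<Longrightarrow> i \<le> n \<Longrightarrow> path_letter (run_end k i) = i"
proof -
  assume i: "1 \<le> i" "i \<le> n"
  have "2 * i - 2 = 2 * (i - 1)" "2 * n + 1 - 2 * i = 2 * (n - i) + 1" using i by auto
  then show ?thesis using i by (auto simp: path_letter_def run_end_def simp del: mult_Suc_right)
qed

lemma even_run_start: "1 \<le> i \<Longrightarrow> i \<le> n \<Longrightarrow> even (run_start k i) \<longleftrightarrow> i \<le> n - k div 2"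
  by (auto simp: run_start_def)

lemma even_run_end: "1 \<le> i \<Longrightarrow> i \<le> n \<Longrightarrow> even (run_end k i) \<longleftrightarrow> \<not> i \<le> n - k div 2"
  by (auto simp: run_end_def)

lemma sandwicher_eq:
  assumes "1 \<le> i" "i \<le> n" "k < 2 * n"
  shows "sandwicher n k i = (if i \<le> n - k div 2 then n + 1 - i else n + 2 - i)"
  unfolding sandwicher_def
  by (rule the_equality) (use assms in \<open>auto simp: sandwich_group_def perm_up_def perm_right_def\<close>)

lemma sandwicher_run_start:
  assumes "1 \<le> i" "i \<le> n" "k < 2 * n"
  shows "sandwicher n k i = path_letter (run_start k i + 1)"
  using path_letter_sum[OF run_start_bound[OF assms]] path_letter_run_start[OF assms(1,2), of k]
    even_run_start[OF assms(1,2), of k] sandwicher_eq[OF assms] by auto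

lemma sandwicher_run_end:
  assumes "1 \<le> i" "i \<le> n" "k < 2 * n"
  shows "sandwicher n k i = path_letter (run_end k i - 1)"
proof -
  note b = run_end_bound[OF assms]
  then have "path_letter (run_end k i - 1) + path_letter (run_end k i) = (if even (run_end k i) then n + 2 else n + 1)"
    using path_letter_sum[of "run_end k i - 1"] by auto
  then show ?thesis using path_letter_run_end[OF assms(1,2), of k]
    even_run_end[OF assms(1,2), of k] sandwicher_eq[OF assms] by auto
qed

text \<open>The sum with the letter one place below reveals the parity of the place, and a letter
  has only one place of each parity.\<close>

lemma run_end_unique:
  assumes "1 \<le> i" "i \<le> n" "k < 2 * n" "p + 1 < 2 * n"
    and "path_letter (p + 1) = i" "path_letter p = sandwicher n k i"
  shows "p + 1 = run_end k i"
proof -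
  have s: "path_letter p + i = (if even p then n + 1 else n + 2)" using path_letter_sum[OF assms(4)] assms(5) by simp
  show ?thesis
  proof (cases "i \<le> n - k div 2")
    case True
    then have "path_letter p + i = n + 1" using assms(2,6) sandwicher_eq[OF assms(1-3)] by simp
    then have "even p" using s by presburger
    then obtain q where q: "p = 2 * q" by blast
    then have "i = n - q" using assms(5) by (simp add: path_letter_def)
    then show ?thesis using q True assms(1,4) by (simp add: run_end_def)
  next
    case False
    then have "path_letter p + i = n + 2" using assms(2,6) sandwicher_eq[OF assms(1-3)] by simp
    then have "odd p" using s by presburger
    then obtain q where q: "p = 2 * q + 1" using oddE by blast
    then have "i = q + 2" using assms(5) by (simp add: path_letter_def)
    then show ?thesis using q False by (simp add: run_end_def)
  qed
qed

text \<open>The second letter fixes the starting place with the upward direction; afterwards the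
  absence of sandwiched letters leaves a single choice at every step, and the penultimate letter
  fixes where the run stops. This yields uniqueness of interpolating words.\<close>

lemma is_interpolating_path:
  assumes i: "1 \<le> i" "i \<le> n" and j: "1 \<le> j" "j \<le> n" and k: "k < 2 * n"
    and ip: "is_interpolating n k i j ws"
  shows "run_start k i < run_end k j" "i # ws @ [j] = map path_letter [run_start k i..<Suc (run_end k j)]"
proof -
  define x where "x = i # ws @ [j]"
  let ?s = "run_start k i"
  have sx: "successively (transition0 n) x" and x1: "x ! 1 = sandwicher n k i"
    and xl: "x ! (length x - 2) = sandwicher n k j"
    and ns: "\<And>t. 1 \<le> t \<Longrightarrow> t + 1 < length x \<Longrightarrow> x ! (t - 1) \<noteq> x ! (t + 1)"
    using ip unfolding is_interpolating_def x_def Let_def by auto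
  have len: "2 \<le> length x" by (simp add: x_def)
  have tr: "transition0 n (x ! t) (x ! Suc t)" if "Suc t < length x" for t
    using sx that by (simp add: successively_conv_nth)
  have path: "Suc t < length x \<Longrightarrow> ?s + Suc t < 2 * n \<and> x ! t = path_letter (?s + t) \<and> x ! Suc t = path_letter (?s + Suc t)" for t
  proof (induction t)
    case 0
    show ?case using run_start_bound[OF i k] path_letter_run_start[OF i] x1 sandwicher_run_start[OF i k]
      by (simp add: x_def)
  next
    case (Suc t)
    then have IH: "?s + Suc t < 2 * n" "x ! t = path_letter (?s + t)" "x ! Suc t = path_letter (?s + Suc t)" by auto
    let ?p = "?s + t"
    have sum1: "path_letter ?p + path_letter (?p + 1) = (if even ?p then n + 1 else n + 2)"
      using path_letter_sum[of ?p] IH(1) by simp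
    have t2: "transition0 n (path_letter (?p + 1)) (x ! Suc (Suc t))" using tr[OF Suc.prems] IH(3) by simp
    have "path_letter ?p \<noteq> x ! Suc (Suc t)" using ns[of "Suc t"] Suc.prems IH(2) by simp
    then have sum2: "path_letter (?p + 1) + x ! Suc (Suc t) = (if even ?p then n + 2 else n + 1)"
      using t2 sum1 by (auto simp: transition0_def split: if_splits)
    \<comment> \<open>The run cannot leave the path at its top: the letter at place
      \<open>2 n - 1\<close> is \<open>1\<close>, and the next sum would have to be
      \<open>n + 2\<close>, which needs the letter \<open>n + 1\<close>.\<close>
    have b: "?p + 2 < 2 * n"
    proof (rule ccontr)
      assume "\<not> ?p + 2 < 2 * n"
      then have e: "?p + 2 = 2 * n" using IH(1) by simp
      then have ev: "even ?p" by (metis dvd_add_left_iff dvd_triv_left dvd_refl)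
      have "?p + 1 = 2 * (n - 1) + 1" using e two_le by simp
      then have "path_letter (?p + 1) = 1" using two_le by (simp add: path_letter_def del: mult_Suc_right)
      then show False using sum2 ev t2 by (simp add: transition0_def)
    qed
    then have "path_letter (?p + 1) + path_letter (?p + 2) = (if even ?p then n + 2 else n + 1)"
      using path_letter_sum[of "?p + 1"] by simp
    then show ?case using sum2 b IH by simp
  qed
  define T where "T = length x - 2"
  have T: "Suc T < length x" "Suc (Suc T) = length x" using len by (simp_all add: T_def)
  have last: "x ! Suc T = j" unfolding T_def x_def by (simp add: nth_append)
  have e: "?s + T + 1 = run_end k j"
    using run_end_unique[OF j k, of "?s + T"] path[OF T(1)] last xl T_def by simp
  then show "?s < run_end k j" by simp
  have "x = map path_letter [?s..<Suc (run_end k j)]"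
  proof (rule nth_equalityI)
    show "length x = length (map path_letter [?s..<Suc (run_end k j)])" using T e by simp
    fix t assume t: "t < length x"
    have "x ! t = path_letter (?s + t)"
    proof (cases t)
      case 0
      then show ?thesis using path[of 0] len by simp
    next
      case (Suc r)
      then show ?thesis using path[of r] t by simp
    qed
    then show "x ! t = map path_letter [?s..<Suc (run_end k j)] ! t" using t T e by (simp del: upt_Suc)
  qed
  then show "i # ws @ [j] = map path_letter [?s..<Suc (run_end k j)]" by (simp add: x_def)
qed

lemma is_interpolating_run:
  assumes i: "1 \<le> i" "i \<le> n" and j: "1 \<le> j" "j \<le> n" and k: "k < 2 * n"
    and lt: "run_start k i < run_end k j"
  shows "is_interpolating n k i j (map path_letter [Suc (run_start k i)..<run_end k j])"
proof -
  let ?s = "run_start k i" and ?e = "run_end k j"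
  have x: "i # map path_letter [Suc ?s..<?e] @ [j] = map path_letter [?s..<Suc ?e]"
    using lt path_letter_run_start[OF i, of k] path_letter_run_end[OF j, of k] by (simp add: upt_conv_Cons)
  have b: "?e < 2 * n" using run_end_bound[OF j k] by simp
  have nth: "map path_letter [?s..<Suc ?e] ! t = path_letter (?s + t)" if "t < Suc ?e - ?s" for t
    using that by (simp del: upt_Suc)
  have len: "length (map path_letter [?s..<Suc ?e]) = Suc ?e - ?s" by (simp del: upt_Suc)
  have "successively (transition0 n) (map path_letter [?s..<Suc ?e])"
    unfolding successively_conv_nth len
  proof (intro allI impI)
    fix t assume t: "Suc t < Suc ?e - ?s"
    show "transition0 n (map path_letter [?s..<Suc ?e] ! t) (map path_letter [?s..<Suc ?e] ! Suc t)"
      using nth[of t] nth[of "Suc t"] t path_letter_transition[of "?s + t"] b by simp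
  qed
  moreover have "map path_letter [?s..<Suc ?e] ! 1 = sandwicher n k i"
    using nth[of 1] lt sandwicher_run_start[OF i k] by simp
  moreover have "map path_letter [?s..<Suc ?e] ! (Suc ?e - ?s - 2) = sandwicher n k j"
    using nth[of "Suc ?e - ?s - 2"] lt sandwicher_run_end[OF j k] by (simp add: numeral_2_eq_2)
  moreover have "map path_letter [?s..<Suc ?e] ! (t - 1) \<noteq> map path_letter [?s..<Suc ?e] ! (t + 1)"
    if t: "1 \<le> t" "t + 1 < Suc ?e - ?s" for t
  proof -
    obtain r where r: "t = Suc r" using t(1) by (cases t) auto
    let ?p = "?s + r"
    have "?p + 2 < 2 * n" using t(2) b r by simp
    then have "path_letter ?p + path_letter (?p + 1) \<noteq> path_letter (?p + 1) + path_letter (?p + 1 + 1)"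
      using path_letter_sum[of ?p] path_letter_sum[of "?p + 1"] by (auto split: if_splits)
    then show ?thesis using nth[of r] nth[of "r + 2"] t r by simp
  qed
  ultimately show ?thesis unfolding is_interpolating_def Let_def x len by auto
qed

lemma interpolating_eq:
  assumes i: "1 \<le> i" "i \<le> n" and j: "1 \<le> j" "j \<le> n" and k: "k < 2 * n"
    and lt: "run_start k i < run_end k j"
  shows "interpolating n k i j = map path_letter [Suc (run_start k i)..<run_end k j]"
  unfolding interpolating_def
proof (rule the_equality)
  show ip: "is_interpolating n k i j (map path_letter [Suc (run_start k i)..<run_end k j])"
    by (rule is_interpolating_run[OF assms])
  fix ws assume "is_interpolating n k i j ws"
  from trans[OF is_interpolating_path(2)[OF i j k this] is_interpolating_path(2)[OF i j k ip, symmetric]]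
  show "ws = map path_letter [Suc (run_start k i)..<run_end k j]" by simp
qed

end

section \<open>Generation\<close>

context even_gon
begin

section \<open>Generated words as concatenations of upward runs\<close>

lemma letter_eq: 
  assumes "1 \<le> z" "z \<le> int n" "y = z + int n * c"
  shows "letter n y = nat z"
proof -
  have "y - 1 = (z - 1) + int n * c" using assms(3) by simp
  then have "(y - 1) mod int n = (z - 1) mod int n" by (simp only: mod_mult_self2)
  then have "(y - 1) mod int n = z - 1" using assms(1,2) by simp
  then show ?thesis using assms(1) by (simp add: letter_def nat_diff_distrib)
qed

lemma dperm_even:
  assumes "1 \<le> j" "j \<le> n" "l < n"
  shows "dperm n (2 * l) j = (if j \<le> n - l then j + l else j + l - n)"
proof (cases "j \<le> n - l")
  case True
  then have "letter n (int j + int l) = nat (int j + int l)"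
    using assms by (intro letter_eq[where c = 0]) auto
  then show ?thesis using assms True by (simp add: dperm_def nat_add_distrib)
next
  case False
  then have "letter n (int j + int l) = nat (int j + int l - int n)"
    using assms by (intro letter_eq[where c = 1]) auto
  then show ?thesis using assms False by (simp add: dperm_def nat_eq_iff)
qed

lemma dperm_odd:
  assumes "1 \<le> j" "j \<le> n" "l < n"
  shows "dperm n (2 * l + 1) j = (if j \<le> n - l then n + 1 - l - j else 2 * n + 1 - l - j)"
proof (cases "j \<le> n - l")
  case True
  then have "letter n (2 - int (l + 1) - int j) = nat (int n + 1 - int l - int j)"
    using assms by (intro letter_eq[where c = "- 1"]) auto
  then show ?thesis using assms True by (simp add: dperm_def nat_eq_iff)
next
  case False
  then have "letter n (2 - int (l + 1) - int j) = nat (2 * int n + 1 - int l - int j)"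
    using assms by (intro letter_eq[where c = "- 2"]) auto
  then show ?thesis using assms False by (simp add: dperm_def nat_eq_iff)
qed

lemma admissible_inD:
  assumes "admissible_in n k u"
  shows "u \<in> words n" "admissible0 n (dperm n k \<circ> u)" "transition0 n (dperm n k (u m)) (dperm n k (u (m + 1)))"
  using assms unfolding admissible_in_def by (auto simp: admissible0_def)

text \<open>For letters on different sides of \<open>n - k div 2\<close> the order of the places is
  automatic; on the same side it amounts to \<open>i + j \<le> n + 1\<close> or
  \<open>n + 2 \<le> i + j\<close>, which transitions of diagram \<open>k\<close> satisfy. For
  \<open>k = 0\<close> a pair with sum \<open>n + 2\<close> would violate it, hence the positive
  lower index.\<close>

lemma run_start_less_run_end:
  assumes k: "1 \<le> k" "k < 2 * n" and i: "1 \<le> i" "i \<le> n" and j: "1 \<le> j" "j \<le> n"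
    and t: "transition0 n (dperm n k i) (dperm n k j)"
  shows "run_start k i < run_end k j"
proof -
  define l where "l = k div 2"
  have l: "l < n" using k by (simp add: l_def)
  have s: "dperm n k i + dperm n k j = n + 1 \<or> dperm n k i + dperm n k j = n + 2"
    using t by (auto simp: transition0_def)
  have "(i \<le> n - l \<and> j \<le> n - l \<longrightarrow> i + j \<le> n + 1) \<and> (n - l < i \<and> n - l < j \<longrightarrow> n + 2 \<le> i + j)"
  proof (cases "even k")
    case True
    then have k': "k = 2 * l" "1 \<le> l" using k(1) by (auto simp: l_def)
    show ?thesis using s unfolding k'(1) dperm_even[OF i l] dperm_even[OF j l] using k'(2) i j l by auto
  next
    case False
    then have k': "k = 2 * l + 1" by (simp add: l_def)
    show ?thesis using s unfolding k'(1) dperm_odd[OF i l] dperm_odd[OF j l] using i j l by auto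
  qed
  then show ?thesis unfolding run_start_def run_end_def l_def[symmetric] using i j l
    by (cases "i \<le> n - l"; cases "j \<le> n - l"; simp; linarith)
qed

text \<open>Here \<open>f m\<close> is the position of \<open>u m\<close> in \<open>v\<close>.
  Neighbouring blocks share a letter, read at its place \<open>run_end\<close> in the earlier block
  and at the mirror place \<open>run_start\<close> in the later one, so that every block is an
  upward run.\<close>

definition is_run_sequence :: "nat \<Rightarrow> biword \<Rightarrow> biword \<Rightarrow> (int \<Rightarrow> int) \<Rightarrow> bool" where
  "is_run_sequence k u v f \<longleftrightarrow> (\<forall>m. run_start k (u m) < run_end k (u (m + 1)) \<and>
     f (m + 1) = f m + int (run_end k (u (m + 1)) - run_start k (u m)) \<and>
     (\<forall>t \<le> run_end k (u (m + 1)) - run_start k (u m). v (f m + int t) = path_letter (run_start k (u m) + t)))"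

lemma is_run_sequenceD:
  assumes "is_run_sequence k u v f"
  shows "run_start k (u m) < run_end k (u (m + 1))"
    "f (m + 1) = f m + int (run_end k (u (m + 1)) - run_start k (u m))"
    "t \<le> run_end k (u (m + 1)) - run_start k (u m) \<Longrightarrow> v (f m + int t) = path_letter (run_start k (u m) + t)"
  using assms unfolding is_run_sequence_def by blast+

lemma run_sequence_strict_mono: "is_run_sequence k u v f \<Longrightarrow> strict_mono f"
  by (rule strict_mono_intI) (simp add: is_run_sequence_def)

lemma gen0_block_iff:
  assumes i: "1 \<le> i" "i \<le> n" and j: "1 \<le> j" "j \<le> n" and k: "k < 2 * n"
    and lt: "run_start k i < run_end k j" and ab: "a < b"
  shows "v a = i \<and> v b = j \<and> map v [a + 1..b - 1] = interpolating n k i j \<longleftrightarrow>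
    b = a + int (run_end k j - run_start k i) \<and>
     (\<forall>t \<le> run_end k j - run_start k i. v (a + int t) = path_letter (run_start k i + t))"
  (is "?A \<longleftrightarrow> ?B")
proof -
  let ?s = "run_start k i" and ?e = "run_end k j"
  note ip = interpolating_eq[OF i j k lt]
  note ps = path_letter_run_start[OF i, of k] path_letter_run_end[OF j, of k]
  show ?thesis
  proof
    assume A: ?A
    then have "length [a + 1..b - 1] = ?e - Suc ?s" unfolding ip by (metis length_map length_upt)
    then have b: "b = a + int (?e - ?s)" using lt ab by simp
    moreover have "v (a + int t) = path_letter (?s + t)" if t: "t \<le> ?e - ?s" for t
    proof -
      consider "t = 0" | "t = ?e - ?s" | "0 < t" "t < ?e - ?s"
        using t by linarith
      then show ?thesis
      proof cases
        case 1
        then show ?thesis using A ps by simp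
      next
        case 2
        then show ?thesis using A ps b lt by simp
      next
        case 3
        then obtain r where r: "t = Suc r" "r < ?e - Suc ?s" by (cases t) auto
        then have "map v [a + 1..b - 1] ! r = path_letter (Suc ?s + r)"
          using A unfolding ip by simp
        then show ?thesis using r b by (simp add: algebra_simps)
      qed
    qed
    ultimately show ?B by blast
  next
    assume B: ?B
    then have b: "b = a + int (?e - ?s)" and v: "\<And>t. t \<le> ?e - ?s \<Longrightarrow> v (a + int t) = path_letter (?s + t)" by auto
    have "map v [a + 1..b - 1] = map path_letter [Suc ?s..<?e]"
    proof (rule nth_equalityI)
      show "length (map v [a + 1..b - 1]) = length (map path_letter [Suc ?s..<?e])" using b lt by simp
      fix t assume "t < length (map v [a + 1..b - 1])"
      then have t: "t < ?e - Suc ?s" using b lt by simp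
      then show "map v [a + 1..b - 1] ! t = map path_letter [Suc ?s..<?e] ! t"
        using v[of "Suc t"] b by (simp add: algebra_simps)
    qed
    then show ?A unfolding ip using v[of 0] v[of "?e - ?s"] ps b lt by simp
  qed
qed

lemma gen0_iff_run_sequence:
  assumes u: "u \<in> words n" and k: "k < 2 * n"
    and lt: "\<And>m. run_start k (u m) < run_end k (u (m + 1))"
  shows "strict_mono f \<and> (\<forall>m. v (f m) = u m \<and> map v [f m + 1..f (m + 1) - 1] = interpolating n k (u m) (u (m + 1)))
     \<longleftrightarrow> is_run_sequence k u v f"
proof
  assume A: "strict_mono f \<and> (\<forall>m. v (f m) = u m \<and> map v [f m + 1..f (m + 1) - 1] = interpolating n k (u m) (u (m + 1)))"
  have "f (m + 1) = f m + int (run_end k (u (m + 1)) - run_start k (u m)) \<and>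
     (\<forall>t \<le> run_end k (u (m + 1)) - run_start k (u m). v (f m + int t) = path_letter (run_start k (u m) + t))" for m
  proof -
    have "f m < f (m + 1)" using A by (simp add: strict_mono_less)
    then show ?thesis
      using gen0_block_iff[of "u m" "u (m + 1)" k "f m" "f (m + 1)" v] wordsD[OF u] k lt A by simp
  qed
  then show "is_run_sequence k u v f" unfolding is_run_sequence_def using lt by blast
next
  assume R: "is_run_sequence k u v f"
  note sm = run_sequence_strict_mono[OF R]
  have "v (f m) = u m \<and> map v [f m + 1..f (m + 1) - 1] = interpolating n k (u m) (u (m + 1))" for m
  proof -
    have "f m < f (m + 1)" using sm by (simp add: strict_mono_less)
    from gen0_block_iff[OF _ _ _ _ k lt[of m] this, of v] show ?thesis
      using wordsD[OF u] is_run_sequenceD(2)[OF R, of m] is_run_sequenceD(3)[OF R, where m = m] by blast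
  qed
  then show "strict_mono f \<and> (\<forall>m. v (f m) = u m \<and> map v [f m + 1..f (m + 1) - 1] = interpolating n k (u m) (u (m + 1)))"
    using sm by blast
qed

lemma gen0_run_sequence:
  assumes u: "admissible_in n k u" and k: "1 \<le> k" "k < 2 * n"
  shows "v \<in> gen0 n k u \<longleftrightarrow> (\<exists>f. is_run_sequence k u v f)"
proof -
  note w = wordsD[OF admissible_inD(1)[OF u]]
  have "run_start k (u m) < run_end k (u (m + 1))" for m
    using run_start_less_run_end[OF k] w admissible_inD(3)[OF u] by blast
  from gen0_iff_run_sequence[of u k, OF admissible_inD(1)[OF u] k(2) this] show ?thesis
    unfolding gen0_def by blast
qed

text \<open>Since the two neighbours agree, every letter inherited from \<open>u\<close> is
  sandwiched in \<open>v\<close>; the descent in \<open>iter_gen_window\<close> rests on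
  this.\<close>

lemma run_sequence_anchor:
  assumes R: "is_run_sequence k u v f" and u: "u \<in> words n" and k: "k < 2 * n"
  shows "v (f m) = u m" "v (f m + 1) = sandwicher n k (u m)" "v (f m - 1) = sandwicher n k (u m)"
proof -
  note d = is_run_sequenceD[OF R] and w = wordsD[OF u]
  show "v (f m) = u m" using d(3)[where t = 0 and m = m] path_letter_run_start w by simp
  show "v (f m + 1) = sandwicher n k (u m)"
    using d(3)[where t = 1 and m = m] d(1)[of m] sandwicher_run_start k w by simp
  let ?t = "run_end k (u m) - run_start k (u (m - 1))"
  have lt: "run_start k (u (m - 1)) < run_end k (u m)" using d(1)[of "m - 1"] by simp
  have e: "f m - 1 = f (m - 1) + int (?t - 1)" using d(2)[of "m - 1"] lt by simp
  have "v (f m - 1) = path_letter (run_start k (u (m - 1)) + (?t - 1))"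
    unfolding e by (rule d(3)) simp
  then show "v (f m - 1) = sandwicher n k (u m)"
    using lt sandwicher_run_end[of "u m" k] k w by simp
qed

lemma run_sequence_position:
  assumes R: "is_run_sequence k u v f"
  obtains m t where "i = f m + int t" "t < run_end k (u (m + 1)) - run_start k (u m)"
proof -
  obtain m where "f m \<le> i" "i < f (m + 1)" using int_int_block[OF run_sequence_strict_mono[OF R]] .
  then show ?thesis using that[of m "nat (i - f m)"] is_run_sequenceD(1,2)[OF R, of m] by simp
qed

lemma run_sequence_admissible0:
  assumes R: "is_run_sequence k u v f" and u: "u \<in> words n" and k: "k < 2 * n"
  shows "admissible0 n v"
proof -
  have tr: "transition0 n (v i) (v (i + 1))" for i
  proof -
    obtain m t where i: "i = f m + int t" and t: "t < run_end k (u (m + 1)) - run_start k (u m)"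
      using run_sequence_position[OF R] .
    have "v i = path_letter (run_start k (u m) + t)" "v (i + 1) = path_letter (run_start k (u m) + t + 1)"
      using is_run_sequenceD(3)[OF R, of t m] is_run_sequenceD(3)[OF R, of "Suc t" m] t
      by (simp_all add: i algebra_simps)
    moreover have "run_start k (u m) + t + 1 < 2 * n"
      using run_end_bound[of "u (m + 1)" k] wordsD[OF u] k t by (smt (verit) add.commute less_diff_conv Suc_eq_plus1 Suc_leI le_less_trans)
    ultimately show ?thesis using path_letter_transition by simp
  qed
  then have "v \<in> words n" by (intro wordsI) (auto simp: transition0_def)
  with tr show ?thesis by (simp add: admissible0_def)
qed

text \<open>The prescribed value of \<open>f\<close> at \<open>a\<close> allows the new sequence to
  be aligned with a given one on a window.\<close>

lemma run_sequence_exists: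
  assumes lt: "\<And>m. run_start k (u m) < run_end k (u (m + 1))" and u: "u \<in> words n"
  obtains v f where "is_run_sequence k u v f" "f a = b"
proof -
  obtain f where fa: "f a = b" and f: "\<And>m. f (m + 1) = f m + int (run_end k (u (m + 1)) - run_start k (u m))"
    using int_partial_sums[of a b "\<lambda>m. int (run_end k (u (m + 1)) - run_start k (u m))"] by blast
  have sm: "strict_mono f" by (rule strict_mono_intI) (use f lt in simp)
  define idx where "idx i = (SOME m. f m \<le> i \<and> i < f (m + 1))" for i
  have idx: "idx i = m" if "f m \<le> i" "i < f (m + 1)" for i m
  proof -
    have "f (idx i) \<le> i \<and> i < f (idx i + 1)" unfolding idx_def by (rule someI[of _ m]) (use that in blast)
    then have "f (idx i) < f (m + 1)" "f m < f (idx i + 1)" using that by linarith+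
    then show ?thesis using sm by (simp add: strict_mono_less)
  qed
  define v where "v i = path_letter (run_start k (u (idx i)) + nat (i - f (idx i)))" for i
  have v: "v (f m + int t) = path_letter (run_start k (u m) + t)" if "t < run_end k (u (m + 1)) - run_start k (u m)" for m t
    using idx[of m "f m + int t"] that f[of m] by (simp add: v_def)
  have "v (f m + int t) = path_letter (run_start k (u m) + t)" if "t \<le> run_end k (u (m + 1)) - run_start k (u m)" for m t
  proof (cases "t = run_end k (u (m + 1)) - run_start k (u m)")
    case True
    then have "f m + int t = f (m + 1) + int 0" using f[of m] by simp
    moreover have "v (f (m + 1) + int 0) = u (m + 1)"
      using v[where t = 0 and m = "m + 1"] lt[of "m + 1"] wordsD[OF u] path_letter_run_start by simp
    ultimately show ?thesis using path_letter_run_end wordsD[OF u] True lt[of m] by simp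
  next
    case False
    then show ?thesis using that v by simp
  qed
  then have "is_run_sequence k u v f" using lt f by (simp add: is_run_sequence_def)
  then show ?thesis using that fa by blast
qed

text \<open>Generation undoes derivation: between consecutive sandwiched positions the word meets
  the defining conditions of an interpolating word, the group supplying the second and the
  penultimate letter, and such a word is unique.\<close>

lemma coherent_run_sequence:
  assumes v: "admissible0 n v" and f: "strict_mono f" "range f = {m. sandwiched v m}"
    and g: "\<And>m. sandwiched v m \<Longrightarrow> (v (m - 1), v m) \<in> sandwich_group n (k div 2)"
    and k: "k < 2 * n"
  shows "is_run_sequence k (v \<circ> f) v f"
proof -
  let ?u = "v \<circ> f"
  have u: "?u \<in> words n" using admissible0_range[OF v] by (intro wordsI) auto
  note w = wordsD[OF u]
  have sf: "sandwiched v (f m)" for m using f(2) by blast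
  have nb: "v (f m - 1) = sandwicher n k (?u m)" "v (f m + 1) = sandwicher n k (?u m)" for m
  proof -
    have "(v (f m - 1), ?u m) \<in> sandwich_group n (k div 2)" using g[OF sf] by simp
    then show "v (f m - 1) = sandwicher n k (?u m)"
      using sandwicher_eq[of "?u m" k] w[of m] k
      by (auto simp: sandwich_group_def perm_up_def perm_right_def)
    then show "v (f m + 1) = sandwicher n k (?u m)" using sf[of m] by (simp add: sandwiched_def)
  qed
  have ip: "is_interpolating n k (?u m) (?u (m + 1)) (map v [f m + 1..f (m + 1) - 1])" for m
  proof -
    let ?x = "?u m # map v [f m + 1..f (m + 1) - 1] @ [?u (m + 1)]"
    have lt: "f m < f (m + 1)" using f(1) by (simp add: strict_mono_less)
    define d where "d = nat (f (m + 1) - f m)"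
    have d: "f (m + 1) = f m + int d" "0 < d" using lt by (simp_all add: d_def)
    have len: "length ?x = Suc d" using d by simp
    have x: "?x ! t = v (f m + int t)" if "t < Suc d" for t
    proof -
      consider "t = 0" | "t = d" | "0 < t" "t < d"
        using \<open>t < Suc d\<close> by linarith
      then show ?thesis
      proof cases
        case 3
        then obtain r where "t = Suc r" by (cases t) auto
        moreover from this have "r < nat (int d - 1)" using 3 by simp
        ultimately show ?thesis using d by (simp add: nth_append algebra_simps)
      qed (use d in \<open>auto simp: nth_append\<close>)
    qed
    have "successively (transition0 n) ?x"
      unfolding successively_conv_nth len
    proof (intro allI impI)
      fix t assume t: "Suc t < Suc d"
      show "transition0 n (?x ! t) (?x ! Suc t)"
        unfolding x[OF t] x[OF Suc_lessD[OF t]]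
        using admissible0_transition[OF v, of "f m + int t"] by (simp add: algebra_simps)
    qed
    moreover have "?x ! 1 = sandwicher n k (?u m)" using x[of 1] d nb(2)[of m] by simp
    moreover have "?x ! (length ?x - 2) = sandwicher n k (?u (m + 1))"
      using x[of "d - 1"] d nb(1)[of "m + 1"] len by (simp add: algebra_simps)
    moreover have "?x ! (t - 1) \<noteq> ?x ! (t + 1)" if t: "1 \<le> t" "t + 1 < length ?x" for t
    proof -
      have "f m + int t \<notin> range f"
        using strict_mono_gap[OF f(1), of m "f m + int t"] t len d by simp
      then have "\<not> sandwiched v (f m + int t)" using f(2) by blast
      moreover have e: "f m + int (t - 1) = f m + int t - 1" "f m + int (t + 1) = f m + int t + 1" using t by auto
      moreover have "t - 1 < Suc d" "t + 1 < Suc d" using t len by simp_all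
      ultimately show ?thesis using x[of "t - 1", unfolded e] x[of "t + 1", unfolded e]
        by (simp add: sandwiched_def)
    qed
    ultimately show ?thesis unfolding is_interpolating_def Let_def by blast
  qed
  have lt: "run_start k (?u m) < run_end k (?u (m + 1))" for m
    using is_interpolating_path(1)[OF _ _ _ _ k ip] w by blast
  have "map v [f m + 1..f (m + 1) - 1] = interpolating n k (?u m) (?u (m + 1))" for m
    using trans[OF is_interpolating_path(2)[OF _ _ _ _ k ip[of m]]
        is_interpolating_path(2)[OF _ _ _ _ k is_interpolating_run[OF _ _ _ _ k lt[of m]], symmetric]]
      interpolating_eq[OF _ _ _ _ k lt[of m]] w by simp
  then have "strict_mono f \<and> (\<forall>m. v (f m) = ?u m \<and> map v [f m + 1..f (m + 1) - 1] = interpolating n k (?u m) (?u (m + 1)))"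
    using f(1) by simp
  then show ?thesis by (rule iffD1[OF gen0_iff_run_sequence[of ?u k, OF u k lt]])
qed

text \<open>The trajectory passes through side midpoints, so all heights vanish. Its direction is
  that of the midpoint-to-midpoint vector: \<open>h\<close> for sum \<open>n + 1\<close> and
  \<open>0\<close> for sum \<open>n + 2\<close>.\<close>

lemma alternating_coding:
  assumes t: "transition0 n a b"
  obtains \<theta> where "0 \<le> \<theta>" "\<theta> \<le> h" "is_coding \<theta> (\<lambda>k. if even (k - c) then a else b) (\<lambda>_. 0)"
proof -
  have ab: "1 \<le> a" "a \<le> n" "1 \<le> b" "b \<le> n" using t by (auto simp: transition0_def)
  let ?w = "\<lambda>k::int. if even (k - c) then a else b"
  have w: "?w \<in> words n" using ab by (intro wordsI) auto
  have pos: "0 < sin (phi \<theta> j)" if "1 \<le> j" "j \<le> n" "0 \<le> \<theta>" "\<theta> \<le> h" "j = 1 \<Longrightarrow> 0 < \<theta>" for j \<theta>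
  proof -
    have "0 < phi \<theta> j"
    proof (cases "j = 1")
      case False
      then have "0 < (real j - 1) * h" using that(1) h_pos by simp
      moreover have "phi \<theta> j = \<theta> + 2 * ((real j - 1) * h)" by (simp add: phi_def)
      ultimately show ?thesis using that(3) by linarith
    qed (use that in \<open>simp add: phi_def\<close>)
    moreover have "phi \<theta> j < pi" using phi_range(2)[OF that(1,2)] that(4) h_pos unfolding phi_0[of \<theta>] by linarith
    ultimately show ?thesis by (rule sin_gt_zero)
  qed
  consider "a + b = n + 1" | "a + b = n + 2" using t by (auto simp: transition0_def)
  then show ?thesis
  proof cases
    case 1
    have e: "phi h b = pi - phi h a" using phi_up[OF 1] unfolding phi_0[of h] by simp
    have "cos (phi h a) + cos (phi h b) = 0" unfolding e by (simp add: cos_diff)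
    then have "is_coding h ?w (\<lambda>_. 0)"
      using w h_pos tan_h pos[of a h] pos[of b h] ab by (intro is_coding0I) (auto simp: add.commute)
    then show ?thesis using that[of h] h_pos by simp
  next
    case 2
    have e: "phi 0 b = pi - phi 0 a" by (rule phi_right[OF 2])
    \<comment> \<open>Label \<open>1\<close> is the only side parallel to direction
      \<open>0\<close>, and it cannot occur with sum \<open>n + 2\<close>.\<close>
    have "a \<noteq> 1" "b \<noteq> 1" using 2 ab by auto
    have "cos (phi 0 a) + cos (phi 0 b) = 0" unfolding e by (simp add: cos_diff)
    then have "is_coding 0 ?w (\<lambda>_. 0)"
      using w h_pos tan_h pos[of a 0] pos[of b 0] ab \<open>a \<noteq> 1\<close> \<open>b \<noteq> 1\<close> by (intro is_coding0I) (auto simp: add.commute)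
    then show ?thesis using that[of 0] h_pos by simp
  qed
qed

lemma cos_le_max:
  assumes "0 \<le> a" "a \<le> b" "b \<le> c" "c \<le> 2 * pi"
  shows "cos b \<le> max (cos a) (cos c)"
proof (cases "b \<le> pi")
  case True
  then have "cos b \<le> cos a" using assms by (intro cos_monotone_0_pi_le) auto
  then show ?thesis by simp
next
  case False
  then have "cos (2 * pi - b) \<le> cos (2 * pi - c)" using assms by (intro cos_monotone_0_pi_le) auto
  then show ?thesis by (simp add: cos_diff)
qed

lemma min_le_cos:
  assumes "- pi \<le> a" "a \<le> b" "b \<le> c" "c \<le> pi"
  shows "min (cos a) (cos c) \<le> cos b"
proof (cases "0 \<le> b")
  case True
  then have "cos c \<le> cos b" using assms by (intro cos_monotone_0_pi_le) auto
  then show ?thesis by simp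
next
  case False
  then have "cos (- a) \<le> cos (- b)" using assms by (intro cos_monotone_0_pi_le) auto
  then show ?thesis by simp
qed

lemma phi_path_letter:
  assumes "p < 2 * n"
  shows "phi 0 (path_letter p) = (if even p then real p * h else pi - (real p + 1) * h)"
proof (cases "even p")
  case True
  then obtain q where "p = 2 * q" by blast
  then show ?thesis by (simp add: path_letter_def phi_def)
next
  case False
  then obtain q where q: "p = 2 * q + 1" using oddE by blast
  then have j: "real (path_letter p) = real n - real q" using assms by (simp add: path_letter_def)
  have "phi 0 (path_letter p) = 2 * (real n * h) - 2 * (real q + 1) * h" unfolding phi_def j by (simp add: algebra_simps)
  then show ?thesis using n_h q by simp
qed

text \<open>This is \<open>kind\<close> in terms of places: the letters at \<open>p\<close> and
  \<open>p + 1\<close> have sum \<open>n + 1\<close> exactly for even \<open>p\<close>. The same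
  parity sign later gives the orientation of the symmetry with index \<open>i\<close>.\<close>

definition run_sign :: "nat \<Rightarrow> real" where
  "run_sign p = (if even p then 1 else - 1)"

text \<open>In the sheared polygon, the points reached by an upward run have constant height. The sides
  crossed inside the run are diagonals of the sheared polygon, and the heights of its vertices are
  unimodal along the two chains on which the diagonals end.\<close>

lemma run_bound:
  assumes \<theta>: "0 \<le> \<theta>" "\<theta> \<le> h" and \<theta>': "h \<le> \<theta>'" "\<theta>' \<le> pi" and \<rho>: "0 < \<rho>"
    and d: "dx \<theta> = \<rho> * cos \<theta>'" "sin \<theta> = \<rho> * sin \<theta>'"
    and pq: "p0 < p1" "p1 < 2 * n" and p: "p0 \<le> p" "p \<le> p1"
    and b0: "\<bar>Y + run_sign p0 * dcos \<theta> (path_letter p0)\<bar> < tan h * (run_sign p0 * dsin \<theta> (path_letter p0))"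
    and b1: "\<bar>Y + run_sign p1 * dcos \<theta> (path_letter p1)\<bar> < - (tan h * (run_sign p1 * dsin \<theta> (path_letter p1)))"
  shows "\<bar>Y + run_sign p * dcos \<theta> (path_letter p)\<bar> < tan h * sin (phi \<theta> (path_letter p))"
proof -
  \<comment> \<open>\<open>Z\<close> is the constant height of the run, rescaled so that the
    vertices of the sheared polygon have plain cosines as heights.\<close>
  define Z where "Z = - (Y * cos h / \<rho>)"
  \<comment> \<open>\<open>ang q\<close> is the angle of the letter at place \<open>q\<close> for
    direction \<open>\<theta>'\<close>, lowered by \<open>pi\<close> at odd places; this absorbs the
    factor \<open>run_sign q\<close>.\<close>
  define ang where "ang q = (if even q then \<theta>' + real q * h else \<theta>' - (real q + 1) * h)" for q :: nat
  have Y: "Y = - (\<rho> * Z / cos h)" using \<rho> cos_h by (simp add: Z_def)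
  have nonneg: "0 \<le> sin \<theta>'" "0 \<le> sin (\<theta>' - h)" using \<theta>' h_pos by (auto intro!: sin_ge_zero)
  have sq: "0 \<le> sin (real q * h)" if "q \<le> 2 * n" for q
  proof -
    have "real q * h \<le> (2 * real n) * h" using that h_pos by (intro mult_right_mono) auto
    also have "\<dots> = pi" using n_h by simp
    finally show ?thesis using h_pos by (intro sin_ge_zero) auto
  qed
  have sc: "run_sign q * dsin \<theta> (path_letter q) = \<rho> * sin (ang q)"
    "run_sign q * dcos \<theta> (path_letter q) = \<rho> * cos (ang q)" if "q < 2 * n" for q
  proof -
    have "run_sign q * sin (phi \<theta>' (path_letter q)) = sin (ang q)" "run_sign q * cos (phi \<theta>' (path_letter q)) = cos (ang q)"
    proof -
      have "phi \<theta>' (path_letter q) = (if even q then ang q else ang q + pi)"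
        unfolding phi_0[of \<theta>'] phi_path_letter[OF that] ang_def by simp
      then show "run_sign q * sin (phi \<theta>' (path_letter q)) = sin (ang q)" "run_sign q * cos (phi \<theta>' (path_letter q)) = cos (ang q)"
        by (simp_all add: run_sign_def)
    qed
    then show "run_sign q * dsin \<theta> (path_letter q) = \<rho> * sin (ang q)"
      "run_sign q * dcos \<theta> (path_letter q) = \<rho> * cos (ang q)"
      unfolding dsin_dcos_polar[OF d] by (simp_all add: mult.left_commute)
  qed
  have lower: "Y + \<rho> * cos t < tan h * (\<rho> * sin t) \<longleftrightarrow> cos (t + h) < Z" for t
  proof -
    have "cos h * (Y + \<rho> * cos t - tan h * (\<rho> * sin t)) = \<rho> * (cos (t + h) - Z)"
      unfolding Y cos_add tan_def using cos_h by (simp add: field_simps)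
    then have "cos h * (Y + \<rho> * cos t - tan h * (\<rho> * sin t)) < 0 \<longleftrightarrow> \<rho> * (cos (t + h) - Z) < 0" by simp
    then show ?thesis using \<rho> cos_h by (simp add: mult_less_0_iff)
  qed
  have upper: "- (Y + \<rho> * cos t) < tan h * (\<rho> * sin t) \<longleftrightarrow> Z < cos (t - h)" for t
  proof -
    have "cos h * (- (Y + \<rho> * cos t) - tan h * (\<rho> * sin t)) = \<rho> * (Z - cos (t - h))"
      unfolding Y cos_diff tan_def using cos_h by (simp add: field_simps)
    then have "cos h * (- (Y + \<rho> * cos t) - tan h * (\<rho> * sin t)) < 0 \<longleftrightarrow> \<rho> * (Z - cos (t - h)) < 0" by simp
    then show ?thesis using \<rho> cos_h by (simp add: mult_less_0_iff)
  qed
  \<comment> \<open>For a crossing inside the run, one of the two bounds is by this identity a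
    comparison of \<open>Z\<close> with a vertex; the other follows from the sharper bound with
    \<open>dsin\<close> in place of the sine.\<close>
  have E: "cos h * (tan h * sin (phi \<theta> j) + dcos \<theta> j) = \<rho> * cos (\<theta>' - (phi 0 j + h))" for j
  proof -
    have "cos h * (tan h * sin (phi \<theta> j) + dcos \<theta> j) = sin \<theta> * sin (phi 0 j + h) + dx \<theta> * cos (phi 0 j + h)"
      unfolding phi_0[of \<theta>] sin_add cos_add dcos_def dx_def tan_def using cos_h sin_h by (simp add: field_simps)
    also have "\<dots> = \<rho> * cos (\<theta>' - (phi 0 j + h))" unfolding d cos_diff by (simp add: algebra_simps)
    finally show ?thesis .
  qed
  have cdiff: "cos (a - b) - cos (a + b) = 2 * sin a * sin b" for a b :: real by (simp add: cos_diff cos_add)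
  have p0: "cos (ang p0 + h) < Z" "Z < cos (ang p0 - h)"
    using b0 sc[of p0] pq lower[of "ang p0"] upper[of "ang p0"] by (auto simp: abs_less_iff)
  have p1: "cos (ang p1 - h) < Z" "Z < cos (ang p1 + h)"
    using b1 sc[of p1] pq lower[of "- ang p1"] upper[of "- ang p1"] cos_minus[of "ang p1 - h"] cos_minus[of "ang p1 + h"]
    by (auto simp: abs_less_iff)
  \<comment> \<open>By unimodality it suffices to find a vertex of this chain below \<open>Z\<close>
    on either side of \<open>q\<close>. If an end of the run has the wrong parity, its inequality
    concerns a vertex of the other chain, and \<open>cdiff\<close> compares that one with its
    partner here.\<close>
  have odd: "cos (\<theta>' + real q * h) < Z" if q: "odd q" "p0 \<le> q" "q \<le> p1" for q
  proof -
    obtain q0 where q0: "q0 \<le> q" "cos (\<theta>' + real q0 * h) < Z"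
    proof (cases "even p0")
      case True
      then have "p0 + 1 \<le> q" using q by (metis Suc_eq_plus1 Suc_leI le_neq_implies_less)
      then show ?thesis using that[of "p0 + 1"] p0(1) True by (simp add: ang_def algebra_simps)
    next
      case False
      have "cos (\<theta>' + real p0 * h) \<le> cos (\<theta>' - real p0 * h)"
        using cdiff[of \<theta>' "real p0 * h"] nonneg(1) sq[of p0] pq by (simp add: algebra_simps)
      also have "\<dots> < Z" using p0(1) False by (simp add: ang_def algebra_simps)
      finally show ?thesis using that q by blast
    qed
    obtain q1 where q1: "q \<le> q1" "q1 < 2 * n" "cos (\<theta>' + real q1 * h) < Z"
    proof (cases "even p1")
      case True
      then have "q \<le> p1 - 1" using q by (metis Suc_eq_plus1 Suc_leI add_le_imp_le_diff le_neq_implies_less)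
      then show ?thesis using that[of "p1 - 1"] p1(1) pq True by (simp add: ang_def algebra_simps)
    next
      case False
      have "cos (\<theta>' + real p1 * h) = cos ((\<theta>' - h) + real (p1 + 1) * h)" by (simp add: algebra_simps)
      also have "\<dots> \<le> cos ((\<theta>' - h) - real (p1 + 1) * h)"
        using cdiff[of "\<theta>' - h" "real (p1 + 1) * h"] nonneg(2) sq[of "p1 + 1"] pq by (simp add: algebra_simps)
      also have "\<dots> = cos (ang p1 - h)" using False by (simp add: ang_def algebra_simps)
      also have "\<dots> < Z" by (rule p1(1))
      finally show ?thesis using that q pq by blast
    qed
    have "real q1 * h \<le> (2 * real n) * h" using q1(2) h_pos by (intro mult_right_mono) auto
    also have "\<dots> = pi" using n_h by simp
    finally have m: "real q1 * h \<le> pi" "real q0 * h \<le> real q * h" "real q * h \<le> real q1 * h"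
      using q0 q1 h_pos by (auto intro!: mult_right_mono)
    have "cos (\<theta>' + real q * h) \<le> max (cos (\<theta>' + real q0 * h)) (cos (\<theta>' + real q1 * h))"
      using m \<theta>' h_pos by (intro cos_le_max) (linarith | simp)+
    then show ?thesis using q0 q1 by linarith
  qed
  have even: "Z < cos (\<theta>' - (real q + 1) * h)" if q: "even q" "p0 \<le> q" "q \<le> p1" for q
  proof -
    obtain q0 where q0: "q0 \<le> q" "Z < cos (\<theta>' - (real q0 + 1) * h)"
    proof (cases "even p0")
      case True
      have "Z < cos (ang p0 - h)" by (rule p0(2))
      also have "\<dots> = cos ((\<theta>' - h) + real p0 * h)" using True by (simp add: ang_def algebra_simps)
      also have "\<dots> \<le> cos ((\<theta>' - h) - real p0 * h)"
        using cdiff[of "\<theta>' - h" "real p0 * h"] nonneg(2) sq[of p0] pq by (simp add: algebra_simps)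
      finally show ?thesis using that q by (simp add: algebra_simps)
    next
      case False
      then have "p0 + 1 \<le> q" using q by (metis Suc_eq_plus1 Suc_leI le_neq_implies_less)
      then show ?thesis using that[of "p0 + 1"] p0(2) False by (simp add: ang_def algebra_simps)
    qed
    obtain q1 where q1: "q \<le> q1" "q1 < 2 * n" "Z < cos (\<theta>' - (real q1 + 1) * h)"
    proof (cases "even p1")
      case True
      have "Z < cos (ang p1 + h)" by (rule p1(2))
      also have "\<dots> = cos (\<theta>' + real (p1 + 1) * h)" using True by (simp add: ang_def algebra_simps)
      also have "\<dots> \<le> cos (\<theta>' - real (p1 + 1) * h)"
        using cdiff[of \<theta>' "real (p1 + 1) * h"] nonneg(1) sq[of "p1 + 1"] pq by (simp add: algebra_simps)
      finally show ?thesis using that q pq by (simp add: algebra_simps)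
    next
      case False
      then have "q \<le> p1 - 1" using q by (metis Suc_eq_plus1 Suc_leI add_le_imp_le_diff le_neq_implies_less)
      moreover have "1 \<le> p1" using pq by simp
      ultimately show ?thesis using that[of "p1 - 1"] p1(2) pq False by (simp add: ang_def algebra_simps)
    qed
    have "(real q1 + 1) * h \<le> (2 * real n) * h" using q1(2) h_pos by (intro mult_right_mono) auto
    also have "\<dots> = pi" using n_h by simp
    finally have m: "real q1 * h + h \<le> pi" "real q0 * h \<le> real q * h" "real q * h \<le> real q1 * h"
      using q0 q1 h_pos by (auto intro!: mult_right_mono simp: distrib_right)
    have "min (cos (\<theta>' - (real q1 + 1) * h)) (cos (\<theta>' - (real q0 + 1) * h)) \<le> cos (\<theta>' - (real q + 1) * h)"
    proof (rule min_le_cos)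
      have "0 \<le> real q0 * h" using h_pos by simp
      then show "\<theta>' - (real q0 + 1) * h \<le> pi" unfolding distrib_right using \<theta>' h_pos by linarith
      show "- pi \<le> \<theta>' - (real q1 + 1) * h" "\<theta>' - (real q1 + 1) * h \<le> \<theta>' - (real q + 1) * h"
        "\<theta>' - (real q + 1) * h \<le> \<theta>' - (real q0 + 1) * h"
        unfolding distrib_right using m \<theta>' h_pos by linarith+
    qed
    then show ?thesis using q0 q1 by linarith
  qed
  let ?s = "sin (phi \<theta> (path_letter p))" and ?c = "dcos \<theta> (path_letter p)" and ?s' = "dsin \<theta> (path_letter p)"
  have pn: "p < 2 * n" using p pq by simp
  have s': "\<bar>?s'\<bar> \<le> ?s" using abs_dsin_le[OF _ _ \<theta>] path_letter_range[OF pn] by blast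
  then have ts': "\<bar>tan h * ?s'\<bar> \<le> tan h * ?s" using tan_h by (simp add: abs_mult)
  consider "p = p0" | "p = p1" | "p0 < p" "p < p1" using p by linarith
  then show ?thesis
  proof cases
    case 1
    then show ?thesis using b0 ts' by (auto simp: run_sign_def split: if_splits)
  next
    case 2
    then show ?thesis using b1 ts' by (auto simp: run_sign_def split: if_splits)
  next
    case 3
    show ?thesis
    proof (cases "even p")
      case True
      have ev: "Z < cos (\<theta>' - (real p + 1) * h)" by (rule even) (use True 3 in auto)
      have "cos h * (tan h * ?s + ?c) = \<rho> * cos (\<theta>' - (real p + 1) * h)"
        unfolding E phi_path_letter[OF pn] using True by (simp add: algebra_simps)
      then have "cos h * (- Y) < cos h * (tan h * ?s + ?c)" using ev \<rho> cos_h unfolding Y by simp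
      then have l: "- Y < tan h * ?s + ?c" by (simp only: mult_less_cancel_left_pos[OF cos_h])
      have "cos (ang p + h) < Z" using odd[of "p + 1"] True 3 by (simp add: ang_def algebra_simps)
      then have "Y + \<rho> * cos (ang p) < tan h * (\<rho> * sin (ang p))" by (simp add: lower)
      then have "Y + ?c < tan h * ?s'" using sc[OF pn] True by (simp add: run_sign_def)
      then show ?thesis using l ts' True by (simp add: run_sign_def)
    next
      case False
      have od: "cos (\<theta>' + real p * h) < Z" by (rule odd) (use False 3 in auto)
      have e: "\<theta>' - (pi - (real p + 1) * h + h) = \<theta>' + real p * h - pi" by (simp add: algebra_simps)
      have "cos (\<theta>' - (pi - (real p + 1) * h + h)) = - cos (\<theta>' + real p * h)" unfolding e by simp
      then have "cos h * (tan h * ?s + ?c) = - (\<rho> * cos (\<theta>' + real p * h))"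
        unfolding E phi_path_letter[OF pn] using False by simp
      then have "cos h * Y < cos h * (tan h * ?s + ?c)" using od \<rho> cos_h unfolding Y by simp
      then have l: "Y < tan h * ?s + ?c" by (simp only: mult_less_cancel_left_pos[OF cos_h])
      have "Z < cos (ang p - h)" using even[of "p + 1"] False 3 by (simp add: ang_def algebra_simps)
      then have "- (Y + \<rho> * cos (ang p)) < tan h * (\<rho> * sin (ang p))" by (rule iffD2[OF upper])
      moreover have "\<rho> * cos (ang p) = - ?c" "\<rho> * sin (ang p) = - ?s'" using sc[OF pn] False by (simp_all add: run_sign_def)
      ultimately have "- (Y - ?c) < - (tan h * ?s')" by simp
      then show ?thesis using l ts' False by (simp add: run_sign_def)
    qed
  qed
qed

text \<open>The converse of \<open>derived_is_coding\<close>. Summing the increments dictated by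
  \<open>v\<close> gives heights that telescope along each run, so the relation to the old heights
  passes from one anchor to the next; \<open>run_bound\<close> then yields the inequalities between
  anchors.\<close>

lemma run_sequence_coding:
  assumes c: "is_coding \<theta>' u x'" and \<theta>': "\<theta>' \<in> sector k" and k: "1 \<le> k" "k < 2 * n"
    and R: "is_run_sequence k u v f"
  obtains \<theta> x where "0 \<le> \<theta>" "\<theta> \<le> h" "is_coding \<theta> v x"
proof -
  have kl: "k \<le> 2 * n - 1" using k by simp
  note \<theta>'_bounds = sector_bounds[OF \<theta>' k(1) kl]
  obtain \<rho> \<theta> where \<rho>: "0 < \<rho>" and \<theta>: "0 \<le> \<theta>" "\<theta> \<le> h" and d: "dx \<theta> = \<rho> * cos \<theta>'" "sin \<theta> = \<rho> * sin \<theta>'"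
    using generate_direction[OF \<theta>'_bounds] by blast
  note u = is_codingD(1)[OF c] and p = dsin_dcos_polar[OF d] and D = is_run_sequenceD[OF R]
  note w = wordsD[OF u]
  note adm = run_sequence_admissible0[OF R u k(2)]
  let ?s = "\<lambda>m. run_start k (u m)" and ?e = "\<lambda>m. run_end k (u m)"
  \<comment> \<open>Runs start at even places exactly for the labels up to
    \<open>n - k div 2\<close>, and in sector \<open>k\<close> these are the labels with positive
    sine.\<close>
  have sgn: "run_sign (?s m) = sgn (sin (phi \<theta>' (u m)))" "run_sign (?e m) = - sgn (sin (phi \<theta>' (u m)))" for m
    using sin_phi_sector[OF \<theta>' kl, of "u m"] w[of m] is_codingD(3)[OF c, of m]
      even_run_start[of "u m" k] even_run_end[of "u m" k]
    by (auto simp: run_sign_def not_le sgn_if)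
  have ec: "\<rho> * exit_cos (phi \<theta>' (u m)) = run_sign (?s m) * dcos \<theta> (u m)"
    "\<rho> * exit_cos (phi \<theta>' (u m)) = - (run_sign (?e m) * dcos \<theta> (u m))" for m
    unfolding p sgn exit_cos_def by simp_all
  obtain x where x0: "x 0 = 0" and x: "\<And>i. x (i + 1) = x i + (cos (phi \<theta> (v i)) + cos (phi \<theta> (v (i + 1))))"
    using int_partial_sums[of 0 "0::real" "\<lambda>i. cos (phi \<theta> (v i)) + cos (phi \<theta> (v (i + 1)))"] by blast
  \<comment> \<open>The free additive constant is chosen so that
    \<open>X (f 0) = - (\<rho> * x' 0)\<close>.\<close>
  define X where "X i = x i - x (f 0) - \<rho> * x' 0" for i
  have X: "X (i + 1) = X i + (cos (phi \<theta> (v i)) + cos (phi \<theta> (v (i + 1))))" for i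
    using x[of i] by (simp add: X_def)
  have run: "X (f m + int t) - run_sign (?s m + t) * dcos \<theta> (path_letter (?s m + t)) = X (f m) - run_sign (?s m) * dcos \<theta> (u m)"
    if "t \<le> ?e (m + 1) - ?s m" for m t
    using that
  proof (induction t)
    case 0
    then show ?case using path_letter_run_start w by simp
  next
    case (Suc t)
    let ?p = "?s m + t"
    have b: "?p + 1 < 2 * n" using Suc.prems D(1)[of m] run_end_bound[of "u (m + 1)" k] w[of "m + 1"] k(2) by linarith
    have v: "v (f m + int t) = path_letter ?p" "v (f m + int t + 1) = path_letter (?p + 1)"
      using D(3)[where m = m and t = t] D(3)[where m = m and t = "Suc t"] Suc.prems by (simp_all add: algebra_simps)
    have "cos (phi \<theta> (path_letter ?p)) + cos (phi \<theta> (path_letter (?p + 1)))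
        = - run_sign ?p * (dcos \<theta> (path_letter ?p) + dcos \<theta> (path_letter (?p + 1)))"
      using path_letter_sum[OF b] cos_up[of "path_letter ?p" "path_letter (?p + 1)" \<theta>]
        cos_right[of "path_letter ?p" "path_letter (?p + 1)" \<theta>] by (simp add: run_sign_def)
    moreover have "run_sign (?p + 1) = - run_sign ?p" by (simp add: run_sign_def)
    moreover have "X (f m + int (Suc t)) = X (f m + int t) + (cos (phi \<theta> (path_letter ?p)) + cos (phi \<theta> (path_letter (?p + 1))))"
      using X[of "f m + int t"] v by (simp add: algebra_simps)
    ultimately show ?case using Suc by (simp add: algebra_simps)
  qed
  have anchor: "X (f m) = - (\<rho> * x' m)" for m
  proof -
    have step: "X (f (m + 1)) + \<rho> * x' (m + 1) = X (f m) + \<rho> * x' m" for m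
    proof -
      let ?t = "?e (m + 1) - ?s m"
      have e: "f (m + 1) = f m + int ?t" "?s m + ?t = ?e (m + 1)" using D(1,2)[of m] by auto
      have "X (f (m + 1)) - run_sign (?e (m + 1)) * dcos \<theta> (u (m + 1)) = X (f m) - run_sign (?s m) * dcos \<theta> (u m)"
        using run[of ?t m] path_letter_run_end w unfolding e by simp
      moreover have "\<rho> * (x' (m + 1) - x' m) = \<rho> * exit_cos (phi \<theta>' (u m)) + \<rho> * exit_cos (phi \<theta>' (u (m + 1)))"
        using is_codingD(4)[OF c, of m] by (simp add: distrib_left)
      ultimately show ?thesis using ec(1)[of m] ec(2)[of "m + 1"] by (simp add: algebra_simps)
    qed
    have "X (f m) + \<rho> * x' m = X (f 0) + \<rho> * x' 0"
    proof (induction m rule: int_induct[where k = 0])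
      case (step1 i)
      then show ?case using step[of i] by simp
    next
      case (step2 i)
      then show ?case using step[of "i - 1"] by simp
    qed simp
    then show ?thesis by (simp add: X_def)
  qed
  have "\<bar>X i\<bar> < tan h * sin (phi \<theta> (v i))" for i
  proof -
    obtain m t where i: "i = f m + int t" and t: "t < ?e (m + 1) - ?s m"
      using run_sequence_position[OF R] .
    let ?Y = "X (f m) - run_sign (?s m) * dcos \<theta> (u m)"
    let ?t = "?e (m + 1) - ?s m"
    have e: "f (m + 1) = f m + int ?t" "?s m + ?t = ?e (m + 1)" using D(1,2)[of m] by auto
    have Ye: "?Y = X (f (m + 1)) - run_sign (?e (m + 1)) * dcos \<theta> (u (m + 1))"
        using run[of ?t m] path_letter_run_end w unfolding e by simp
    have ab: "\<bar>X (f m)\<bar> < tan h * (\<rho> * \<bar>sin (phi \<theta>' (u m))\<bar>)" for m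
    proof -
      have "\<rho> * \<bar>x' m\<bar> < \<rho> * (tan h * \<bar>sin (phi \<theta>' (u m))\<bar>)" using is_codingD(2)[OF c, of m] \<rho> by simp
      then show ?thesis using \<rho> by (simp add: anchor abs_mult mult.left_commute)
    qed
    have as: "\<rho> * \<bar>sin (phi \<theta>' (u m))\<bar> = run_sign (?s m) * dsin \<theta> (u m)"
      "\<rho> * \<bar>sin (phi \<theta>' (u m))\<bar> = - (run_sign (?e m) * dsin \<theta> (u m))" for m
      unfolding p sgn by (simp_all add: abs_sgn mult.commute mult.left_commute)
    have "\<bar>?Y + run_sign (?s m + t) * dcos \<theta> (path_letter (?s m + t))\<bar> < tan h * sin (phi \<theta> (path_letter (?s m + t)))"
    proof (rule run_bound[OF \<theta> \<theta>'_bounds \<rho> d D(1)[of m]])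
      show "?e (m + 1) < 2 * n" using run_end_bound[of "u (m + 1)" k] w[of "m + 1"] k(2) by blast
      show "\<bar>?Y + run_sign (?s m) * dcos \<theta> (path_letter (?s m))\<bar> < tan h * (run_sign (?s m) * dsin \<theta> (path_letter (?s m)))"
        using ab[of m] as(1)[of m] path_letter_run_start[of "u m" k] w[of m] by simp
      show "\<bar>?Y + run_sign (?e (m + 1)) * dcos \<theta> (path_letter (?e (m + 1)))\<bar> < - (tan h * (run_sign (?e (m + 1)) * dsin \<theta> (path_letter (?e (m + 1)))))"
        unfolding Ye using ab[of "m + 1"] as(2)[of "m + 1"] path_letter_run_end[of "u (m + 1)" k] w[of "m + 1"] by simp
    qed (use t in auto)
    then show ?thesis using run[of t m] D(3)[where m = m and t = t] t by (simp add: i)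
  qed
  then have "is_coding \<theta> v X"
    using \<theta> X adm by (intro is_coding0I) (auto simp: admissible0_def)
  then show ?thesis using that \<theta> by blast
qed

end

section \<open>Trajectories in the polygon\<close>

context even_gon
begin

section \<open>Coordinates along and across a direction, and points on the sides\<close>

definition para :: "real \<Rightarrow> complex \<Rightarrow> real" where
  "para t z = Re (cis (- t) * z)"

definition perp :: "real \<Rightarrow> complex \<Rightarrow> real" where
  "perp t z = Im (cis (- t) * z)"

definition side_dir :: "nat \<Rightarrow> real" where
  "side_dir m = pi / 2 - 2 * real m * h"

text \<open>The coordinate \<open>y\<close> is measured from the midpoint towards
  \<open>vertex n r m\<close> in units of the apothem \<open>r * cos h\<close>, so the closed side
  is \<open>\<bar>y\<bar> \<le> tan h\<close>.\<close>

definition side_point :: "real \<Rightarrow> nat \<Rightarrow> real \<Rightarrow> complex" where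
  "side_point r m y = of_real (r * cos h) * (cis (side_dir m) * Complex 1 y)"

lemma para_linear: "para t (z + z') = para t z + para t z'" "para t (z - z') = para t z - para t z'"
    "para t (a *\<^sub>R z) = a * para t z"
  and perp_linear: "perp t (z + z') = perp t z + perp t z'" "perp t (z - z') = perp t z - perp t z'"
    "perp t (a *\<^sub>R z) = a * perp t z"
  by (simp_all add: para_def perp_def algebra_simps)

lemma para_inner: "para t z = inner (cis t) z"
  by (simp add: para_def inner_complex_def)

lemma para_cis: "para t (cis a) = cos (a - t)" and perp_cis: "perp t (cis a) = sin (a - t)"
  by (simp_all add: para_def perp_def cis_mult)

lemma para_perp_decomp: "z = para t z *\<^sub>R cis t + perp t z *\<^sub>R (\<i> * cis t)"
proof -
  have "z = cis t * (cis (- t) * z)" by (simp add: cis_mult mult.assoc[symmetric])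
  also have "\<dots> = cis t * Complex (para t z) (perp t z)"
    unfolding para_def perp_def complex_surj ..
  also have "\<dots> = para t z *\<^sub>R cis t + perp t z *\<^sub>R (\<i> * cis t)"
    by (simp add: complex_eq_iff algebra_simps)
  finally show ?thesis .
qed

lemma side_point_para: "para t (side_point r m y) = r * cos h * (cos (side_dir m - t) - y * sin (side_dir m - t))"
proof -
  have "cis (- t) * side_point r m y = of_real (r * cos h) * (cis (side_dir m - t) * Complex 1 y)"
    unfolding side_point_def by (simp add: cis_mult mult.left_commute[of "cis (- t)"] mult.assoc[symmetric])
  then show ?thesis by (simp add: para_def algebra_simps)
qed

lemma side_point_perp: "perp t (side_point r m y) = r * cos h * (sin (side_dir m - t) + y * cos (side_dir m - t))"
proof -
  have "cis (- t) * side_point r m y = of_real (r * cos h) * (cis (side_dir m - t) * Complex 1 y)"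
    unfolding side_point_def by (simp add: cis_mult mult.left_commute[of "cis (- t)"] mult.assoc[symmetric])
  then show ?thesis by (simp add: perp_def algebra_simps)
qed

lemma vertex_side_point:
  "vertex n r m = side_point r m (tan h)" "vertex n r (Suc m) = side_point r m (- tan h)"
proof -
  have e: "vertex n r m = of_real r * cis (side_dir m + h)" "vertex n r (Suc m) = of_real r * cis (side_dir m - h)"
  proof -
    have a: "pi / (2 * real n) = h" "real m * pi / real n = 2 * real m * h" by (simp_all add: h_def)
    have b: "real (Suc m) * pi / real n = 2 * real m * h + 2 * h" by (simp add: h_def add_divide_distrib distrib_right)
    show "vertex n r m = of_real r * cis (side_dir m + h)" "vertex n r (Suc m) = of_real r * cis (side_dir m - h)"
      unfolding vertex_def a b side_dir_def by (simp_all add: algebra_simps)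
  qed
  have c: "cis h = of_real (cos h) * Complex 1 (tan h)" "cis (- h) = of_real (cos h) * Complex 1 (- tan h)"
    using cos_h by (simp_all add: complex_eq_iff tan_def)
  have "cis (side_dir m + h) = cis (side_dir m) * cis h" "cis (side_dir m - h) = cis (side_dir m) * cis (- h)"
    by (simp_all add: cis_mult)
  then show "vertex n r m = side_point r m (tan h)" "vertex n r (Suc m) = side_point r m (- tan h)"
    unfolding e c side_point_def by (simp_all add: mult_ac)
qed

lemma side_point_combination:
  "(1 - u) *\<^sub>R side_point r m a + u *\<^sub>R side_point r m b = side_point r m ((1 - u) * a + u * b)"
proof -
  have "(1 - u) *\<^sub>R Complex 1 a + u *\<^sub>R Complex 1 b = Complex 1 ((1 - u) * a + u * b)"
    by (simp add: complex_eq_iff)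
  then have "side_point r m ((1 - u) * a + u * b)
      = of_real (r * cos h) * (cis (side_dir m) * ((1 - u) *\<^sub>R Complex 1 a + u *\<^sub>R Complex 1 b))"
    unfolding side_point_def by simp
  also have "\<dots> = (1 - u) *\<^sub>R side_point r m a + u *\<^sub>R side_point r m b"
    unfolding side_point_def by (simp only: distrib_left mult_scaleR_right)
  finally show ?thesis ..
qed

lemma open_side_iff:
  assumes "0 < r"
  shows "z \<in> open_side n r m \<longleftrightarrow> (\<exists>y. \<bar>y\<bar> < tan h \<and> z = side_point r m y)"
proof
  assume "z \<in> open_side n r m"
  then obtain u where u: "0 < u" "u < 1" "z = (1 - u) *\<^sub>R side_point r m (tan h) + u *\<^sub>R side_point r m (- tan h)"
    unfolding open_side_def vertex_side_point(2) unfolding vertex_side_point(1) by (auto simp: in_segment)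
  have "z = side_point r m ((1 - 2 * u) * tan h)"
    unfolding u(3) side_point_combination by (simp add: algebra_simps)
  moreover have "\<bar>(1 - 2 * u) * tan h\<bar> < tan h"
    using u tan_h by (simp add: abs_mult abs_less_iff)
  ultimately show "\<exists>y. \<bar>y\<bar> < tan h \<and> z = side_point r m y" by blast
next
  assume "\<exists>y. \<bar>y\<bar> < tan h \<and> z = side_point r m y"
  then obtain y where y: "\<bar>y\<bar> < tan h" "z = side_point r m y" by blast
  define u where "u = (1 - y / tan h) / 2"
  have u: "0 < u" "u < 1" using y(1) tan_h by (auto simp: u_def field_simps abs_less_iff)
  have "(1 - u) * tan h + u * (- tan h) = y" using tan_h by (simp add: u_def field_simps)
  then have "z = (1 - u) *\<^sub>R side_point r m (tan h) + u *\<^sub>R side_point r m (- tan h)"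
    unfolding side_point_combination using y by simp
  moreover have "side_point r m (tan h) \<noteq> side_point r m (- tan h)"
    using assms tan_h cos_h by (auto simp: side_point_def complex_eq_iff[of "Complex _ _"])
  ultimately show "z \<in> open_side n r m"
    unfolding open_side_def vertex_side_point(2) unfolding vertex_side_point(1) in_segment using u by blast
qed

lemma two_pi_h: "2 * pi = real (2 * n) * (2 * h)"
  using n_h by (simp add: mult.commute)

lemma cis_side_dir_mod: "cis (side_dir (m mod (2 * n))) = cis (side_dir m)"
proof -
  have "real m = real (m mod (2 * n)) + real (m div (2 * n)) * real (2 * n)"
    by (metis add.commute div_mult_mod_eq of_nat_add of_nat_mult)
  then have "side_dir m = side_dir (m mod (2 * n)) - real (m div (2 * n)) * (real (2 * n) * (2 * h))"
    unfolding side_dir_def by (simp add: algebra_simps)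
  then have "side_dir (m mod (2 * n)) = side_dir m + 2 * pi * of_int (int (m div (2 * n)))"
    unfolding two_pi_h[symmetric] by simp
  then show ?thesis by (simp only: cis_mult[symmetric] cis_multiple_2pi Ints_of_int mult_1_right)
qed

lemma side_point_mod: "side_point r (m mod (2 * n)) y = side_point r m y"
  unfolding side_point_def cis_side_dir_mod ..

lemma cis_side_dir_opposite: "cis (side_dir (m + n)) = - cis (side_dir m)"
proof -
  have "side_dir (m + n) = side_dir m - pi" using n_h by (simp add: side_dir_def algebra_simps)
  then show ?thesis by (simp add: complex_eq_iff)
qed

lemma glue_side_point: "glue n r m (side_point r m y) = side_point r ((m + n) mod (2 * n)) (- y)"
proof -
  have "vertex n r m + vertex n r (Suc m) = of_real (r * cos h) * (cis (side_dir m) * 2)"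
    unfolding vertex_side_point(2) unfolding vertex_side_point(1) side_point_def by (simp add: complex_eq_iff algebra_simps)
  then have "glue n r m (side_point r m y) = of_real (r * cos h) * (cis (side_dir m) * (Complex 1 y - 2))"
    unfolding glue_def side_point_def by (simp add: algebra_simps)
  also have "Complex 1 y - 2 = - Complex 1 (- y)" by (simp add: complex_eq_iff)
  finally show ?thesis unfolding side_point_mod unfolding side_point_def cis_side_dir_opposite by simp
qed

section \<open>The polygon as an intersection of half-planes\<close>

text \<open>As \<open>2 * pi\<close> is the even multiple \<open>4 n h\<close>, an odd multiple of
  \<open>h\<close> reduced modulo \<open>2 * pi\<close> keeps distance \<open>h\<close> from
  \<open>0\<close> and \<open>2 * pi\<close>. Vertices lie at odd multiples of \<open>h\<close> from
  the normal of any side.\<close>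

lemma cos_odd_multiple_le: "cos ((2 * of_int d + 1) * h) \<le> cos h"
proof -
  define e where "e = d mod (2 * int n)"
  have e: "0 \<le> e" "e < 2 * int n" using two_le by (simp_all add: e_def)
  have "d = e + (d div (2 * int n)) * (2 * int n)" unfolding e_def by (rule mod_div_mult_eq[symmetric])
  then have "real_of_int d = real_of_int (e + (d div (2 * int n)) * (2 * int n))" by (rule arg_cong)
  then have "real_of_int d = of_int e + of_int (d div (2 * int n)) * real (2 * n)" by simp
  then have "(2 * real_of_int d + 1) * h = (2 * of_int e + 1) * h + of_int (d div (2 * int n)) * (real (2 * n) * (2 * h))"
    by (simp add: algebra_simps)
  then have "(2 * of_int d + 1) * h = (2 * of_int e + 1) * h + 2 * pi * of_int (d div (2 * int n))"
    unfolding two_pi_h[symmetric] by simp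
  then have c: "cos ((2 * of_int d + 1) * h) = cos ((2 * of_int e + 1) * h)"
    by (simp add: cos_add sin_times_pi_eq_0 mult.commute[of pi])
  have "of_int e + 1 \<le> real (2 * n)" using e by linarith
  then have "(of_int e + 1) * (2 * h) \<le> real (2 * n) * (2 * h)" using h_pos by (intro mult_right_mono) auto
  then have hi: "(2 * of_int e + 1) * h \<le> 2 * pi - h" unfolding two_pi_h by (simp add: algebra_simps)
  have "0 \<le> of_int e * h" using e h_pos by simp
  then have lo: "h \<le> (2 * of_int e + 1) * h" by (simp add: algebra_simps)
  show ?thesis
  proof (cases "(2 * of_int e + 1) * h \<le> pi")
    case True
    then show ?thesis unfolding c using lo h_pos by (intro cos_monotone_0_pi_le) auto
  next
    case False
    have "cos (2 * pi - (2 * of_int e + 1) * h) \<le> cos h"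
      using False hi h_pos by (intro cos_monotone_0_pi_le) auto
    then show ?thesis unfolding c by (simp add: cos_diff)
  qed
qed

lemma side_dir_diff: "side_dir m - side_dir m' = 2 * of_int (int m' - int m) * h"
  by (simp add: side_dir_def algebra_simps)

lemma vertex_halfplane: "cos (side_dir m - side_dir m') + tan h * \<bar>sin (side_dir m - side_dir m')\<bar> \<le> 1"
proof -
  let ?D = "side_dir m - side_dir m'"
  define d where "d = int m' - int m"
  have D: "?D = 2 * of_int d * h" unfolding side_dir_diff d_def ..
  have "cos (?D + h) \<le> cos h" "cos (?D - h) \<le> cos h"
    using cos_odd_multiple_le[of d] cos_odd_multiple_le[of "d - 1"] unfolding D by (simp_all add: algebra_simps)
  then have "cos ?D * cos h + sin h * \<bar>sin ?D\<bar> \<le> cos h" by (simp add: cos_add cos_diff abs_if mult.commute)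
  then show ?thesis using cos_h by (simp add: tan_def field_simps)
qed

lemma side_point_halfplane:
  assumes "0 < r" "\<bar>y\<bar> \<le> tan h"
  shows "para (side_dir m') (side_point r m y) \<le> r * cos h"
proof -
  let ?D = "side_dir m - side_dir m'"
  have "- y * sin ?D \<le> \<bar>y\<bar> * \<bar>sin ?D\<bar>" by (metis abs_ge_self abs_minus_cancel abs_mult)
  also have "\<dots> \<le> tan h * \<bar>sin ?D\<bar>" using assms by (intro mult_right_mono) auto
  finally have "cos ?D - y * sin ?D \<le> 1" using vertex_halfplane[of m m'] by simp
  then have "r * cos h * (cos ?D - y * sin ?D) \<le> r * cos h * 1" using assms cos_h by (intro mult_left_mono) auto
  then show ?thesis by (simp add: side_point_para)
qed

text \<open>If the sine of the angle between the normals vanishes, the normals are opposite because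
  the sides differ; otherwise the strict bound on \<open>y\<close> leaves a gap. Strictness later
  yields positive flight times and interior points.\<close>

lemma side_point_strict_halfplane:
  assumes "0 < r" "\<bar>y\<bar> < tan h" "m < 2 * n" "m' < 2 * n" "m \<noteq> m'"
  shows "para (side_dir m') (side_point r m y) < r * cos h"
proof -
  let ?D = "side_dir m - side_dir m'"
  have "cos ?D - y * sin ?D < 1"
  proof (cases "sin ?D = 0")
    case True
    have "cos ?D \<noteq> 1"
    proof
      assume "cos ?D = 1"
      then obtain k :: int where "?D = of_int k * 2 * pi" using cos_one_2pi_int by blast
      then have "2 * of_int (int m' - int m) * h = of_int (k * (2 * int n)) * (2 * h)"
        unfolding side_dir_diff using n_h by (simp add: algebra_simps)
      then have "of_int (int m' - int m) * (2 * h) = of_int (k * (2 * int n)) * (2 * h)" by (simp only: mult_ac)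
      then have "int m' - int m = k * (2 * int n)" using h_pos of_int_eq_iff by (metis mult_cancel_right mult_eq_0_iff less_irrefl zero_neq_numeral)
      then have "(2 * int n) dvd (int m' - int m)" by simp
      moreover have "\<bar>int m' - int m\<bar> < 2 * int n" using assms by linarith
      ultimately show False using assms(5) zdvd_not_zless zdvd_imp_le by (smt (verit, best) dvd_minus_iff of_nat_eq_iff)
    qed
    then have "cos ?D < 1" using cos_le_one[of ?D] by (metis less_le)
    then show ?thesis using True by simp
  next
    case False
    have "- y * sin ?D \<le> \<bar>y\<bar> * \<bar>sin ?D\<bar>" by (metis abs_ge_self abs_minus_cancel abs_mult)
    also have "\<dots> < tan h * \<bar>sin ?D\<bar>" using assms(2) False by (intro mult_strict_right_mono) auto
    finally show ?thesis using vertex_halfplane[of m m'] by simp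
  qed
  then have "r * cos h * (cos ?D - y * sin ?D) < r * cos h * 1" using assms(1) cos_h by (intro mult_strict_left_mono) auto
  then show ?thesis by (simp add: side_point_para)
qed

lemma polygon_halfplane:
  assumes "0 < r"
  shows "regular_polygon n r \<subseteq> {z. para (side_dir m) z \<le> r * cos h}"
  unfolding regular_polygon_def para_inner
proof (rule hull_minimal)
  show "vertex n r ` {..<2 * n} \<subseteq> {z. inner (cis (side_dir m)) z \<le> r * cos h}"
    using side_point_halfplane[OF assms, of "tan h"] tan_h by (auto simp: vertex_side_point para_inner)
  show "convex {z. inner (cis (side_dir m)) z \<le> r * cos h}" by (rule convex_halfspace_le)
qed

lemma interior_polygon_halfplane:
  assumes "0 < r" "z \<in> interior (regular_polygon n r)"
  shows "para (side_dir m) z < r * cos h"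
proof -
  have "z \<in> interior {z. inner (cis (side_dir m)) z \<le> r * cos h}"
    using assms interior_mono[OF polygon_halfplane[OF assms(1), of m]] unfolding para_inner by blast
  moreover have "cis (side_dir m) \<noteq> 0" by simp
  ultimately show ?thesis unfolding para_inner by (simp add: interior_halfspace_le)
qed

lemma vertex_in_polygon: "vertex n r m \<in> regular_polygon n r"
proof -
  have "vertex n r (m mod (2 * n)) = vertex n r m" unfolding vertex_side_point(1) side_point_mod ..
  moreover have "vertex n r (m mod (2 * n)) \<in> vertex n r ` {..<2 * n}" using two_le by simp
  ultimately show ?thesis unfolding regular_polygon_def by (metis hull_inc)
qed

lemma side_point_in_polygon:
  assumes "\<bar>y\<bar> \<le> tan h"
  shows "side_point r m y \<in> regular_polygon n r"
proof -
  define u where "u = (1 - y / tan h) / 2"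
  have u: "0 \<le> u" "u \<le> 1" using assms tan_h by (auto simp: u_def field_simps abs_le_iff)
  have "(1 - u) * tan h + u * (- tan h) = y" using tan_h by (simp add: u_def field_simps)
  then have "side_point r m y = (1 - u) *\<^sub>R vertex n r m + u *\<^sub>R vertex n r (Suc m)"
    unfolding vertex_side_point(2) unfolding vertex_side_point(1) side_point_combination by simp
  then show ?thesis
    using convexD_alt[of "regular_polygon n r"] u vertex_in_polygon by (simp add: regular_polygon_def)
qed

text \<open>A nonzero \<open>z\<close> lies in the cone over some side, so it is a multiple
  \<open>u\<close> of a point of that side; the half-plane of this side gives \<open>u < 1\<close>,
  and convexity with the centre does the rest.\<close>

lemma halfplanes_in_polygon:
  assumes r: "0 < r" and z: "\<And>m. m < 2 * n \<Longrightarrow> para (side_dir m) z < r * cos h"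
  shows "z \<in> regular_polygon n r"
proof -
  have z0: "0 \<in> regular_polygon n r"
  proof -
    have "side_point r 0 0 = - side_point r n 0"
      using cis_side_dir_opposite[of 0] by (simp add: side_point_def)
    then have "0 = (1 - 1/2) *\<^sub>R side_point r 0 0 + (1/2) *\<^sub>R side_point r n 0" by simp
    then show ?thesis
      using convexD_alt[of "regular_polygon n r" "side_point r 0 0" "side_point r n 0" "1/2"]
        side_point_in_polygon[of 0 r] tan_h by (simp add: regular_polygon_def)
  qed
  show ?thesis
  proof (cases "z = 0")
    case True
    then show ?thesis using z0 by simp
  next
    case False
    \<comment> \<open>Rounding to the index of the side whose normal is nearest to \<open>z\<close>
      in angle; the summand \<open>h\<close> contributes the one half before taking the
      floor.\<close>
    define M where "M = \<lfloor>(pi / 2 + h - Arg z) / (2 * h)\<rfloor>"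
    define m where "m = nat (M mod (2 * int n))"
    define \<delta> where "\<delta> = Arg z - (pi / 2 - 2 * of_int M * h)"
    have M: "of_int M \<le> (pi / 2 + h - Arg z) / (2 * h)" "(pi / 2 + h - Arg z) / (2 * h) < of_int M + 1"
      unfolding M_def by linarith+
    then have \<delta>: "- h \<le> \<delta>" "\<delta> \<le> h" using h_pos by (simp_all add: \<delta>_def field_simps)
    have m: "m < 2 * n" using two_le by (simp add: m_def nat_less_iff)
    have "int m = M mod (2 * int n)" using two_le by (simp add: m_def)
    then have "M = int m + (M div (2 * int n)) * (2 * int n)" by (simp only: mod_div_mult_eq)
    then have "real_of_int M = real_of_int (int m + (M div (2 * int n)) * (2 * int n))" by (rule arg_cong)
    then have "real_of_int M = real m + of_int (M div (2 * int n)) * real (2 * n)" by simp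
    then have "Arg z = side_dir m + \<delta> - of_int (M div (2 * int n)) * (real (2 * n) * (2 * h))"
      unfolding \<delta>_def side_dir_def by (simp add: algebra_simps)
    then have a: "side_dir m + \<delta> = Arg z + 2 * pi * of_int (M div (2 * int n))"
      unfolding two_pi_h[symmetric] by simp
    have "cis (Arg z) = cis (side_dir m) * cis \<delta>"
      unfolding cis_mult a by (simp only: cis_mult[symmetric] cis_multiple_2pi Ints_of_int mult_1_right)
    then have zc: "z = of_real (cmod z) * (cis (side_dir m) * cis \<delta>)"
      using rcis_cmod_Arg[of z] by (simp add: rcis_def)
    have "h < pi / 2" using h_le pi_gt_zero by linarith
    then have cd: "0 < cos \<delta>" using \<delta> by (intro cos_gt_zero_pi) auto
    define u where "u = cmod z * cos \<delta> / (r * cos h)"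
    have "cis \<delta> = of_real (cos \<delta>) * Complex 1 (tan \<delta>)" using cd by (simp add: complex_eq_iff tan_def)
    then have zu: "z = u *\<^sub>R side_point r m (tan \<delta>)"
      using zc r cos_h by (simp add: u_def side_point_def scaleR_conv_of_real mult_ac)
    have "para (side_dir m) z = u * (r * cos h)" unfolding zu para_linear side_point_para by simp
    then have "u < 1" using z[OF m] r cos_h by simp
    moreover have "0 \<le> u" using cd r cos_h by (simp add: u_def)
    moreover have "\<bar>tan \<delta>\<bar> \<le> tan h"
    proof -
      have "tan \<delta> \<le> tan h" by (rule tan_mono_le) (use \<delta> \<open>h < pi / 2\<close> h_pos in auto)
      moreover have "tan (- h) \<le> tan \<delta>" by (rule tan_mono_le) (use \<delta> \<open>h < pi / 2\<close> h_pos in auto)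
      ultimately show ?thesis by simp
    qed
    ultimately show ?thesis
      using convexD_alt[of "regular_polygon n r" 0 "side_point r m (tan \<delta>)" u] z0 side_point_in_polygon[of "tan \<delta>" r m] zu
      by (simp add: regular_polygon_def)
  qed
qed

lemma halfplanes_in_interior:
  assumes r: "0 < r" and z: "\<And>m. m < 2 * n \<Longrightarrow> para (side_dir m) z < r * cos h"
  shows "z \<in> interior (regular_polygon n r)"
proof -
  let ?S = "\<Inter>m\<in>{..<2 * n}. {z. inner (cis (side_dir m)) z < r * cos h}"
  have "open ?S" by (intro open_INT ballI open_halfspace_lt) auto
  moreover have "?S \<subseteq> regular_polygon n r" using halfplanes_in_polygon[OF r] by (auto simp: para_inner)
  ultimately have "?S \<subseteq> interior (regular_polygon n r)" by (rule interior_maximal[rotated])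
  moreover have "z \<in> ?S" using z by (simp add: para_inner)
  ultimately show ?thesis by blast
qed

section \<open>Cutting sequences are exactly the words with a coding\<close>

lemma exit_cos_pi: "exit_cos (t - pi) = exit_cos t" "exit_cos (t + pi) = exit_cos t"
  by (simp_all add: exit_cos_def sgn_minus)

text \<open>The angles of opposite sides differ by \<open>pi\<close>, which neither
  \<open>exit_cos\<close> nor the absolute sine can see; therefore a coding can refer to labels
  only.\<close>

lemma phi_side_label:
  assumes "m < 2 * n"
  shows "side_label n m \<in> {1..n}"
    "exit_cos (phi \<theta> (side_label n m)) = exit_cos (\<theta> + 2 * real m * h)"
    "\<bar>sin (phi \<theta> (side_label n m))\<bar> = \<bar>sin (\<theta> + 2 * real m * h)\<bar>"
proof -
  show "side_label n m \<in> {1..n}" using two_le by (simp add: side_label_def Suc_le_eq)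
  have p: "phi \<theta> (side_label n m) = \<theta> + 2 * real (m mod n) * h" by (simp add: phi_def side_label_def)
  have "phi \<theta> (side_label n m) = \<theta> + 2 * real m * h \<or> phi \<theta> (side_label n m) = \<theta> + 2 * real m * h - pi"
  proof (cases "m < n")
    case False
    then have j: "real (m mod n) = real m - real n" using assms by (simp add: le_mod_geq)
    have "phi \<theta> (side_label n m) = \<theta> + 2 * real m * h - 2 * (real n * h)" unfolding p j by (simp add: algebra_simps)
    then show ?thesis using n_h by simp
  qed (simp add: p)
  then show "exit_cos (phi \<theta> (side_label n m)) = exit_cos (\<theta> + 2 * real m * h)"
    "\<bar>sin (phi \<theta> (side_label n m))\<bar> = \<bar>sin (\<theta> + 2 * real m * h)\<bar>"
    by (auto simp: exit_cos_pi)
qed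

lemma side_dir_sin_cos: "cos (\<theta> - side_dir m) = sin (\<theta> + 2 * real m * h)" "cos (side_dir m - \<theta>) = sin (\<theta> + 2 * real m * h)"
    "sin (side_dir m - \<theta>) = cos (\<theta> + 2 * real m * h)"
proof -
  have e: "side_dir m - \<theta> = pi / 2 - (\<theta> + 2 * real m * h)" by (simp add: side_dir_def)
  show c: "cos (side_dir m - \<theta>) = sin (\<theta> + 2 * real m * h)" "sin (side_dir m - \<theta>) = cos (\<theta> + 2 * real m * h)"
    unfolding e by (simp_all add: cos_diff sin_diff)
  then show "cos (\<theta> - side_dir m) = sin (\<theta> + 2 * real m * h)" by (metis cos_minus minus_diff_eq)
qed

lemma opposite_sin_cos:
  "sin (\<theta> + 2 * real ((m + n) mod (2 * n)) * h) = - sin (\<theta> + 2 * real m * h)"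
  "cos (\<theta> + 2 * real ((m + n) mod (2 * n)) * h) = - cos (\<theta> + 2 * real m * h)"
proof -
  have c: "cis (side_dir ((m + n) mod (2 * n))) = - cis (side_dir m)"
    unfolding cis_side_dir_mod cis_side_dir_opposite ..
  have "para \<theta> (cis (side_dir ((m + n) mod (2 * n)))) = - para \<theta> (cis (side_dir m))"
    "perp \<theta> (cis (side_dir ((m + n) mod (2 * n)))) = - perp \<theta> (cis (side_dir m))"
    unfolding c by (simp_all add: para_def perp_def)
  then show "sin (\<theta> + 2 * real ((m + n) mod (2 * n)) * h) = - sin (\<theta> + 2 * real m * h)"
  "cos (\<theta> + 2 * real ((m + n) mod (2 * n)) * h) = - cos (\<theta> + 2 * real m * h)"
    unfolding para_cis perp_cis side_dir_sin_cos .
qed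

lemma cutting_sequence_is_coding:
  assumes r: "0 < r" and w: "w \<in> cutting_sequences n r"
  obtains \<theta> where "w \<in> codings \<theta>"
proof -
  obtain v \<gamma> T \<sigma> where lt: "linear_trajectory n r v \<gamma> T \<sigma>" and wk: "\<And>k. w k = side_label n (\<sigma> k)"
    using w unfolding cutting_sequences_def by blast
  define \<theta> where "\<theta> = Arg v"
  have v: "v = cmod v *\<^sub>R cis \<theta>" using rcis_cmod_Arg[of v] by (simp add: rcis_def \<theta>_def scaleR_conv_of_real)
  have v0: "v \<noteq> 0" and T: "strict_mono T" and \<sigma>: "\<And>k. \<sigma> k < 2 * n"
    and lin: "\<And>k t. T k \<le> t \<Longrightarrow> t < T (k + 1) \<Longrightarrow> \<gamma> t = \<gamma> (T k) + (t - T k) *\<^sub>R v"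
    and int: "\<And>k t. T k < t \<Longrightarrow> t < T (k + 1) \<Longrightarrow> \<gamma> t \<in> interior (regular_polygon n r)"
    and hit: "\<And>k. \<gamma> (T k) + (T (k + 1) - T k) *\<^sub>R v \<in> open_side n r (\<sigma> (k + 1))"
    and gl: "\<And>k. \<gamma> (T (k + 1)) = glue n r (\<sigma> (k + 1)) (\<gamma> (T k) + (T (k + 1) - T k) *\<^sub>R v)"
    using lt unfolding linear_trajectory_def Let_def by auto
  have "\<exists>y. \<bar>y\<bar> < tan h \<and> \<gamma> (T (k - 1)) + (T k - T (k - 1)) *\<^sub>R v = side_point r (\<sigma> k) y" for k
    using hit[of "k - 1"] open_side_iff[OF r] by simp
  then obtain y where y: "\<And>k. \<bar>y k\<bar> < tan h"
    and q: "\<And>k. \<gamma> (T (k - 1)) + (T k - T (k - 1)) *\<^sub>R v = side_point r (\<sigma> k) (y k)" by metis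
  have q': "\<gamma> (T k) + (T (k + 1) - T k) *\<^sub>R v = side_point r (\<sigma> (k + 1)) (y (k + 1))" for k
    using q[of "k + 1"] by simp
  have p: "\<gamma> (T k) = side_point r ((\<sigma> k + n) mod (2 * n)) (- y k)" for k
    using gl[of "k - 1"] q[of k] glue_side_point by simp
  let ?f = "\<lambda>k. \<theta> + 2 * real (\<sigma> k) * h"
  have pos': "0 < sin (?f (k + 1))" for k
  proof -
    \<comment> \<open>At an intermediate time the point is strictly inside the half-plane of the
      side hit next, so the velocity points outwards there and the sine of that side is
      positive.\<close>
    define t where "t = (T k + T (k + 1)) / 2"
    have tk: "T k < t" "t < T (k + 1)" using T by (simp_all add: t_def strict_mono_less)
    let ?a = "side_dir (\<sigma> (k + 1))"
    have "\<gamma> t = (\<gamma> (T k) + (T (k + 1) - T k) *\<^sub>R v) - (T (k + 1) - t) *\<^sub>R v"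
      using lin[of k t] tk by (simp add: algebra_simps)
    then have "\<gamma> t = side_point r (\<sigma> (k + 1)) (y (k + 1)) - (T (k + 1) - t) *\<^sub>R v"
      unfolding q' .
    moreover have "para ?a (\<gamma> t) < r * cos h" by (rule interior_polygon_halfplane[OF r int[OF tk]])
    ultimately have "0 < (T (k + 1) - t) * para ?a v" by (simp add: para_linear side_point_para)
    then have "0 < para ?a v" using tk by (simp add: zero_less_mult_iff)
    then have "0 < cmod v * cos (\<theta> - ?a)" by (subst (asm) v) (simp add: para_linear para_cis)
    then show ?thesis using v0 by (simp add: zero_less_mult_iff side_dir_sin_cos)
  qed
  have pos: "0 < sin (?f k)" for k using pos'[of "k - 1"] by simp
  have vp: "perp \<theta> v = 0" by (subst v) (simp add: perp_linear perp_cis)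
  define x where "x k = - (y k * sin (?f k))" for k
  have "x (k + 1) - x k = cos (?f k) + cos (?f (k + 1))" for k
  proof -
    have "perp \<theta> (side_point r (\<sigma> (k + 1)) (y (k + 1))) = perp \<theta> (side_point r ((\<sigma> k + n) mod (2 * n)) (- y k))"
      unfolding q'[symmetric] p[symmetric] perp_linear vp by simp
    then have "r * cos h * (cos (?f (k + 1)) + y (k + 1) * sin (?f (k + 1))) = r * cos h * (- cos (?f k) + y k * sin (?f k))"
      unfolding side_point_perp side_dir_sin_cos opposite_sin_cos by simp
    then have "cos (?f (k + 1)) + y (k + 1) * sin (?f (k + 1)) = - cos (?f k) + y k * sin (?f k)"
      using r cos_h by simp
    then show ?thesis by (simp add: x_def)
  qed
  moreover have "\<bar>x k\<bar> < tan h * sin (?f k)" for k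
    using y[of k] pos[of k] by (simp add: x_def abs_mult)
  moreover have "exit_cos (?f k) = cos (?f k)" for k using pos[of k] by (simp add: exit_cos_def)
  moreover have "w \<in> words n" using phi_side_label(1)[OF \<sigma>] by (intro wordsI) (simp add: wk)
  ultimately have "is_coding \<theta> w x"
    unfolding is_coding_def wk phi_side_label(2,3)[OF \<sigma>] using pos by (simp add: less_imp_le)
  then show ?thesis using that unfolding codings_def by blast
qed

lemma coding_is_cutting_sequence:
  assumes r: "0 < r" and w: "w \<in> codings \<theta>"
  shows "w \<in> cutting_sequences n r"
proof -
  obtain x where c: "is_coding \<theta> w x" using w unfolding codings_def by blast
  note wr = wordsD[OF is_codingD(1)[OF c]]
  \<comment> \<open>Of the two sides with the given label, the one crossed outwards is the one with
    positive sine.\<close>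
  define \<sigma> where "\<sigma> k = (if 0 < sin (phi \<theta> (w k)) then w k - 1 else w k - 1 + n)" for k
  let ?f = "\<lambda>k. \<theta> + 2 * real (\<sigma> k) * h"
  have \<sigma>: "\<sigma> k < 2 * n" for k using wr[of k] by (auto simp: \<sigma>_def)
  have wk: "w k = side_label n (\<sigma> k)" for k
  proof -
    have "w k - 1 < n" using wr[of k] by linarith
    then show ?thesis using wr[of k] unfolding \<sigma>_def side_label_def by (simp only: mod_add_self2 mod_less split: if_split) simp
  qed
  have f: "?f k = (if 0 < sin (phi \<theta> (w k)) then phi \<theta> (w k) else phi \<theta> (w k) + pi)" for k
    using wr[of k] n_h by (simp add: \<sigma>_def phi_def of_nat_diff algebra_simps)
  have pos: "0 < sin (?f k)" for k
    unfolding f using is_codingD(3)[OF c, of k] by simp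
  have as: "\<bar>sin (phi \<theta> (w k))\<bar> = sin (?f k)" for k
    unfolding wk phi_side_label(3)[OF \<sigma>] using pos[of k] by simp
  have xb: "\<bar>x k\<bar> < tan h * sin (?f k)" for k using is_codingD(2)[OF c, of k] as by simp
  have ec: "exit_cos (phi \<theta> (w k)) = cos (?f k)" for k
    unfolding wk phi_side_label(2)[OF \<sigma>] using pos[of k] by (simp add: exit_cos_def)
  have xs: "x (k + 1) - x k = cos (?f k) + cos (?f (k + 1))" for k using is_codingD(4)[OF c, of k] ec by simp
  define y where "y k = - x k / sin (?f k)" for k
  have ys: "y k * sin (?f k) = - x k" for k using pos[of k] by (simp add: y_def)
  have y: "\<bar>y k\<bar> < tan h" for k
    using xb[of k] pos[of k] by (simp add: y_def abs_divide pos_divide_less_eq)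
  define q where "q k = side_point r (\<sigma> k) (y k)" for k
  define \<sigma>' where "\<sigma>' k = (\<sigma> k + n) mod (2 * n)" for k
  define p where "p k = side_point r (\<sigma>' k) (- y k)" for k
  have \<sigma>': "\<sigma>' k < 2 * n" for k using two_le by (simp add: \<sigma>'_def)
  have pq: "p k = glue n r (\<sigma> k) (q k)" for k unfolding p_def q_def glue_side_point \<sigma>'_def ..
  have ne: "\<sigma> l \<noteq> \<sigma>' k" for k l
    using pos[of l] pos[of k] opposite_sin_cos(1)[of \<theta> "\<sigma> k"] unfolding \<sigma>'_def by auto
  define \<tau> where "\<tau> k = para \<theta> (q (k + 1) - p k)" for k
  have move: "q (k + 1) = p k + \<tau> k *\<^sub>R cis \<theta>" for k
  proof -
    have "perp \<theta> (q (k + 1) - p k) = r * cos h * ((cos (?f (k + 1)) + y (k + 1) * sin (?f (k + 1))) - (- cos (?f k) + y k * sin (?f k)))"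
      unfolding q_def p_def \<sigma>'_def perp_linear side_point_perp side_dir_sin_cos opposite_sin_cos by (simp add: algebra_simps)
    also have "\<dots> = 0" unfolding ys using xs[of k] by simp
    finally have "q (k + 1) - p k = \<tau> k *\<^sub>R cis \<theta>" using para_perp_decomp[of "q (k + 1) - p k" \<theta>] by (simp add: \<tau>_def)
    then show ?thesis by (simp add: algebra_simps)
  qed
  have \<tau>: "0 < \<tau> k" for k
  proof -
    have "para (side_dir (\<sigma>' k)) (q (k + 1)) < r * cos h"
      unfolding q_def by (rule side_point_strict_halfplane[OF r y \<sigma> \<sigma>' ne])
    moreover have "para (side_dir (\<sigma>' k)) (p k) = r * cos h" by (simp add: p_def side_point_para)
    ultimately have "\<tau> k * cos (\<theta> - side_dir (\<sigma>' k)) < 0" unfolding move para_linear para_cis by simp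
    then show ?thesis
      using pos[of k] by (simp add: side_dir_sin_cos \<sigma>'_def opposite_sin_cos zero_less_mult_iff)
  qed
  obtain T where T0: "T 0 = (0::real)" and T: "\<And>k. T (k + 1) = T k + \<tau> k"
    using int_partial_sums[of 0 "0::real" \<tau>] by blast
  have sm: "strict_mono T" by (rule strict_mono_intI) (simp add: T \<tau>)
  \<comment> \<open>A single flight time has no evident lower bound. But \<open>T k\<close> minus
    the coordinate \<open>g k\<close> of the exit point along the direction grows by the component
    of the translation between opposite sides, which takes finitely many positive values, and
    \<open>g\<close> is bounded.\<close>
  have unbounded: "\<exists>a. T a \<le> t" "\<exists>b. t < T b" for t
  proof -
    let ?S = "(\<lambda>j. \<bar>sin (phi \<theta> j)\<bar>) ` {1..n} \<inter> {0<..}"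
    define s where "s = Min ?S"
    have mem: "sin (?f k) \<in> ?S" for k using as[of k, symmetric] pos[of k] wr[of k] by auto
    have "s \<in> ?S" unfolding s_def by (rule Min_in) (use mem[of 0] in auto)
    then have s: "0 < s" by simp
    have sle: "s \<le> sin (?f k)" for k unfolding s_def using mem[of k] by (intro Min_le) auto
    define c where "c = 2 * (r * cos h) * s"
    have c0: "0 < c" using r cos_h s by (simp add: c_def)
    define g where "g k = para \<theta> (q k)" for k
    define G where "G = r * cos h * (1 + tan h)"
    have gb: "\<bar>g k\<bar> \<le> G" for k
    proof -
      have "\<bar>sin (?f k) - y k * cos (?f k)\<bar> \<le> \<bar>sin (?f k)\<bar> + \<bar>y k\<bar> * \<bar>cos (?f k)\<bar>" by (metis abs_mult abs_triangle_ineq4)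
      also have "\<dots> \<le> 1 + tan h * 1" using y[of k] tan_h by (intro add_mono mult_mono) auto
      finally have "r * cos h * \<bar>sin (?f k) - y k * cos (?f k)\<bar> \<le> G"
        unfolding G_def using r cos_h by (intro mult_left_mono) auto
      then show ?thesis unfolding g_def q_def side_point_para side_dir_sin_cos using r cos_h by (simp add: abs_mult)
    qed
    have \<tau>g: "\<tau> k = g (k + 1) - g k + 2 * (r * cos h) * sin (?f k)" for k
      unfolding \<tau>_def g_def p_def q_def \<sigma>'_def para_linear side_point_para side_dir_sin_cos opposite_sin_cos
      by (simp add: algebra_simps)
    have step: "T k - g k + c \<le> T (k + 1) - g (k + 1)" for k
    proof -
      have "c \<le> 2 * (r * cos h) * sin (?f k)" unfolding c_def using sle[of k] r cos_h by (intro mult_left_mono) auto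
      then show ?thesis unfolding T \<tau>g by simp
    qed
    have grow: "T k - g k + c * real d \<le> T (k + int d) - g (k + int d)" for k d
    proof (induction d)
      case (Suc d)
      then show ?case using step[of "k + int d"] by (simp add: algebra_simps)
    qed simp
    define d where "d = nat \<lceil>(\<bar>t\<bar> + 2 * G + 1) / c\<rceil>"
    have "(\<bar>t\<bar> + 2 * G + 1) / c \<le> real d" unfolding d_def by linarith
    then have d: "\<bar>t\<bar> + 2 * G + 1 \<le> c * real d" using c0 by (simp add: field_simps)
    have "t < T (0 + int d)" using grow[of 0 d] T0 gb[of 0] gb[of "0 + int d"] d by linarith
    then show "\<exists>b. t < T b" by blast
    have "T (- int d) \<le> t" using grow[of "- int d" d] T0 gb[of 0] gb[of "- int d"] d by simp
    then show "\<exists>a. T a \<le> t" by blast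
  qed
  have block: "\<exists>k. T k \<le> t \<and> t < T (k + 1)" for t
    using unbounded[of t] int_block[OF sm] by metis
  define idx where "idx t = (SOME k. T k \<le> t \<and> t < T (k + 1))" for t
  have idx: "idx t = k" if "T k \<le> t" "t < T (k + 1)" for t k
  proof -
    have "T (idx t) \<le> t \<and> t < T (idx t + 1)" unfolding idx_def using block by (rule someI_ex)
    then have "T (idx t) < T (k + 1)" "T k < T (idx t + 1)" using that by linarith+
    then show ?thesis using sm by (simp add: strict_mono_less)
  qed
  define \<gamma> where "\<gamma> t = p (idx t) + (t - T (idx t)) *\<^sub>R cis \<theta>" for t
  have \<gamma>: "\<gamma> t = p k + (t - T k) *\<^sub>R cis \<theta>" if "T k \<le> t" "t < T (k + 1)" for t k
    using idx[OF that] by (simp add: \<gamma>_def)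
  have \<gamma>T: "\<gamma> (T k) = p k" for k using \<gamma>[of k "T k"] \<tau>[of k] T[of k] by simp
  have q: "\<gamma> (T k) + (T (k + 1) - T k) *\<^sub>R cis \<theta> = q (k + 1)" for k
    unfolding \<gamma>T move T by simp
  have inside: "\<gamma> t \<in> interior (regular_polygon n r)" if t: "T k < t" "t < T (k + 1)" for t k
  proof (rule halfplanes_in_interior[OF r])
    fix m assume m: "m < 2 * n"
    define s where "s = (t - T k) / \<tau> k"
    have s: "0 < s" "s < 1" using t \<tau>[of k] T[of k] by (simp_all add: s_def field_simps)
    have "(t - T k) *\<^sub>R cis \<theta> = s *\<^sub>R (\<tau> k *\<^sub>R cis \<theta>)" using \<tau>[of k] by (simp add: s_def)
    also have "\<dots> = s *\<^sub>R (q (k + 1) - p k)" using move[of k] by simp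
    finally have "\<gamma> t = p k + s *\<^sub>R (q (k + 1) - p k)" using \<gamma>[of k t] t by simp
    then have "\<gamma> t = (1 - s) *\<^sub>R p k + s *\<^sub>R q (k + 1)" by (simp add: scaleR_diff_left scaleR_diff_right)
    then have e: "para (side_dir m) (\<gamma> t) = (1 - s) * para (side_dir m) (p k) + s * para (side_dir m) (q (k + 1))"
      by (simp add: para_linear)
    have yw: "\<bar>- y k\<bar> < tan h" using y[of k] by simp
    have pb: "para (side_dir m) (p k) \<le> r * cos h" "m \<noteq> \<sigma>' k \<Longrightarrow> para (side_dir m) (p k) < r * cos h"
      unfolding p_def using side_point_halfplane[OF r less_imp_le[OF yw]] side_point_strict_halfplane[OF r yw \<sigma>'[of k] m] by auto
    have qb: "para (side_dir m) (q (k + 1)) \<le> r * cos h" "m \<noteq> \<sigma> (k + 1) \<Longrightarrow> para (side_dir m) (q (k + 1)) < r * cos h"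
      unfolding q_def using side_point_halfplane[OF r less_imp_le[OF y]] side_point_strict_halfplane[OF r y \<sigma> m] by auto
    let ?A = "r * cos h"
    have l: "(1 - s) * para (side_dir m) (p k) \<le> (1 - s) * ?A" "s * para (side_dir m) (q (k + 1)) \<le> s * ?A"
      using s pb(1) qb(1) by (auto intro!: mult_left_mono)
    \<comment> \<open>No side is both the side of entry and the side of exit of one flight, so at
      least one end of the flight is strictly inside the half-plane.\<close>
    have "(1 - s) * para (side_dir m) (p k) < (1 - s) * ?A \<or> s * para (side_dir m) (q (k + 1)) < s * ?A"
      using s pb(2) qb(2) ne[of "k + 1" k] by (metis diff_gt_0_iff_gt mult_strict_left_mono)
    then have "para (side_dir m) (\<gamma> t) < (1 - s) * ?A + s * ?A" unfolding e using l by linarith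
    then show "para (side_dir m) (\<gamma> t) < ?A" by (simp add: algebra_simps)
  qed
  have "linear_trajectory n r (cis \<theta>) \<gamma> T \<sigma>"
    unfolding linear_trajectory_def Let_def q
  proof (intro conjI allI ballI)
    show "cis \<theta> \<noteq> 0" by simp
    show "strict_mono T" by (rule sm)
    show "\<exists>k. T k \<le> t \<and> t < T (k + 1)" for t by (rule block)
    show "\<sigma> k < 2 * n" for k by (rule \<sigma>)
    show "\<gamma> t = \<gamma> (T k) + (t - T k) *\<^sub>R cis \<theta>" if "t \<in> {T k..<T (k + 1)}" for t k
      using \<gamma>[of k t] that by (simp add: \<gamma>T)
    show "\<gamma> t \<in> interior (regular_polygon n r)" if "t \<in> {T k<..<T (k + 1)}" for t k
      using inside[of k t] that by simp
    show "q (k + 1) \<in> open_side n r (\<sigma> (k + 1))" for k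
      unfolding open_side_iff[OF r] q_def using y by blast
    show "\<gamma> (T (k + 1)) = glue n r (\<sigma> (k + 1)) (q (k + 1))" for k by (simp add: \<gamma>T pq)
  qed
  then show ?thesis using wk unfolding cutting_sequences_def by blast
qed

lemma cutting_sequences_eq:
  assumes "0 < r"
  shows "cutting_sequences n r = (\<Union>\<theta>. codings \<theta>)"
proof (intro equalityI subsetI)
  fix w assume "w \<in> cutting_sequences n r"
  then obtain \<theta> where "w \<in> codings \<theta>" by (rule cutting_sequence_is_coding[OF assms])
  then show "w \<in> (\<Union>\<theta>. codings \<theta>)" by blast
qed (use coding_is_cutting_sequence[OF assms] in auto)

end

section \<open>Closure and coherence\<close>

lemma sandwiched_comp: "inj p \<Longrightarrow> sandwiched (p \<circ> w) m \<longleftrightarrow> sandwiched w m"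
  by (simp add: sandwiched_def inj_eq)

lemma derived_comp: "inj p \<Longrightarrow> derived (p \<circ> w) = p \<circ> derived w"
  by (simp add: derived_def sandwiched_comp comp_assoc)

text \<open>Starting from the index at which \<open>g\<close> meets \<open>f A\<close>, neither
  enumeration can skip an element of the window that the other one hits; outside the window they may
  differ.\<close>

lemma enumeration_agree:
  fixes f g :: "int \<Rightarrow> int"
  assumes f: "strict_mono f" and g: "strict_mono g"
    and R: "\<And>i. f A \<le> i \<Longrightarrow> i \<le> f B \<Longrightarrow> i \<in> range f \<longleftrightarrow> i \<in> range g"
  obtains a where "\<And>m. A \<le> m \<Longrightarrow> m \<le> B \<Longrightarrow> g (m + a) = f m"
proof (cases "A \<le> B")
  case True
  then have "f A \<in> range g" using R[of "f A"] f by (simp add: strict_mono_less_eq)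
  then obtain c where c: "f A = g c" by blast
  have "m \<le> B \<longrightarrow> g (m + (c - A)) = f m" if "A \<le> m" for m
    using that
  proof (induction m rule: int_ge_induct)
    case base
    then show ?case using c by simp
  next
    case (step m)
    show ?case
    proof
      assume mB: "m + 1 \<le> B"
      then have IH: "g (m + (c - A)) = f m" using step by simp
      have "f A \<le> f (m + 1)" "f (m + 1) \<le> f B" using f step(1) mB by (simp_all add: strict_mono_less_eq)
      then have "f (m + 1) \<in> range g" using R by blast
      then obtain d where d: "f (m + 1) = g d" by blast
      have "g (m + (c - A)) < g d" using IH d f by (metis less_add_one strict_mono_less)
      then have "m + (c - A) < d" using g by (simp add: strict_mono_less)
      moreover have "\<not> m + (c - A) + 1 < d"
      proof
        assume l: "m + (c - A) + 1 < d"
        let ?i = "g (m + (c - A) + 1)"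
        have i: "f m < ?i" "?i < f (m + 1)" using IH d g l by (simp_all add: strict_mono_less flip: IH)
        then have "f A \<le> ?i" "?i \<le> f B" using f step(1) mB \<open>f (m + 1) \<le> f B\<close>
          by (metis less_imp_le order_trans strict_mono_less_eq, linarith)
        then have "?i \<in> range f" using R by blast
        then show False using strict_mono_gap[OF f i] by blast
      qed
      ultimately have "d = m + 1 + (c - A)" by simp
      then show "g (m + 1 + (c - A)) = f (m + 1)" using d by simp
    qed
  qed
  then show ?thesis using that by blast
qed (use that in force)

text \<open>The topological closure in combinatorial form: a basic neighbourhood fixes finitely many
  positions, and these lie in one interval.\<close>

definition window_closure :: "biword set \<Rightarrow> biword set" where
  "window_closure S = {w. \<forall>a b. \<exists>v\<in>S. \<forall>i\<in>{a..b}. v i = w i}"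

lemma window_closureD:
  assumes "w \<in> window_closure S"
  shows "\<exists>v. v \<in> S \<and> (\<forall>i. a \<le> i \<longrightarrow> i \<le> b \<longrightarrow> v i = w i)"
proof -
  have "\<exists>v\<in>S. \<forall>i\<in>{a..b}. v i = w i" using assms unfolding window_closure_def by blast
  then show ?thesis by auto
qed

lemma window_closure_mono: "S \<subseteq> T \<Longrightarrow> window_closure S \<subseteq> window_closure T"
  unfolding window_closure_def by blast

lemma window_closure_comp: "w \<in> window_closure S \<Longrightarrow> p \<circ> w \<in> window_closure ((\<lambda>v. p \<circ> v) ` S)"
proof -
  assume w: "w \<in> window_closure S"
  have "\<exists>v\<in>(\<lambda>v. p \<circ> v) ` S. \<forall>i\<in>{a..b}. v i = (p \<circ> w) i" for a b
  proof -
    obtain v where "v \<in> S" "\<And>i. a \<le> i \<Longrightarrow> i \<le> b \<Longrightarrow> v i = w i" using window_closureD[OF w, of "a" "b"] by blast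
    then show ?thesis by (intro bexI[of _ "p \<circ> v"]) auto
  qed
  then show ?thesis unfolding window_closure_def by blast
qed

text \<open>If each set failed on some window, a window containing all of these finitely many
  windows would be matched by no word of the union.\<close>

lemma window_closure_finite_Union:
  assumes "finite I" "w \<in> window_closure (\<Union>i\<in>I. S i)"
  obtains i where "i \<in> I" "w \<in> window_closure (S i)"
proof (rule ccontr)
  assume "\<not> thesis"
  then have "\<forall>i\<in>I. \<exists>a b. \<forall>v\<in>S i. \<exists>k\<in>{a..b}. v k \<noteq> w k" using that unfolding window_closure_def by blast
  then obtain a b where ab: "\<And>i v. i \<in> I \<Longrightarrow> v \<in> S i \<Longrightarrow> \<exists>k\<in>{a i..b i}. v k \<noteq> w k" by metis
  \<comment> \<open>The element \<open>0\<close> is inserted so that \<open>Min\<close> and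
    \<open>Max\<close> are taken of nonempty sets.\<close>
  obtain v where v: "v \<in> (\<Union>i\<in>I. S i)" "\<And>k. Min (insert 0 (a ` I)) \<le> k \<Longrightarrow> k \<le> Max (insert 0 (b ` I)) \<Longrightarrow> v k = w k"
    using window_closureD[OF assms(2), of "Min (insert 0 (a ` I))" "Max (insert 0 (b ` I))"] by blast
  then obtain i where i: "i \<in> I" "v \<in> S i" by blast
  obtain k where k: "a i \<le> k" "k \<le> b i" "v k \<noteq> w k" using ab[OF i] by auto
  have "Min (insert 0 (a ` I)) \<le> a i" "b i \<le> Max (insert 0 (b ` I))" using assms(1) i(1) by auto
  then show False using v(2)[of k] k by linarith
qed

lemma closure_of_words:
  assumes S: "S \<subseteq> words n"
  shows "product_topology (\<lambda>_ :: int. discrete_topology {1..n}) UNIV closure_of S = window_closure S"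
    (is "?T closure_of S = _")
proof (intro equalityI subsetI)
  fix w assume w: "w \<in> ?T closure_of S"
  then have wt: "w \<in> topspace ?T" unfolding in_closure_of by blast
  then have wr: "w i \<in> {1..n}" for i by (simp add: PiE_def Pi_def)
  have "\<exists>v\<in>S. \<forall>i\<in>{a..b}. v i = w i" for a b :: int
  proof -
    let ?U = "PiE UNIV (\<lambda>i. if i \<in> {a..b} then {w i} else {1..n})"
    have "finite {i. (if i \<in> {a..b} then {w i} else {1..n}) \<noteq> {1..n}}"
      by (rule finite_subset[of _ "{a..b}"]) auto
    then have "openin ?T ?U" using wr by (auto simp: openin_PiE_gen)
    moreover have "w \<in> ?U" using wr by auto
    ultimately obtain v where "v \<in> S" "v \<in> ?U" using w unfolding in_closure_of by blast
    then show ?thesis by (intro bexI[of _ v]) (auto simp: PiE_def Pi_def split: if_splits)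
  qed
  then show "w \<in> window_closure S" by (simp add: window_closure_def)
next
  fix w assume w: "w \<in> window_closure S"
  have wr: "w i \<in> {1..n}" for i
  proof -
    obtain v where "v \<in> S" "v i = w i" using window_closureD[OF w, of i i] by blast
    then show ?thesis using S unfolding words_def by (metis (mono_tags, lifting) mem_Collect_eq range_subsetD subsetD)
  qed
  show "w \<in> ?T closure_of S"
    unfolding in_closure_of
  proof (intro conjI allI impI)
    show "w \<in> topspace ?T" using wr by (simp add: PiE_def Pi_def)
    fix U assume U: "w \<in> U \<and> openin ?T U"
    then obtain X where X: "w \<in> PiE UNIV X" "finite {i. X i \<noteq> {1..n}}" "PiE UNIV X \<subseteq> U"
      using product_topology_open_contains_basis[of "\<lambda>_. discrete_topology {1..n}" UNIV U w] by auto
    let ?F = "insert 0 {i. X i \<noteq> {1..n}}"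
    obtain v where v: "v \<in> S" "\<And>i. Min ?F \<le> i \<Longrightarrow> i \<le> Max ?F \<Longrightarrow> v i = w i"
      using window_closureD[OF w, of "Min ?F" "Max ?F"] by blast
    have "v i \<in> X i" for i
    proof (cases "X i = {1..n}")
      case True
      then show ?thesis using v(1) S unfolding words_def by (metis (mono_tags, lifting) mem_Collect_eq range_subsetD subsetD)
    next
      case False
      then have "Min ?F \<le> i" "i \<le> Max ?F" using X(2) by auto
      then show ?thesis using v(2) X(1) by auto
    qed
    then have "v \<in> U" using X(3) by auto
    then show "\<exists>y. y \<in> S \<and> y \<in> U" using v(1) by blast
  qed
qed

context even_gon
begin

section \<open>The symmetry group of the labels and its action on words, directions and
  codings\<close>

text \<open>For \<open>e = 1\<close> and \<open>e = - 1\<close> these are the permutations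
  \<open>dperm n i\<close> over again, in a parametrisation with a simple rule for
  composition.\<close>

definition dihedral :: "int \<Rightarrow> int \<Rightarrow> nat \<Rightarrow> nat" where
  "dihedral e c j = (if j \<in> {1..n} then letter n (e * int j + c) else j)"

lemma letter_mod: "z mod int n = z' mod int n \<Longrightarrow> letter n z = letter n z'"
  unfolding letter_def by (metis mod_diff_left_eq)

lemma letter_range: "letter n z \<in> {1..n}"
proof -
  have "0 \<le> (z - 1) mod int n" "(z - 1) mod int n < int n" using two_le by simp_all
  then show ?thesis by (auto simp: letter_def nat_less_iff)
qed

lemma letter_mod_eq: "int (letter n z) mod int n = z mod int n"
proof -
  have "int (letter n z) = (z - 1) mod int n + 1" using two_le by (simp add: letter_def)
  then show ?thesis by (simp add: mod_add_left_eq)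
qed

lemma dihedral_comp: "dihedral e c (dihedral e' c' j) = dihedral (e * e') (e * c' + c) j"
proof (cases "j \<in> {1..n}")
  case True
  have "(e * int (letter n (e' * int j + c')) + c) mod int n = (e * (e' * int j + c') + c) mod int n"
    using letter_mod_eq[of "e' * int j + c'"] by (metis mod_add_left_eq mod_mult_right_eq)
  then have "letter n (e * int (letter n (e' * int j + c')) + c) = letter n (e * (e' * int j + c') + c)"
    by (rule letter_mod)
  then show ?thesis using True letter_range by (simp add: dihedral_def algebra_simps)
qed (auto simp: dihedral_def)

lemma dihedral_id: "dihedral 1 0 = id"
proof
  fix j
  show "dihedral 1 0 j = id j"
  proof (cases "j \<in> {1..n}")
    case True
    then show ?thesis using letter_eq[of "int j" "int j" 0] by (simp add: dihedral_def)
  qed (auto simp: dihedral_def)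
qed

lemma dperm_dihedral:
  obtains e c where "e = 1 \<or> e = - 1" "dperm n i = dihedral e c"
proof (cases "even i")
  case True
  then have "dperm n i = dihedral 1 (int (i div 2))" by (auto simp: dperm_def dihedral_def)
  then show ?thesis using that[of 1] by blast
next
  case False
  then have "dperm n i = dihedral (- 1) (2 - int ((i + 1) div 2))"
    by (intro ext) (auto simp: dperm_def dihedral_def algebra_simps)
  then show ?thesis using that[of "- 1"] by blast
qed

lemma dihedral_dperm:
  assumes "e = 1 \<or> e = - 1"
  obtains i where "i \<in> {0..2 * n - 1}" "dihedral e c = dperm n i"
  using assms
proof
  assume e: "e = 1"
  define m where "m = nat (c mod int n)"
  have "0 \<le> c mod int n" "c mod int n < int n" using two_le by simp_all
  then have m: "m < n" "int m = c mod int n" by (auto simp: m_def nat_less_iff)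
  have "letter n (int j + int m) = letter n (int j + c)" for j
    by (rule letter_mod) (simp add: m(2) mod_add_right_eq)
  then have "dihedral e c = dperm n (2 * m)" by (auto simp: e dperm_def dihedral_def)
  then show ?thesis using that[of "2 * m"] m by simp
next
  assume e: "e = - 1"
  define m where "m = nat ((1 - c) mod int n)"
  have "0 \<le> (1 - c) mod int n" "(1 - c) mod int n < int n" using two_le by simp_all
  then have m: "m < n" "int m = (1 - c) mod int n" by (auto simp: m_def nat_less_iff)
  have "letter n (2 - int (m + 1) - int j) = letter n (- int j + c)" for j
  proof (rule letter_mod)
    have "2 - int (m + 1) - int j = 1 - int j - int m" by simp
    then have "(2 - int (m + 1) - int j) mod int n = (1 - int j - int m) mod int n" by (rule arg_cong)
    also have "\<dots> = (1 - int j - (1 - c)) mod int n" unfolding m(2) by (rule mod_diff_right_eq)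
    finally show "(2 - int (m + 1) - int j) mod int n = (- int j + c) mod int n" by simp
  qed
  then have "dihedral e c = dperm n (2 * m + 1)" by (intro ext) (auto simp: e dperm_def dihedral_def)
  then show ?thesis using that[of "2 * m + 1"] m by simp
qed

lemma dihedral_inverse:
  assumes "e = 1 \<or> e = - 1"
  shows "dihedral e (- e * c) \<circ> dihedral e c = id" "dihedral e c \<circ> dihedral e (- e * c) = id"
  using assms by (auto simp: fun_eq_iff dihedral_comp dihedral_id)

lemma inj_dihedral: "e = 1 \<or> e = - 1 \<Longrightarrow> inj (dihedral e c)"
  using dihedral_inverse(1) by (metis inj_on_id inj_on_imageI2)

lemma bij_dperm: "bij (dperm n i)"
proof -
  obtain e c where ec: "e = 1 \<or> e = - 1" "dperm n i = dihedral e c" by (rule dperm_dihedral)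
  show ?thesis unfolding ec(2) by (rule o_bij[OF dihedral_inverse[OF ec(1)]])
qed

lemma inv_dperm_comp: "inv (dperm n i) \<circ> (dperm n i \<circ> w) = w" "dperm n i \<circ> (inv (dperm n i) \<circ> w) = w"
  using bij_dperm[of i] by (auto simp: fun_eq_iff bij_is_inj bij_is_surj surj_f_inv_f)

lemma dihedral_words: "dihedral e c \<circ> w \<in> words n \<longleftrightarrow> w \<in> words n"
proof -
  have "1 \<le> dihedral e c j \<and> dihedral e c j \<le> n \<longleftrightarrow> 1 \<le> j \<and> j \<le> n" for j
    using letter_range by (auto simp: dihedral_def)
  then show ?thesis unfolding words_def by (auto simp: image_subset_iff)
qed

lemma dperm_words: "dperm n i \<circ> w \<in> words n \<longleftrightarrow> w \<in> words n"
  using dperm_dihedral[of i] dihedral_words by metis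

lemma admissible_in_iff: "admissible_in n i w \<longleftrightarrow> admissible0 n (dperm n i \<circ> w)"
  using dperm_words[of i w] by (auto simp: admissible_in_def admissible0_def)

lemma admissible_dihedral:
  assumes e: "e = 1 \<or> e = - 1" and a: "admissible n (dihedral e c \<circ> w)"
  shows "admissible n w"
proof -
  obtain i where i: "admissible0 n (dperm n i \<circ> (dihedral e c \<circ> w))"
    using a unfolding admissible_def admissible_in_iff by blast
  obtain e' c' where ec: "e' = 1 \<or> e' = - 1" "dperm n i = dihedral e' c'" by (rule dperm_dihedral)
  have "e' * e = 1 \<or> e' * e = - 1" using e ec(1) by auto
  then obtain t where t: "t \<in> {0..2 * n - 1}" "dihedral (e' * e) (e' * c + c') = dperm n t"
    by (rule dihedral_dperm)
  have "dperm n i \<circ> (dihedral e c \<circ> w) = dperm n t \<circ> w"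
    unfolding ec(2) t(2)[symmetric] by (auto simp: dihedral_comp)
  then show ?thesis using i t(1) unfolding admissible_def admissible_in_iff by auto
qed

lemma derivable_dihedral:
  assumes e: "e = 1 \<or> e = - 1" and a: "derivable n (dihedral e c \<circ> w)"
  shows "derivable n w"
  using a admissible_dihedral[OF e] unfolding derivable_def derived_comp[OF inj_dihedral[OF e]] by blast

text \<open>Derivation commutes with injective relabelling, so normalising merely accumulates a
  relabelling. Derivability of the normalised words therefore gives derivability of the iterated
  derived words.\<close>

lemma normalized_derived_dihedral:
  "\<exists>e c. (e = 1 \<or> e = - 1) \<and> normalized_derived n s w k = dihedral e c \<circ> (derived ^^ k) w"
proof (induction k)
  case 0
  then show ?case by (intro exI[of _ 1] exI[of _ 0]) (simp add: dihedral_id)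
next
  case (Suc k)
  then obtain e c where ec: "e = 1 \<or> e = - 1" "normalized_derived n s w k = dihedral e c \<circ> (derived ^^ k) w" by blast
  obtain e' c' where ec': "e' = 1 \<or> e' = - 1" "dperm n (s k) = dihedral e' c'" by (rule dperm_dihedral)
  have e: "e' * e = 1 \<or> e' * e = - 1" using ec ec' by auto
  have "dperm n (s k) \<circ> normalized_derived n s w k = dihedral (e' * e) (e' * c + c') \<circ> (derived ^^ k) w"
    unfolding ec ec' by (auto simp: dihedral_comp)
  then have "normalized_derived n s w (Suc k) = dihedral (e' * e) (e' * c + c') \<circ> (derived ^^ Suc k) w"
    using derived_comp[OF inj_dihedral[OF e]] by simp
  then show ?case using e by blast
qed

text \<open>The action of the isometry \<open>\<nu>\<^sub>i\<close> on directions.\<close>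

definition reduced_direction :: "nat \<Rightarrow> real \<Rightarrow> real" where
  "reduced_direction i \<theta> = (if even i then \<theta> - real i * h else (real i + 1) * h - \<theta>)"

lemma exit_cos_reflect: "exit_cos (pi - t) = - exit_cos t" "exit_cos (2 * pi - t) = - exit_cos t"
  by (simp_all add: exit_cos_def sgn_minus)

text \<open>A rotation preserves \<open>phi\<close> up to a multiple of \<open>pi\<close>, a
  reflection also negates it; reflections therefore reverse heights, whence the factor
  \<open>run_sign i\<close>.\<close>

lemma phi_dperm:
  assumes "i < 2 * n" "1 \<le> j" "j \<le> n"
  shows "\<bar>sin (phi (reduced_direction i \<theta>) (dperm n i j))\<bar> = \<bar>sin (phi \<theta> j)\<bar>"
    "exit_cos (phi (reduced_direction i \<theta>) (dperm n i j)) = run_sign i * exit_cos (phi \<theta> j)"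
proof -
  let ?p = "phi (reduced_direction i \<theta>) (dperm n i j)"
  define l where "l = i div 2"
  have l: "l < n" using assms(1) by (simp add: l_def)
  have "\<bar>sin ?p\<bar> = \<bar>sin (phi \<theta> j)\<bar> \<and> exit_cos ?p = run_sign i * exit_cos (phi \<theta> j)"
  proof (cases "even i")
    case True
    then have i: "i = 2 * l" by (simp add: l_def)
    have "?p = phi \<theta> j \<or> ?p = phi \<theta> j - pi"
    proof (cases "j \<le> n - l")
      case c: True
      then have d: "dperm n i j = j + l" unfolding i dperm_even[OF assms(2,3) l] by simp
      show ?thesis unfolding d reduced_direction_def using True i by (simp add: phi_def algebra_simps)
    next
      case c: False
      then have "dperm n i j = j + l - n" unfolding i dperm_even[OF assms(2,3) l] by simp
      then have d: "real (dperm n i j) = real j + real l - real n" using c by simp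
      have "?p = phi \<theta> j - 2 * (real n * h)"
        unfolding phi_def d reduced_direction_def using True i by (simp add: algebra_simps)
      then show ?thesis using n_h by simp
    qed
    then show ?thesis using True by (auto simp: exit_cos_pi run_sign_def)
  next
    case False
    then have i: "i = 2 * l + 1" by (simp add: l_def)
    have "?p = pi - phi \<theta> j \<or> ?p = 2 * pi - phi \<theta> j"
    proof (cases "j \<le> n - l")
      case c: True
      then have "dperm n i j = n + 1 - l - j" unfolding i dperm_odd[OF assms(2,3) l] by simp
      then have d: "real (dperm n i j) = real n + 1 - real l - real j" using c l by simp
      have "?p = 2 * (real n * h) - phi \<theta> j"
        unfolding phi_def d reduced_direction_def using False i by (simp add: algebra_simps)
      then show ?thesis using n_h by simp
    next
      case c: False
      then have "dperm n i j = 2 * n + 1 - l - j" unfolding i dperm_odd[OF assms(2,3) l] by simp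
      then have d: "real (dperm n i j) = 2 * real n + 1 - real l - real j" using assms(3) l by simp
      have "?p = 2 * (2 * (real n * h)) - phi \<theta> j"
        unfolding phi_def d reduced_direction_def using False i by (simp add: algebra_simps)
      then show ?thesis using n_h by simp
    qed
    then show ?thesis using False by (auto simp: exit_cos_pi exit_cos_reflect run_sign_def)
  qed
  then show "\<bar>sin ?p\<bar> = \<bar>sin (phi \<theta> j)\<bar>" "exit_cos ?p = run_sign i * exit_cos (phi \<theta> j)" by auto
qed

lemma codings_words: "codings \<theta> \<subseteq> words n"
  using is_codingD(1) unfolding codings_def by blast

lemma sector_codings_words: "sector_codings i \<subseteq> words n"
  using codings_words unfolding sector_codings_def by blast

lemma dperm_codings:
  assumes i: "i < 2 * n" and w: "w \<in> words n"
  shows "dperm n i \<circ> w \<in> codings (reduced_direction i \<theta>) \<longleftrightarrow> w \<in> codings \<theta>"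
proof -
  have ss: "run_sign i * (run_sign i * a) = a" "\<bar>run_sign i * a\<bar> = \<bar>a\<bar>" for a
    by (simp_all add: run_sign_def abs_mult)
  have dw: "dperm n i \<circ> w \<in> words n" using dperm_words w by simp
  note p = phi_dperm[OF i]
  have wr: "1 \<le> w k" "w k \<le> n" for k using wordsD[OF w] by auto
  have 1: "is_coding (reduced_direction i \<theta>) (dperm n i \<circ> w) (\<lambda>k. run_sign i * x k)" if "is_coding \<theta> w x" for x
    unfolding is_coding_def o_apply p[OF wr] ss
    using is_codingD(2,4)[OF that] dw by (simp flip: distrib_left right_diff_distrib add: comp_def)
  have 2: "is_coding \<theta> w (\<lambda>k. run_sign i * x k)" if "is_coding (reduced_direction i \<theta>) (dperm n i \<circ> w) x" for x
  proof -
    have a: "\<bar>x k\<bar> < tan h * \<bar>sin (phi \<theta> (w k))\<bar>" for k using is_codingD(2)[OF that, of k] unfolding o_apply p[OF wr] .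
    have b: "x (k + 1) - x k = run_sign i * exit_cos (phi \<theta> (w k)) + run_sign i * exit_cos (phi \<theta> (w (k + 1)))" for k
      using is_codingD(4)[OF that, of k] unfolding o_apply p[OF wr] .
    have "run_sign i * x (k + 1) - run_sign i * x k = exit_cos (phi \<theta> (w k)) + exit_cos (phi \<theta> (w (k + 1)))" for k
      unfolding right_diff_distrib[symmetric] b distrib_left ss ..
    then show ?thesis unfolding is_coding_def ss using a w by simp
  qed
  show ?thesis unfolding codings_def using 1 2 by blast
qed

lemma dperm_sector_codings:
  assumes i: "i < 2 * n"
  shows "dperm n i \<circ> w \<in> sector_codings 0 \<longleftrightarrow> w \<in> sector_codings i"
proof
  assume a: "dperm n i \<circ> w \<in> sector_codings 0"
  then have w: "w \<in> words n" using dperm_words sector_codings_words by blast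
  obtain t where t: "t \<in> sector 0" "dperm n i \<circ> w \<in> codings t" using a unfolding sector_codings_def by blast
  define \<theta> where "\<theta> = (if even i then t + real i * h else (real i + 1) * h - t)"
  have "reduced_direction i \<theta> = t" by (simp add: reduced_direction_def \<theta>_def)
  then have "w \<in> codings \<theta>" using dperm_codings[OF i w, of \<theta>] t(2) by simp
  moreover have "\<theta> \<in> sector i" using t(1) by (auto simp: sector_def \<theta>_def algebra_simps)
  ultimately show "w \<in> sector_codings i" unfolding sector_codings_def by blast
next
  assume a: "w \<in> sector_codings i"
  then have w: "w \<in> words n" using sector_codings_words by blast
  obtain t where t: "t \<in> sector i" "w \<in> codings t" using a unfolding sector_codings_def by blast
  then have "dperm n i \<circ> w \<in> codings (reduced_direction i t)" using dperm_codings[OF i w] by simp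
  moreover have "reduced_direction i t \<in> sector 0" using t(1) by (auto simp: sector_def reduced_direction_def algebra_simps)
  ultimately show "dperm n i \<circ> w \<in> sector_codings 0" unfolding sector_codings_def by blast
qed

text \<open>Rotation by \<open>pi\<close> is a symmetry of the polygon that preserves
  labels.\<close>

lemma codings_pi: "codings (\<theta> + pi) = codings \<theta>"
proof -
  have "phi (\<theta> + pi) j = phi \<theta> j + pi" for j by (simp add: phi_def)
  then have "is_coding (\<theta> + pi) w x \<longleftrightarrow> is_coding \<theta> w x" for w x
    by (simp add: is_coding_def exit_cos_pi)
  then show ?thesis by (simp add: codings_def)
qed

lemma codings_multiple_pi: "codings (\<theta> + real k * pi) = codings \<theta>"
proof (induction k)
  case (Suc k)
  have "\<theta> + real (Suc k) * pi = (\<theta> + real k * pi) + pi" by (simp add: algebra_simps)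
  then show ?case using Suc codings_pi by metis
qed simp

lemma Union_codings: "(\<Union>\<theta>. codings \<theta>) = (\<Union>i<2 * n. sector_codings i)"
proof -
  have "w \<in> (\<Union>i<2 * n. sector_codings i)" if w: "w \<in> codings \<theta>" for w \<theta>
  proof -
    define q where "q = \<lfloor>\<theta> / pi\<rfloor>"
    define t where "t = \<theta> - of_int q * pi"
    have "of_int q \<le> \<theta> / pi" "\<theta> / pi < of_int q + 1" unfolding q_def by linarith+
    then have t: "0 \<le> t" "t < pi" by (simp_all add: t_def field_simps)
    have "codings t = codings \<theta>"
    proof (cases "0 \<le> q")
      case True
      then have "\<theta> = t + real (nat q) * pi" by (simp add: t_def)
      then show ?thesis using codings_multiple_pi by metis
    next
      case False
      then have "t = \<theta> + real (nat (- q)) * pi" by (simp add: t_def)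
      then show ?thesis using codings_multiple_pi by metis
    qed
    moreover obtain i where "i < 2 * n" "t \<in> sector i" using sector_cover[OF t] .
    ultimately show ?thesis using w unfolding sector_codings_def by blast
  qed
  then show ?thesis unfolding sector_codings_def by blast
qed

lemma codings_shift:
  assumes "w \<in> codings \<theta>"
  shows "(\<lambda>k. w (k + a)) \<in> codings \<theta>"
proof -
  obtain x where c: "is_coding \<theta> w x" using assms unfolding codings_def by blast
  have "is_coding \<theta> (\<lambda>k. w (k + a)) (\<lambda>k. x (k + a))"
    unfolding is_coding_def
  proof (intro conjI allI)
    show "(\<lambda>k. w (k + a)) \<in> words n" using wordsD[OF is_codingD(1)[OF c]] by (intro wordsI)
    show "\<bar>x (k + a)\<bar> < tan h * \<bar>sin (phi \<theta> (w (k + a)))\<bar>" for k by (rule is_codingD(2)[OF c])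
    show "x (k + 1 + a) - x (k + a) = exit_cos (phi \<theta> (w (k + a))) + exit_cos (phi \<theta> (w (k + 1 + a)))" for k
      using is_codingD(4)[OF c, of "k + a"] by (simp add: add.commute add.left_commute)
  qed
  then show ?thesis unfolding codings_def by blast
qed

section \<open>Words in the closure are infinitely coherent\<close>

text \<open>A sector containing the image direction supplies \<open>j\<close>. The sign of the sine
  at a sandwiched letter determines both the kind of sandwich and the side of
  \<open>n - j div 2\<close> on which the letter lies, so this \<open>j\<close> also gives the
  group.\<close>

lemma sector_codings0_cover:
  assumes u: "u \<in> sector_codings 0"
  obtains j where "j \<in> {1..2 * n - 1}" "\<And>m. sandwiched u m \<Longrightarrow> (u (m - 1), u m) \<in> sandwich_group n (j div 2)"
    "derived u \<in> sector_codings j"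
proof -
  obtain \<theta> x where "\<theta> \<in> sector 0" and c: "is_coding \<theta> u x"
    using u unfolding sector_codings_def codings_def by blast
  then have \<theta>: "0 \<le> \<theta>" "\<theta> \<le> h" by (simp_all add: sector_def)
  obtain \<rho> \<theta>' where \<rho>: "0 < \<rho>" and \<theta>': "h \<le> \<theta>'" "\<theta>' \<le> pi" and d: "dx \<theta> = \<rho> * cos \<theta>'" "sin \<theta> = \<rho> * sin \<theta>'"
    using derive_direction[OF \<theta>] by blast
  obtain j where j: "1 \<le> j" "j \<le> 2 * n - 1" "\<theta>' \<in> sector j" using sector_cover_derived[OF \<theta>'] .
  note adm = coding0_admissible0[OF c \<theta>]
  obtain f where f: "strict_mono f" "range f = {m. sandwiched u m}" and du: "derived u = u \<circ> f"
    using admissible0_derived[OF adm] .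
  note D = derived_is_coding[OF c \<theta> d \<rho> f]
  have "derived u \<in> sector_codings j" using D(1) j(3) unfolding du sector_codings_def codings_def by blast
  moreover have "(u (m - 1), u m) \<in> sandwich_group n (j div 2)" if s: "sandwiched u m" for m
  proof -
    note r = admissible0_range[OF adm, of m] admissible0_range[OF adm, of "m - 1"]
    note S = sin_phi_sector[OF j(3,2), of "u m"]
    from D(2)[OF s] show ?thesis
    proof (elim disjE conjE)
      assume a: "u (m - 1) + u m = n + 1" "0 < sin (phi \<theta>' (u m))"
      then have "u m \<le> n - j div 2" using S(2) r by force
      moreover have "u (m - 1) = n + 1 - u m" using a(1) by simp
      ultimately show ?thesis using r by (simp add: sandwich_group_def perm_up_def)
    next
      assume a: "u (m - 1) + u m = n + 2" "sin (phi \<theta>' (u m)) < 0"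
      then have "n - j div 2 < u m" using S(1) r by force
      moreover have "u (m - 1) = n + 2 - u m" "u m \<noteq> 1" using a(1) r by auto
      ultimately show ?thesis using r by (simp add: sandwich_group_def perm_right_def)
    qed
  qed
  ultimately show ?thesis using that[of j] j by simp
qed

lemma window_closure_admissible0:
  assumes u: "u \<in> window_closure (sector_codings 0)"
  shows "admissible0 n u"
proof -
  have tr: "transition0 n (u m) (u (m + 1))" for m
  proof -
    obtain v where v: "v \<in> sector_codings 0" "\<And>i. m \<le> i \<Longrightarrow> i \<le> m + 1 \<Longrightarrow> v i = u i"
      using window_closureD[OF u, of "m" "m + 1"] by blast
    obtain \<theta> x where "\<theta> \<in> sector 0" "is_coding \<theta> v x" using v(1) unfolding sector_codings_def codings_def by blast
    then have "transition0 n (v m) (v (m + 1))" using coding0_transition by (simp add: sector_def)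
    then show ?thesis using v(2)[of m] v(2)[of "m + 1"] by simp
  qed
  then have "u \<in> words n" by (intro wordsI) (auto simp: transition0_def)
  then show ?thesis using tr by (simp add: admissible0_def)
qed

lemma dperm_window_closure:
  assumes "i < 2 * n" "w \<in> window_closure (sector_codings i)"
  shows "dperm n i \<circ> w \<in> window_closure (sector_codings 0)"
proof -
  have "(\<lambda>v. dperm n i \<circ> v) ` sector_codings i \<subseteq> sector_codings 0"
    using dperm_sector_codings[OF assms(1)] by blast
  then show ?thesis using window_closure_comp[OF assms(2)] window_closure_mono by blast
qed

lemma window_closure_derived:
  assumes u: "u \<in> window_closure (sector_codings 0)"
  obtains j where "j \<in> {1..2 * n - 1}" "\<And>m. sandwiched u m \<Longrightarrow> (u (m - 1), u m) \<in> sandwich_group n (j div 2)"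
    "derived u \<in> window_closure (sector_codings j)"
proof -
  \<comment> \<open>The group condition and the sector of the derived word are bundled, so that the
    passage to a finite union yields one \<open>j\<close> for both.\<close>
  define T where "T j = {u \<in> sector_codings 0. (\<forall>m. sandwiched u m \<longrightarrow> (u (m - 1), u m) \<in> sandwich_group n (j div 2)) \<and>
    derived u \<in> sector_codings j}" for j
  have "sector_codings 0 \<subseteq> (\<Union>j\<in>{1..2 * n - 1}. T j)"
  proof
    fix v assume v: "v \<in> sector_codings 0"
    then obtain j where "j \<in> {1..2 * n - 1}" "\<And>m. sandwiched v m \<Longrightarrow> (v (m - 1), v m) \<in> sandwich_group n (j div 2)"
      "derived v \<in> sector_codings j" using sector_codings0_cover by blast
    then show "v \<in> (\<Union>j\<in>{1..2 * n - 1}. T j)" using v unfolding T_def by blast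
  qed
  then have "u \<in> window_closure (\<Union>j\<in>{1..2 * n - 1}. T j)" using u window_closure_mono by blast
  then obtain j where j: "j \<in> {1..2 * n - 1}" and uT: "u \<in> window_closure (T j)"
    by (rule window_closure_finite_Union[rotated]) auto
  have "(u (m - 1), u m) \<in> sandwich_group n (j div 2)" if s: "sandwiched u m" for m
  proof -
    obtain v where v: "v \<in> T j" "\<And>i. m - 1 \<le> i \<Longrightarrow> i \<le> m + 1 \<Longrightarrow> v i = u i"
      using window_closureD[OF uT, of "m - 1" "m + 1"] by blast
    have "sandwiched v m" using s v(2)[of "m - 1"] v(2)[of "m + 1"] by (simp add: sandwiched_def)
    then have "(v (m - 1), v m) \<in> sandwich_group n (j div 2)" using v(1) unfolding T_def by blast
    then show ?thesis using v(2)[of "m - 1"] v(2)[of m] by simp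
  qed
  moreover have "derived u \<in> window_closure (sector_codings j)"
    unfolding window_closure_def
  proof (intro CollectI allI)
    fix A B
    obtain f where f: "strict_mono f" "range f = {m. sandwiched u m}" and du: "derived u = u \<circ> f"
      using admissible0_derived[OF window_closure_admissible0[OF u]] .
    \<comment> \<open>One further letter at each end decides whether the outermost positions are
      sandwiched.\<close>
    obtain v where v: "v \<in> T j" "\<And>i. f A - 1 \<le> i \<Longrightarrow> i \<le> f B + 1 \<Longrightarrow> v i = u i"
      using window_closureD[OF uT, of "f A - 1" "f B + 1"] by blast
    have v0: "v \<in> sector_codings 0" and vj: "derived v \<in> sector_codings j" using v(1) unfolding T_def by auto
    have "v \<in> window_closure (sector_codings 0)" using v0 unfolding window_closure_def by blast
    then obtain g where g: "strict_mono g" "range g = {m. sandwiched v m}" and dv: "derived v = v \<circ> g"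
      using admissible0_derived[OF window_closure_admissible0] by blast
    have "i \<in> range f \<longleftrightarrow> i \<in> range g" if "f A \<le> i" "i \<le> f B" for i
      unfolding f(2) g(2) using v(2)[of "i - 1"] v(2)[of "i + 1"] that by (simp add: sandwiched_def)
    from enumeration_agree[OF f(1) g(1) this] obtain a where a: "\<And>m. A \<le> m \<Longrightarrow> m \<le> B \<Longrightarrow> g (m + a) = f m" by blast
    have "(\<lambda>k. derived v (k + a)) \<in> sector_codings j" using vj codings_shift unfolding sector_codings_def by blast
    moreover have "derived v (m + a) = derived u m" if "m \<in> {A..B}" for m
    proof -
      have "f A \<le> f m" "f m \<le> f B" using f(1) that by (simp_all add: strict_mono_less_eq)
      then show ?thesis unfolding du dv o_apply using a[of m] that v(2)[of "f m"] by simp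
    qed
    ultimately show "\<exists>v\<in>sector_codings j. \<forall>i\<in>{A..B}. v i = derived u i"
      by (intro bexI[of _ "\<lambda>k. derived v (k + a)"]) auto
  qed
  ultimately show ?thesis using that j by blast
qed

lemma window_closure_coherent:
  assumes i: "i < 2 * n" and w: "w \<in> window_closure (sector_codings i)"
  obtains j where "j \<in> {1..2 * n - 1}" "coherent n i j w" "derived (dperm n i \<circ> w) \<in> window_closure (sector_codings j)"
proof -
  let ?u = "dperm n i \<circ> w"
  note u = dperm_window_closure[OF i w]
  obtain j where j: "j \<in> {1..2 * n - 1}" and g: "\<And>m. sandwiched ?u m \<Longrightarrow> (?u (m - 1), ?u m) \<in> sandwich_group n (j div 2)"
    and d: "derived ?u \<in> window_closure (sector_codings j)"
    using window_closure_derived[OF u] by blast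
  have adm: "admissible_in n i w" unfolding admissible_in_iff by (rule window_closure_admissible0[OF u])
  have j2: "j < 2 * n" using j two_le by auto
  have admj: "admissible_in n j (derived ?u)"
    unfolding admissible_in_iff by (rule window_closure_admissible0[OF dperm_window_closure[OF j2 d]])
  have "derivable n ?u"
    unfolding derivable_def admissible_def
  proof (intro conjI bexI)
    show "admissible_in n 0 ?u"
    proof -
      have "dperm n 0 = id"
        using dihedral_id letter_eq[where c = 0] by (auto simp: dperm_def fun_eq_iff)
      then show ?thesis unfolding admissible_in_iff using window_closure_admissible0[OF u] by simp
    qed
    show "admissible_in n j (derived ?u)" by (rule admj)
  qed (use j in auto)
  then have "derivable n w" using dperm_dihedral[of i] derivable_dihedral by metis
  then have "coherent n i j w"
    unfolding coherent_def Let_def using i j adm admj g by (auto intro!: bexI[of _ "j div 2"])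
  then show ?thesis using that j d by blast
qed

text \<open>The sector found for the derived word is the starting sector of the next step; dependent
  choice on pairs of sector index and normalised word assembles the sequence
  \<open>s\<close>.\<close>

lemma window_closure_infinitely_coherent:
  assumes i0: "i0 < 2 * n" and w: "w \<in> window_closure (sector_codings i0)"
  shows "infinitely_coherent n w"
proof -
  define P where "P k z \<longleftrightarrow> fst z < 2 * n \<and> (1 \<le> k \<longrightarrow> 1 \<le> fst z) \<and> snd z \<in> window_closure (sector_codings (fst z)) \<and>
    (k = 0 \<longrightarrow> snd z = w)" for k :: nat and z :: "nat \<times> biword"
  define Q where "Q k z z' \<longleftrightarrow> coherent n (fst z) (fst z') (snd z) \<and> snd z' = derived (dperm n (fst z) \<circ> snd z)" for k :: nat and z z' :: "nat \<times> biword"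
  have "\<exists>z. P 0 z" using i0 w by (intro exI[of _ "(i0, w)"]) (simp add: P_def)
  moreover have "\<exists>z'. P (Suc k) z' \<and> Q k z z'" if "P k z" for k z
  proof -
    obtain j where "j \<in> {1..2 * n - 1}" "coherent n (fst z) j (snd z)" "derived (dperm n (fst z) \<circ> snd z) \<in> window_closure (sector_codings j)"
      using window_closure_coherent \<open>P k z\<close> unfolding P_def by blast
    then show ?thesis using two_le
      by (intro exI[of _ "(j, derived (dperm n (fst z) \<circ> snd z))"]) (auto simp: P_def Q_def)
  qed
  ultimately obtain z where z: "\<And>k. P k (z k)" "\<And>k. Q k (z k) (z (Suc k))"
    using dependent_nat_choice[of P Q] by metis
  define s where "s k = fst (z k)" for k
  have nd: "normalized_derived n s w k = snd (z k)" for k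
  proof (induction k)
    case 0
    then show ?case using z(1)[of 0] by (simp add: P_def)
  next
    case (Suc k)
    then show ?case using z(2)[of k] by (simp add: Q_def s_def)
  qed
  have coh: "coherent n (s k) (s (Suc k)) (normalized_derived n s w k)" for k
    unfolding nd s_def using z(2)[of k] by (simp add: Q_def)
  have "infinitely_derivable n w"
    unfolding infinitely_derivable_def
  proof
    fix k
    obtain e c where ec: "e = 1 \<or> e = - 1" "normalized_derived n s w k = dihedral e c \<circ> (derived ^^ k) w"
      using normalized_derived_dihedral by blast
    have "derivable n (normalized_derived n s w k)" using coh[of k] unfolding coherent_def by blast
    then show "derivable n ((derived ^^ k) w)" unfolding ec(2) by (rule derivable_dihedral[OF ec(1)])
  qed
  moreover have "s 0 \<in> {0..2 * n - 1}" using z(1)[of 0] by (auto simp: P_def s_def)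
  moreover have "s k \<in> {1..2 * n - 1}" if "1 \<le> k" for k using z(1)[of k] that by (auto simp: P_def s_def)
  ultimately show ?thesis unfolding infinitely_coherent_def using coh by blast
qed

section \<open>Coherent words are generated, and windows of generated words occur in codings\<close>

lemma coherent_gen:
  assumes c: "coherent n i j w"
  shows "w \<in> gen n i j (derived (dperm n i \<circ> w))"
proof -
  let ?u = "dperm n i \<circ> w"
  have a: "admissible0 n ?u" using c unfolding coherent_def admissible_in_iff by blast
  obtain l where l: "\<forall>m. sandwiched ?u m \<longrightarrow> (?u (m - 1), ?u m) \<in> sandwich_group n l" "l = j div 2"
    and j': "j \<in> {1..2 * n - 1}" and ad: "admissible_in n j (derived ?u)"
    using c unfolding coherent_def Let_def by blast
  then have g: "\<And>m. sandwiched ?u m \<Longrightarrow> (?u (m - 1), ?u m) \<in> sandwich_group n (j div 2)" by blast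
  have j: "1 \<le> j" "j < 2 * n" using j' two_le by auto
  obtain f where f: "strict_mono f" "range f = {m. sandwiched ?u m}" and du: "derived ?u = ?u \<circ> f"
    using admissible0_derived[OF a] .
  have "is_run_sequence j (derived ?u) ?u f" unfolding du by (rule coherent_run_sequence[of ?u f j, OF a f g j(2)])
  then have "?u \<in> gen0 n j (derived ?u)" unfolding gen0_run_sequence[OF ad j] by (rule exI[of _ f])
  then have "inv (dperm n i) \<circ> ?u \<in> gen n i j (derived ?u)" unfolding gen_def by blast
  then show ?thesis unfolding inv_dperm_comp .
qed

lemma coherent_iter_gen:
  assumes "\<And>k. coherent n (s k) (s (Suc k)) (normalized_derived n s w k)"
  shows "normalized_derived n s w k \<in> U \<Longrightarrow> w \<in> iter_gen n s k U"
proof (induction k arbitrary: U)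
  case (Suc k)
  then have "normalized_derived n s w k \<in> (\<Union>u\<in>U. gen n (s k) (s (Suc k)) u)"
    using coherent_gen[OF assms[of k]] by auto
  then show ?case using Suc.IH by simp
qed simp

text \<open>The recursion of \<open>iter_gen\<close> splits off the innermost operator, while the
  induction on windows has to split off the outermost one.\<close>

lemma iter_gen_Suc_front:
  "w \<in> iter_gen n s (Suc k) U \<longleftrightarrow> (\<exists>u\<in>iter_gen n (\<lambda>i. s (Suc i)) k U. w \<in> gen n (s 0) (s (Suc 0)) u)"
proof (induction k arbitrary: U)
  case (Suc k)
  show ?case using Suc[of "\<Union>u\<in>U. gen n (s (Suc k)) (s (Suc (Suc k))) u"] by simp
qed simp

lemma gen_run_sequence:
  assumes "admissible_in n k u" "1 \<le> k" "k < 2 * n" "w \<in> gen n i k u"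
  obtains f where "is_run_sequence k u (dperm n i \<circ> w) f"
proof -
  obtain v where "w = inv (dperm n i) \<circ> v" "v \<in> gen0 n k u" using assms(4) unfolding gen_def by blast
  then have "dperm n i \<circ> w = v" "v \<in> gen0 n k u" using inv_dperm_comp(2) by auto
  then show ?thesis using gen0_run_sequence[OF assms(1-3)] that by blast
qed

lemma iter_gen_admissible:
  assumes "s 0 \<in> {0..2 * n - 1}" "\<forall>j\<in>{1..k}. s j \<in> {1..2 * n - 1}" "w \<in> iter_gen n s k (admissible_words n (s k))"
  shows "admissible_in n (s 0) w"
  using assms
proof (induction k arbitrary: s w)
  case 0
  then show ?case by (simp add: admissible_words_def)
next
  case (Suc k)
  obtain u where u: "u \<in> iter_gen n (\<lambda>i. s (Suc i)) k (admissible_words n (s (Suc k)))" "w \<in> gen n (s 0) (s (Suc 0)) u"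
    using Suc.prems(3) unfolding iter_gen_Suc_front by blast
  have s1: "s (Suc 0) \<in> {1..2 * n - 1}" using Suc.prems(2) by auto
  have adm: "admissible_in n (s (Suc 0)) u"
    by (rule Suc.IH[of "\<lambda>i. s (Suc i)"]) (use Suc.prems(2) u(1) s1 in auto)
  have k: "1 \<le> s (Suc 0)" "s (Suc 0) < 2 * n" using s1 two_le by auto
  obtain f where R: "is_run_sequence (s (Suc 0)) u (dperm n (s 0) \<circ> w) f" using gen_run_sequence[OF adm k u(2)] .
  show ?case unfolding admissible_in_iff
    by (rule run_sequence_admissible0[OF R admissible_inD(1)[OF adm] k(2)])
qed

lemma alternating_window:
  assumes u: "admissible0 n u" and s: "\<And>i. a < i \<Longrightarrow> i < b \<Longrightarrow> sandwiched u i"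
  obtains v where "v \<in> sector_codings 0" "\<And>i. a \<le> i \<Longrightarrow> i \<le> b \<Longrightarrow> v i = u i"
proof -
  obtain \<theta> where \<theta>: "0 \<le> \<theta>" "\<theta> \<le> h" and c: "is_coding \<theta> (\<lambda>k. if even (k - a) then u a else u (a + 1)) (\<lambda>_. 0)"
    using alternating_coding[OF admissible0_transition[OF u, of a]] by blast
  let ?v = "\<lambda>k. if even (k - a) then u a else u (a + 1)"
  have "\<theta> \<in> sector 0" using \<theta> by (simp add: sector_def)
  then have "?v \<in> sector_codings 0" using c unfolding sector_codings_def codings_def by blast
  moreover have "?v i = u i" if "a \<le> i" "i \<le> b" for i
  proof -
    have "(i \<le> b \<longrightarrow> ?v i = u i) \<and> (i + 1 \<le> b \<longrightarrow> ?v (i + 1) = u (i + 1))"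
      using that(1)
    proof (induction i rule: int_ge_induct)
      case (step i)
      have "?v (i + 1 + 1) = u (i + 1 + 1)" if l: "i + 1 + 1 \<le> b"
      proof -
        have "u (i + 1 + 1) = u i" using s[of "i + 1"] step(1) l by (simp add: sandwiched_def)
        then show ?thesis using step(2) l by simp
      qed
      then show ?case using step(2) by simp
    qed simp
    then show ?thesis using that(2) by blast
  qed
  ultimately show ?thesis using that by blast
qed

text \<open>Passing to the derived word shortens a window unless all its interior letters are sandwiched,
  and then the window is part of a periodic cutting sequence.\<close>

lemma iter_gen_window:
  assumes "s 0 \<in> {0..2 * n - 1}" "\<forall>j\<in>{1..k}. s j \<in> {1..2 * n - 1}" "w \<in> iter_gen n s k (admissible_words n (s k))"
    and "a < b" "b \<le> a + int k + 1"
  shows "\<exists>v\<in>sector_codings (s 0). \<forall>i\<in>{a..b}. v i = w i"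
  using assms
proof (induction k arbitrary: s w a b)
  case 0
  have i0: "s 0 < 2 * n" using 0(1) two_le by auto
  have adm: "admissible0 n (dperm n (s 0) \<circ> w)" using iter_gen_admissible[OF 0(1-3)] unfolding admissible_in_iff .
  obtain v where v: "v \<in> sector_codings 0" "\<And>i. a \<le> i \<Longrightarrow> i \<le> b \<Longrightarrow> v i = (dperm n (s 0) \<circ> w) i"
    \<comment> \<open>For \<open>k = 0\<close> the window consists of two letters and has no
      interior position.\<close>
    by (rule alternating_window[OF adm, of a b]) (use 0(4,5) in auto)
  have "inv (dperm n (s 0)) \<circ> v \<in> sector_codings (s 0)"
    using dperm_sector_codings[OF i0, of "inv (dperm n (s 0)) \<circ> v"] v(1) unfolding inv_dperm_comp by simp
  moreover have "(inv (dperm n (s 0)) \<circ> v) i = w i" if "i \<in> {a..b}" for i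
    using v(2)[of i] that bij_dperm[of "s 0"] by (simp add: bij_is_inj)
  ultimately show ?case by blast
next
  case (Suc k)
  have i0: "s 0 < 2 * n" using Suc.prems(1) two_le by auto
  let ?u = "dperm n (s 0) \<circ> w"
  have adm: "admissible0 n ?u" using iter_gen_admissible[OF Suc.prems(1-3)] unfolding admissible_in_iff .
  have "\<exists>v\<in>sector_codings 0. \<forall>i\<in>{a..b}. v i = ?u i"
  proof (cases "\<forall>i. a < i \<and> i < b \<longrightarrow> sandwiched ?u i")
    case True
    then obtain v where "v \<in> sector_codings 0" "\<And>i. a \<le> i \<Longrightarrow> i \<le> b \<Longrightarrow> v i = ?u i"
      using alternating_window[OF adm, of a b] by blast
    then show ?thesis by (intro bexI[of _ v]) auto
  next
    case False
    then obtain i0 where i0: "a < i0" "i0 < b" "\<not> sandwiched ?u i0" by blast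
    obtain w1 where w1: "w1 \<in> iter_gen n (\<lambda>i. s (Suc i)) k (admissible_words n (s (Suc k)))" "w \<in> gen n (s 0) (s (Suc 0)) w1"
      using Suc.prems(3) unfolding iter_gen_Suc_front by blast
    have s1: "s (Suc 0) \<in> {1..2 * n - 1}" using Suc.prems(2) by auto
    have s': "\<forall>j\<in>{1..k}. s (Suc j) \<in> {1..2 * n - 1}" using Suc.prems(2) by auto
    have adm1: "admissible_in n (s (Suc 0)) w1"
      by (rule iter_gen_admissible[of "\<lambda>i. s (Suc i)" k]) (use s' w1(1) s1 in auto)
    have k: "1 \<le> s (Suc 0)" "s (Suc 0) < 2 * n" using s1 two_le by auto
    obtain f where R: "is_run_sequence (s (Suc 0)) w1 ?u f" using gen_run_sequence[OF adm1 k w1(2)] .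
    note sm = run_sequence_strict_mono[OF R] and w1w = admissible_inD(1)[OF adm1]
    have sf: "sandwiched ?u (f m)" for m
      using run_sequence_anchor(2,3)[OF R w1w k(2), of m] by (simp add: sandwiched_def)
    obtain m1 where m1: "f m1 \<le> a" "a < f (m1 + 1)" using int_int_block[OF sm] .
    \<comment> \<open>Locating \<open>b - 1\<close> instead of \<open>b\<close> makes
      \<open>m2 + 1\<close> the first anchor at or after \<open>b\<close>.\<close>
    obtain m2 where m2: "f m2 \<le> b - 1" "b - 1 < f (m2 + 1)" using int_int_block[OF sm] .
    have m12: "m1 < m2 + 1" using m1(1) m2(2) Suc.prems(4) sm by (metis diff_add_cancel less_diff_eq linorder_not_less order.strict_trans1 strict_mono_less zle_diff1_eq le_less_trans)
    \<comment> \<open>Anchors are sandwiched, so those strictly inside the window avoid the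
      unsandwiched position \<open>i0\<close>. Hence the window \<open>{m1..m2 + 1}\<close> of the
      derived word is shorter by at least one, which pays for the operator removed.\<close>
    have "card {m1 + 1..m2} \<le> card ({a + 1..b - 1} - {i0})"
    proof (rule card_inj_on_le[of f])
      show "inj_on f {m1 + 1..m2}" using sm by (meson inj_on_subset strict_mono_imp_inj_on subset_UNIV)
      show "f ` {m1 + 1..m2} \<subseteq> {a + 1..b - 1} - {i0}"
      proof
        fix y assume "y \<in> f ` {m1 + 1..m2}"
        then obtain m where m: "m1 + 1 \<le> m" "m \<le> m2" "y = f m" by auto
        then have "f (m1 + 1) \<le> y" "y \<le> f m2" using sm by (simp_all add: strict_mono_less_eq)
        then show "y \<in> {a + 1..b - 1} - {i0}" using m1 m2 sf i0(3) m(3) by auto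
      qed
    qed simp
    then have "nat (m2 - m1) \<le> nat (b - a - 1) - 1" using i0(1,2) by (simp add: card_Diff_singleton)
    then have sz: "m2 + 1 - m1 \<le> b - a - 1" using m12 i0(1,2) by linarith
    have "\<exists>v\<in>sector_codings (s (Suc 0)). \<forall>i\<in>{m1..m2 + 1}. v i = w1 i"
      by (rule Suc.IH[of "\<lambda>i. s (Suc i)"]) (use s' s1 w1(1) m12 sz Suc.prems(5) in auto)
    then obtain u1 where u1: "u1 \<in> sector_codings (s (Suc 0))" "\<And>i. m1 \<le> i \<Longrightarrow> i \<le> m2 + 1 \<Longrightarrow> u1 i = w1 i" by auto
    obtain \<theta>' x' where \<theta>': "\<theta>' \<in> sector (s (Suc 0))" and c: "is_coding \<theta>' u1 x'"
      using u1(1) unfolding sector_codings_def codings_def by blast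
    have "dperm n (s (Suc 0)) \<circ> u1 \<in> sector_codings 0" using dperm_sector_codings[OF k(2)] u1(1) by simp
    then have "dperm n (s (Suc 0)) \<circ> u1 \<in> window_closure (sector_codings 0)" unfolding window_closure_def by blast
    then have adu: "admissible_in n (s (Suc 0)) u1"
      unfolding admissible_in_iff by (rule window_closure_admissible0)
    have "run_start (s (Suc 0)) (u1 m) < run_end (s (Suc 0)) (u1 (m + 1))" for m
      using run_start_less_run_end[OF k] wordsD[OF admissible_inD(1)[OF adu]] admissible_inD(3)[OF adu] by blast
    \<comment> \<open>The runs generated from \<open>u1\<close> and \<open>w1\<close> agree as long
      as the letters do, so aligning them at \<open>m1\<close> aligns them up to
      \<open>m2 + 1\<close>.\<close>
    from run_sequence_exists[of "s (Suc 0)" u1, OF this admissible_inD(1)[OF adu]]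
    obtain v g where R': "is_run_sequence (s (Suc 0)) u1 v g" and g: "g m1 = f m1" by metis
    obtain \<theta> x where "0 \<le> \<theta>" "\<theta> \<le> h" "is_coding \<theta> v x" using run_sequence_coding[OF c \<theta>' k R'] .
    then have v0: "v \<in> sector_codings 0" unfolding sector_codings_def codings_def sector_def by auto
    have fg: "m \<le> m2 + 1 \<longrightarrow> g m = f m" if "m1 \<le> m" for m
      using that
    proof (induction m rule: int_ge_induct)
      case (step m)
      show ?case
        using step is_run_sequenceD(2)[OF R, of m] is_run_sequenceD(2)[OF R', of m] u1(2)[of m] u1(2)[of "m + 1"] by simp
    qed (simp add: g)
    have "v i = ?u i" if i: "i \<in> {a..b}" for i
    proof -
      obtain m t where mt: "i = f m + int t" "t < run_end (s (Suc 0)) (w1 (m + 1)) - run_start (s (Suc 0)) (w1 m)"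
        using run_sequence_position[OF R] .
      have lt: "i < f (m + 1)" using mt is_run_sequenceD(2)[OF R, of m] by simp
      have "f m1 < f (m + 1)" using lt m1(1) i by simp
      then have mm: "m1 \<le> m" using sm by (simp add: strict_mono_less)
      show ?thesis
      proof (cases "m \<le> m2")
        case True
        then have e: "u1 m = w1 m" "u1 (m + 1) = w1 (m + 1)" "g m = f m" using u1(2) fg mm by auto
        show ?thesis
          using is_run_sequenceD(3)[OF R', where m = m and t = t] is_run_sequenceD(3)[OF R, where m = m and t = t] mt e by simp
      next
        case False
        \<comment> \<open>Only \<open>i = b\<close> can occur here, namely when \<open>b\<close> is
          itself an anchor.\<close>
        then have "f (m2 + 1) \<le> f m" using sm by (simp add: strict_mono_less_eq)
        then have "i = f (m2 + 1)" using mt(1) m2(2) i by simp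
        moreover have "g (m2 + 1) = f (m2 + 1)" "u1 (m2 + 1) = w1 (m2 + 1)" using fg[of "m2 + 1"] u1(2) m12 by auto
        ultimately show ?thesis
          using run_sequence_anchor(1)[OF R' admissible_inD(1)[OF adu] k(2), of "m2 + 1"]
            run_sequence_anchor(1)[OF R w1w k(2), of "m2 + 1"] by simp
      qed
    qed
    then show ?thesis using v0 by blast
  qed
  then obtain v where v: "v \<in> sector_codings 0" "\<And>i. a \<le> i \<Longrightarrow> i \<le> b \<Longrightarrow> v i = ?u i" by auto
  have "inv (dperm n (s 0)) \<circ> v \<in> sector_codings (s 0)"
    using dperm_sector_codings[OF i0, of "inv (dperm n (s 0)) \<circ> v"] v(1) unfolding inv_dperm_comp by simp
  moreover have "(inv (dperm n (s 0)) \<circ> v) i = w i" if "i \<in> {a..b}" for i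
    using v(2)[of i] that bij_dperm[of "s 0"] by (simp add: bij_is_inj)
  ultimately show ?case by blast
qed

end

theorem theorem6p3p2:
  fixes n :: nat and r :: real
  assumes "n \<ge> 3" and "r > 0"
  shows "product_topology (\<lambda>_ :: int. discrete_topology {1..n}) UNIV closure_of cutting_sequences n r
           = {w \<in> words n. infinitely_coherent n w} \<and>
         product_topology (\<lambda>_ :: int. discrete_topology {1..n}) UNIV closure_of cutting_sequences n r
           = (\<Inter>k :: nat. \<Union>s \<in> {s :: nat \<Rightarrow> nat. s 0 \<in> {0..2 * n - 1} \<and>
                                            (\<forall>j\<in>{1..k}. s j \<in> {1..2 * n - 1})}.
                iter_gen n s k (admissible_words n (s k)))"
    (is "?closure = ?coherent \<and> _ = ?generated")
proof -
  interpret even_gon n by unfold_locales (use assms(1) in simp)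
  have cut: "cutting_sequences n r = (\<Union>i<2 * n. sector_codings i)"
    unfolding cutting_sequences_eq[OF assms(2)] Union_codings ..
  then have words: "cutting_sequences n r \<subseteq> words n" using sector_codings_words by blast
  have cl: "?closure = window_closure (\<Union>i<2 * n. sector_codings i)"
    using closure_of_words[OF words] unfolding cut .
  have 1: "w \<in> ?coherent" if w: "w \<in> ?closure" for w
  proof -
    obtain i where "i \<in> {..<2 * n}" and i: "w \<in> window_closure (sector_codings i)"
      using window_closure_finite_Union[of "{..<2 * n}" w sector_codings] w unfolding cl by blast
    then have i2: "i < 2 * n" by simp
    have "w \<in> words n"
      using window_closure_admissible0[OF dperm_window_closure[OF i2 i]] admissible_in_iff admissible_inD(1) by blast
    then show ?thesis using window_closure_infinitely_coherent[OF i2 i] by blast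
  qed
  have 2: "w \<in> ?generated" if "w \<in> ?coherent" for w
  proof -
    obtain s where s: "s 0 \<in> {0..2 * n - 1}" "\<And>k. 1 \<le> k \<Longrightarrow> s k \<in> {1..2 * n - 1}"
      and c: "\<And>k. coherent n (s k) (s (Suc k)) (normalized_derived n s w k)"
      using \<open>w \<in> ?coherent\<close> unfolding infinitely_coherent_def by blast
    have "w \<in> iter_gen n s k (admissible_words n (s k))" for k
    proof (rule coherent_iter_gen[OF c])
      show "normalized_derived n s w k \<in> admissible_words n (s k)"
        using c[of k] unfolding coherent_def admissible_words_def by (simp add: admissible_in_def)
    qed
    moreover have "s \<in> {s. s 0 \<in> {0..2 * n - 1} \<and> (\<forall>j\<in>{1..k}. s j \<in> {1..2 * n - 1})}" for k
      using s by simp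
    ultimately show ?thesis by blast
  qed
  have 3: "w \<in> ?closure" if w: "w \<in> ?generated" for w
    unfolding cl window_closure_def
  proof (intro CollectI allI)
    fix a b :: int
    \<comment> \<open>A window of length \<open>b - a\<close> needs this many operators; replacing
      \<open>b\<close> by \<open>max b (a + 1)\<close> below ensures two letters even if
      \<open>{a..b}\<close> is empty or a single position.\<close>
    define k where "k = nat (b - a)"
    obtain s where s: "s 0 \<in> {0..2 * n - 1}" "\<forall>j\<in>{1..k}. s j \<in> {1..2 * n - 1}"
      and k: "w \<in> iter_gen n s k (admissible_words n (s k))"
      using w by blast
    have "a < max b (a + 1)" "max b (a + 1) \<le> a + int k + 1" by (auto simp: k_def)
    from iter_gen_window[OF s k this]
    obtain v where v: "v \<in> sector_codings (s 0)" "\<forall>i\<in>{a..max b (a + 1)}. v i = w i" by blast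
    have "s 0 \<in> {..<2 * n}" using s(1) assms(1) by auto
    then have "v \<in> (\<Union>i<2 * n. sector_codings i)" using v(1) by (rule UN_I)
    moreover have "{a..b} \<subseteq> {a..max b (a + 1)}" by auto
    ultimately show "\<exists>v\<in>\<Union>i<2 * n. sector_codings i. \<forall>i\<in>{a..b}. v i = w i"
      using v(2) by (intro bexI[of _ v] ballI) (erule bspec, erule subsetD)
  qed
  have "?closure \<subseteq> ?coherent" by (rule subsetI) (rule 1)
  moreover have "?coherent \<subseteq> ?generated" by (rule subsetI) (rule 2)
  moreover have "?generated \<subseteq> ?closure" by (rule subsetI) (rule 3)
  ultimately show ?thesis by (intro conjI subset_antisym) (assumption | erule (1) order_trans)+
qed

end
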